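(* Let $G$ be any connected graph (parallel edges and loops allowed). Then: (i) The edge sets of the circles in $|G|$ are the circuits of a matroid $M_{\rm C}(G)$ on $E(G)$ (the cycle matroid of $G$). (ii) The bases of $M_{\rm C}(G)$ are the edge sets of the topological spanning trees of $G$. (iii) $M_{\rm C}(G)$ is the dual of the finite-bond matroid $M_{\rm FB}(G)$.
   Context: Matroids may be infinite. A matroid on a set $E$ is a pair $(E,\mathcal I)$ with $\mathcal I\subseteq 2^E$ such that: (I1) $\emptyset\in\mathcal I$; (I2) $\mathcal I$ is closed under subsets; (I3) for every non-maximal $I\in\mathcal I$ and maximal $I'\in\mathcal I$ there is $x\in I'\setminus I$ with $I\cup\{x\}\in\mathcal I$; (IM) whenever $I\subseteq X\subseteq E$ and $I\in\mathcal I$, the set $\{I'\in\mathcal I: I\subseteq I'\subseteq X\}$ has a maximal element. Bases are maximal independent sets, circuits are minimal dependent sets. The dual $M^*$ of $M$ is the matroid on $E$ whose bases are the complements of the bases of $M$. A cut of $G$ is the set of edges between the two classes of a partition of $V(G)$; a bond is a minimal non-empty cut. $M_{\rm FB}(G)$ is the matroid on $E(G)$ whose circuits are the finite bonds of $G$. The space $|G|$: A ray is a one-way infinite path. Two rays are edge-equivalent if for every finite set $F$ of edges some component of $G-F$ contains subrays of both; the classes are the edge-ends of $G$, forming the set $\mathcal E(G)$. View each edge as a copy of $[0,1]$ and let $X_G$ be the quotient space obtained by identifying these copies at common vertices; $\mathring e$ denotes the set of inner points of the edge $e$. $|G|$ is the space on the point set $X_G\cup\mathcal E(G)$ whose open sets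 are the unions of sets $\widetilde C$, where $C$ is a connected component of $X_G\setminus Z$ for some finite set $Z$ of inner points of edges, and $\widetilde C$ is $C$ together with all edge-ends represented by a ray in $C$. For $X\subseteq|G|$, its edge set is $E(X)=\{e\in E(G):\mathring e\subseteq X\}$. A circle is a subspace of $|G|$ homeomorphic to $S^1$. A standard subspace is the closure in $|G|$ of a subgraph of $G$. A topological spanning tree of $G$ is a standard subspace of $|G|$ that is path-connected, contains $V(G)$, and contains no circle. *)

theory Defs
  imports "HOL-Analysis.Analysis"
begin

text \<open>A graph is given by a vertex set V, an edge set E and an incidence map
  inc assigning to each edge its two (not necessarily distinct) end vertices;
  a loop e has fst (inc e) = snd (inc e). Graphs may be infinite.\<close>

definition graph :: "'v set \<Rightarrow> 'e set \<Rightarrow> ('e \<Rightarrow> 'v \<times> 'v) \<Rightarrow> bool" where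
  "graph V E inc \<longleftrightarrow> (\<forall>e\<in>E. fst (inc e) \<in> V \<and> snd (inc e) \<in> V)"

definition ends_of :: "('e \<Rightarrow> 'v \<times> 'v) \<Rightarrow> 'e \<Rightarrow> 'v set" where
  "ends_of inc e = {fst (inc e), snd (inc e)}"

definition adj_minus :: "'e set \<Rightarrow> ('e \<Rightarrow> 'v \<times> 'v) \<Rightarrow> 'e set \<Rightarrow> 'v \<Rightarrow> 'v \<Rightarrow> bool" where
  "adj_minus E inc F u w \<longleftrightarrow> (\<exists>e\<in>E - F. ends_of inc e = {u, w})"

definition conn_minus :: "'e set \<Rightarrow> ('e \<Rightarrow> 'v \<times> 'v) \<Rightarrow> 'e set \<Rightarrow> 'v \<Rightarrow> 'v \<Rightarrow> bool" where
  "conn_minus E inc F = (adj_minus E inc F)\<^sup>*\<^sup>*"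

definition connected_graph :: "'v set \<Rightarrow> 'e set \<Rightarrow> ('e \<Rightarrow> 'v \<times> 'v) \<Rightarrow> bool" where
  "connected_graph V E inc \<longleftrightarrow> V \<noteq> {} \<and> (\<forall>u\<in>V. \<forall>w\<in>V. conn_minus E inc {} u w)"

definition components_minus :: "'v set \<Rightarrow> 'e set \<Rightarrow> ('e \<Rightarrow> 'v \<times> 'v) \<Rightarrow> 'e set \<Rightarrow> 'v set set" where
  "components_minus V E inc F = {{w\<in>V. conn_minus E inc F v w} | v. v \<in> V}"

definition cut :: "'v set \<Rightarrow> 'e set \<Rightarrow> ('e \<Rightarrow> 'v \<times> 'v) \<Rightarrow> 'e set \<Rightarrow> bool" where
  "cut V E inc D \<longleftrightarrow>
     (\<exists>A\<subseteq>V. D = {e\<in>E. (fst (inc e) \<in> A) \<noteq> (snd (inc e) \<in> A)})"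

definition bond :: "'v set \<Rightarrow> 'e set \<Rightarrow> ('e \<Rightarrow> 'v \<times> 'v) \<Rightarrow> 'e set \<Rightarrow> bool" where
  "bond V E inc D \<longleftrightarrow> cut V E inc D \<and> D \<noteq> {} \<and>
     (\<forall>D'. cut V E inc D' \<and> D' \<noteq> {} \<and> D' \<subseteq> D \<longrightarrow> D' = D)"

type_synonym ('v,'e) ray = "(nat \<Rightarrow> 'v) \<times> (nat \<Rightarrow> 'e)"

definition is_ray :: "'v set \<Rightarrow> 'e set \<Rightarrow> ('e \<Rightarrow> 'v \<times> 'v) \<Rightarrow> ('v,'e) ray \<Rightarrow> bool" where
  "is_ray V E inc R \<longleftrightarrow> inj (fst R) \<and>
     (\<forall>n. fst R n \<in> V \<and> snd R n \<in> E \<and> ends_of inc (snd R n) = {fst R n, fst R (Suc n)})"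

definition subray_in :: "'e set \<Rightarrow> 'v set \<Rightarrow> ('v,'e) ray \<Rightarrow> nat \<Rightarrow> bool" where
  "subray_in F C R k \<longleftrightarrow> (\<forall>n\<ge>k. fst R n \<in> C \<and> snd R n \<notin> F)"

definition edge_equiv :: "'v set \<Rightarrow> 'e set \<Rightarrow> ('e \<Rightarrow> 'v \<times> 'v) \<Rightarrow> ('v,'e) ray \<Rightarrow> ('v,'e) ray \<Rightarrow> bool" where
  "edge_equiv V E inc R1 R2 \<longleftrightarrow> is_ray V E inc R1 \<and> is_ray V E inc R2 \<and>
     (\<forall>F. F \<subseteq> E \<and> finite F \<longrightarrow>
        (\<exists>C\<in>components_minus V E inc F. \<exists>k1 k2. subray_in F C R1 k1 \<and> subray_in F C R2 k2))"

definition edge_ends :: "'v set \<Rightarrow> 'e set \<Rightarrow> ('e \<Rightarrow> 'v \<times> 'v) \<Rightarrow> ('v,'e) ray set set" where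
  "edge_ends V E inc = {{R'. edge_equiv V E inc R R'} | R. is_ray V E inc R}"

text \<open>Points: vertices, inner points Inner e t (0 < t < 1) of edges, and edge-ends.\<close>
datatype ('v,'e) gpoint = Vx 'v | Inner 'e real | End "('v,'e) ray set"

definition edge_map :: "('e \<Rightarrow> 'v \<times> 'v) \<Rightarrow> 'e \<Rightarrow> real \<Rightarrow> ('v,'e) gpoint" where
  "edge_map inc e t = (if t = 0 then Vx (fst (inc e)) else if t = 1 then Vx (snd (inc e)) else Inner e t)"

definition inner_points :: "'e set \<Rightarrow> ('v,'e) gpoint set" where
  "inner_points E = {Inner e t | e t. e \<in> E \<and> 0 < t \<and> t < 1}"

definition inner_of :: "'e \<Rightarrow> ('v,'e) gpoint set" where
  "inner_of e = {Inner e t | t. 0 < t \<and> t < 1}"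

definition XG :: "'v set \<Rightarrow> 'e set \<Rightarrow> ('v,'e) gpoint set" where
  "XG V E = Vx ` V \<union> inner_points E"

text \<open>X_G with the quotient (identification) topology of the edge copies of [0,1].\<close>
definition XG_top :: "'v set \<Rightarrow> 'e set \<Rightarrow> ('e \<Rightarrow> 'v \<times> 'v) \<Rightarrow> ('v,'e) gpoint topology" where
  "XG_top V E inc = topology (\<lambda>U. U \<subseteq> XG V E \<and>
     (\<forall>e\<in>E. openin (top_of_set {0..1}) {t\<in>{0..1::real}. edge_map inc e t \<in> U}))"

definition ray_in_set :: "('v,'e) gpoint set \<Rightarrow> ('v,'e) ray \<Rightarrow> bool" where
  "ray_in_set C R \<longleftrightarrow> (\<forall>n. Vx (fst R n) \<in> C \<and> inner_of (snd R n) \<subseteq> C)"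

definition tilde :: "'v set \<Rightarrow> 'e set \<Rightarrow> ('e \<Rightarrow> 'v \<times> 'v) \<Rightarrow> ('v,'e) gpoint set \<Rightarrow> ('v,'e) gpoint set" where
  "tilde V E inc C = C \<union> {End \<omega> | \<omega>. \<omega> \<in> edge_ends V E inc \<and> (\<exists>R\<in>\<omega>. ray_in_set C R)}"

definition basic_open_sets :: "'v set \<Rightarrow> 'e set \<Rightarrow> ('e \<Rightarrow> 'v \<times> 'v) \<Rightarrow> ('v,'e) gpoint set set" where
  "basic_open_sets V E inc =
     {tilde V E inc C | C Z. finite Z \<and> Z \<subseteq> inner_points E \<and>
        C \<in> connected_components_of (subtopology (XG_top V E inc) (XG V E - Z))}"

definition G_top :: "'v set \<Rightarrow> 'e set \<Rightarrow> ('e \<Rightarrow> 'v \<times> 'v) \<Rightarrow> ('v,'e) gpoint topology" where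
  "G_top V E inc = topology (\<lambda>U. \<exists>\<B>\<subseteq>basic_open_sets V E inc. U = \<Union>\<B>)"

definition edge_set_of :: "'e set \<Rightarrow> ('v,'e) gpoint set \<Rightarrow> 'e set" where
  "edge_set_of E X = {e\<in>E. inner_of e \<subseteq> X}"

definition is_circle :: "'v set \<Rightarrow> 'e set \<Rightarrow> ('e \<Rightarrow> 'v \<times> 'v) \<Rightarrow> ('v,'e) gpoint set \<Rightarrow> bool" where
  "is_circle V E inc X \<longleftrightarrow> X \<subseteq> topspace (G_top V E inc) \<and>
     subtopology (G_top V E inc) X homeomorphic_space top_of_set (sphere (0::complex) 1)"

definition standard_subspace :: "'v set \<Rightarrow> 'e set \<Rightarrow> ('e \<Rightarrow> 'v \<times> 'v) \<Rightarrow> ('v,'e) gpoint set \<Rightarrow> bool" where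
  "standard_subspace V E inc S \<longleftrightarrow>
     (\<exists>V' E'. V' \<subseteq> V \<and> E' \<subseteq> E \<and> (\<forall>e\<in>E'. ends_of inc e \<subseteq> V') \<and>
        S = (G_top V E inc) closure_of (Vx ` V' \<union> \<Union>(inner_of ` E')))"

definition top_spanning_tree :: "'v set \<Rightarrow> 'e set \<Rightarrow> ('e \<Rightarrow> 'v \<times> 'v) \<Rightarrow> ('v,'e) gpoint set \<Rightarrow> bool" where
  "top_spanning_tree V E inc T \<longleftrightarrow> standard_subspace V E inc T \<and>
     path_connectedin (G_top V E inc) T \<and> Vx ` V \<subseteq> T \<and>
     \<not> (\<exists>X\<subseteq>T. is_circle V E inc X)"

definition maximal_in :: "'a set set \<Rightarrow> 'a set \<Rightarrow> bool" where
  "maximal_in \<F> A \<longleftrightarrow> A \<in> \<F> \<and> (\<forall>B\<in>\<F>. A \<subseteq> B \<longrightarrow> B = A)"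

definition matroid :: "'a set \<Rightarrow> 'a set set \<Rightarrow> bool" where
  "matroid E \<I> \<longleftrightarrow> \<I> \<subseteq> Pow E \<and>
     {} \<in> \<I> \<and>
     (\<forall>I\<in>\<I>. \<forall>J. J \<subseteq> I \<longrightarrow> J \<in> \<I>) \<and>
     (\<forall>I I'. I \<in> \<I> \<and> \<not> maximal_in \<I> I \<and> maximal_in \<I> I' \<longrightarrow>
        (\<exists>x\<in>I' - I. insert x I \<in> \<I>)) \<and>
     (\<forall>I X. I \<in> \<I> \<and> I \<subseteq> X \<and> X \<subseteq> E \<longrightarrow>
        (\<exists>M. maximal_in {I'\<in>\<I>. I \<subseteq> I' \<and> I' \<subseteq> X} M))"

definition bases :: "'a set set \<Rightarrow> 'a set set" where
  "bases \<I> = {B. maximal_in \<I> B}"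

definition circuits :: "'a set \<Rightarrow> 'a set set \<Rightarrow> 'a set set" where
  "circuits E \<I> = {C. C \<subseteq> E \<and> C \<notin> \<I> \<and> (\<forall>D. D \<subset> C \<longrightarrow> D \<in> \<I>)}"

end

theory Submission
  imports Defs
begin

text \<open>
  Finite cuts form a family closed under symmetric difference. For such a family W, the sets that
  contain no nonempty member of W are the independent sets of a matroid; its circuits are the minimal
  nonempty members of W, here the finite bonds. The independent sets I of the dual are those in which
  every e is the only element of I in some member of W, and the circuits of the dual are the nonempty
  sets C that no member of W meets in exactly one element but in which any two elements e, f are
  separated by some D in W with D \<inter> C = {e, f}. It remains to recognise the circles and the topological
  spanning trees in these terms.

  A finite cut with side A gives a continuous map from |G| to [0,1] that is 0 on A, 1 off A and linear
  on edges. Together with the inner points of edges these maps determine the topology. Vertices and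
  edge-ends are, up to topological indistinguishability, the ultrafilters of the Boolean algebra of
  vertex sets with finite cut.

  Let P be a minimal set of edges meeting every finite cut that separates x from y. It is linearly
  ordered by the cuts that meet it in a single edge, and it is countable since an edge lies in only
  finitely many bonds of each finite size. Give the edges of P summable lengths; a point of the
  resulting interval that is not inside an edge determines the ultrafilter of those A that contain x
  after being corrected at the finitely many crossings passed so far. This is an arc from x to y.
  Closing it up by one more edge turns every circuit of the dual into a circle, and applied inside a
  base it shows that the closure of the base is path-connected.

  Conversely, a circle cannot cross a finite cut exactly once, and cutting it at two of its edges leaves
  two disjoint compact sets of vertices and ends, which some finite cut separates.
\<close>

section \<open>Matroids of families of finite sets closed under symmetric difference\<close>

text \<open>The space need not be Hausdorff: two vertices that no finite cut separates share all
  their neighbourhoods, and so may a vertex and an end. Hence general facts about arcs in Hausdorff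
  spaces do not apply, and for vertices and ends the working notion of being distinct is separation
  by a finite cut. Points of a path are chosen only up to this relation, except for its two end
  points, which are prescribed. A second obstacle is that a minimal set P of edges between x and y
  can be densely ordered, with no first edge and no successors. No walk along P exists; its order
  has to be read off from cuts, and finitely many cuts see only finitely many crossings at a time.
  Positions inside P come from sums of the lengths of preceding edges, so P must be countable
  although E can have any size. Finiteness of the cuts is also what makes Zorn's lemma apply:
  whether a set meets a finite cut, or meets it in exactly one given edge, is settled at one member
  of a chain.\<close>

lemma Zorn_minimal_of_finite_tests:
  assumes "P Y0"
    and chain: "\<And>\<C>. \<C> \<noteq> {} \<Longrightarrow> (\<And>Y. Y \<in> \<C> \<Longrightarrow> P Y \<and> Y \<subseteq> Y0) \<Longrightarrow>
       (\<And>Y Z. Y \<in> \<C> \<Longrightarrow> Z \<in> \<C> \<Longrightarrow> Y \<subseteq> Z \<or> Z \<subseteq> Y) \<Longrightarrow> P (\<Inter>\<C>)"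
  shows "\<exists>M. P M \<and> M \<subseteq> Y0 \<and> (\<forall>Y. P Y \<longrightarrow> Y \<subseteq> M \<longrightarrow> Y = M)"
proof -
  \<comment> \<open>Passing to complements in Y0 turns the minimal sets sought into maximal elements
    for \<open>subset_Zorn\<close>.\<close>
  let ?F = "(\<lambda>Y. Y0 - Y) ` {Y. P Y \<and> Y \<subseteq> Y0}"
  have "\<exists>M\<in>?F. \<forall>X\<in>?F. M \<subseteq> X \<longrightarrow> X = M"
  proof (rule subset_Zorn)
    fix C assume C: "subset.chain ?F C"
    show "\<exists>U\<in>?F. \<forall>X\<in>C. X \<subseteq> U"
    proof (cases "C = {}")
      case True
      then show ?thesis using assms(1) by auto
    next
      case False
      define D where "D = (\<lambda>Y. Y0 - Y) ` C"
      have D1: "P Y \<and> Y \<subseteq> Y0" if "Y \<in> D" for Y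
      proof -
        from that obtain X where X: "X \<in> C" "Y = Y0 - X" by (auto simp: D_def)
        then obtain Y' where "X = Y0 - Y'" "P Y'" "Y' \<subseteq> Y0" using C
          unfolding subset_chain_def by blast
        then have "Y = Y'" using X by blast
        then show ?thesis using \<open>P Y'\<close> \<open>Y' \<subseteq> Y0\<close> by simp
      qed
      have D2: "Y \<subseteq> Z \<or> Z \<subseteq> Y" if "Y \<in> D" "Z \<in> D" for Y Z
        using that C unfolding D_def subset_chain_def by blast
      have "P (\<Inter>D)" using chain[of D] D1 D2 False by (simp add: D_def)
      moreover have "\<Inter>D \<subseteq> Y0" using False D1 by (auto simp: D_def)
      moreover have "X \<subseteq> Y0 - \<Inter>D" if "X \<in> C" for X
      proof -
        have "Y0 - X \<in> D" using that by (auto simp: D_def)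
        moreover have "X \<subseteq> Y0" using that C unfolding subset_chain_def by blast
        ultimately show ?thesis by blast
      qed
      ultimately show ?thesis by blast
    qed
  qed
  then obtain M where M: "P M" "M \<subseteq> Y0" "\<And>Y. P Y \<Longrightarrow> Y \<subseteq> Y0 \<Longrightarrow> Y0 - M \<subseteq> Y0 - Y \<Longrightarrow> Y0 - Y = Y0 - M"
    by auto
  have "Y = M" if "P Y" "Y \<subseteq> M" for Y
  proof -
    have "Y0 - Y = Y0 - M" using M that by blast
    then show "Y = M" using \<open>Y \<subseteq> M\<close> M(2) by blast
  qed
  then show ?thesis using M(1,2) by blast
qed

lemma maximal_in_mem: "maximal_in F A \<Longrightarrow> A \<in> F"
  unfolding maximal_in_def by blast

lemma maximal_in_eq: "maximal_in F A \<Longrightarrow> B \<in> F \<Longrightarrow> A \<subseteq> B \<Longrightarrow> B = A"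
  unfolding maximal_in_def by blast

lemma Int_eq_iff: "D \<inter> C = S \<longleftrightarrow> S \<subseteq> C \<and> (\<forall>y\<in>C. y \<in> D \<longleftrightarrow> y \<in> S)"
  by auto

lemma sym_diff_Int: "((D - D') \<union> (D' - D)) \<inter> C = (D \<inter> C - D' \<inter> C) \<union> (D' \<inter> C - D \<inter> C)"
  by auto

lemma finite_subset_chain_Union:
  assumes "finite D" "D \<subseteq> \<Union>C" "C \<noteq> {}"
    and "\<And>Y Z. Y \<in> C \<Longrightarrow> Z \<in> C \<Longrightarrow> Y \<subseteq> Z \<or> Z \<subseteq> Y"
  obtains Y where "Y \<in> C" "D \<subseteq> Y"
proof -
  have "subset.chain UNIV C" using assms(4) unfolding subset_chain_def by blast
  then obtain Y where "Y \<in> C" "D \<subseteq> Y" by (rule finite_subset_Union_chain[OF assms(1,2,3)])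
  then show ?thesis by (rule that)
qed

text \<open>The finite set D - \<Inter>C is covered by the complements of the members of C, which
  again form a chain, so a single complement covers it. A property of Y that depends only on D
  \<inter> Y thus passes from the members of a chain to its intersection.\<close>

lemma chain_Inter_finite_test:
  assumes "finite D" "C \<noteq> {}"
    and "\<And>Y Z. Y \<in> C \<Longrightarrow> Z \<in> C \<Longrightarrow> Y \<subseteq> Z \<or> Z \<subseteq> Y"
  obtains Y where "Y \<in> C" "D \<inter> Y = D \<inter> \<Inter>C"
proof -
  have "finite (D - \<Inter>C)" using assms by blast
  moreover have "D - \<Inter>C \<subseteq> \<Union>(uminus ` C)" by auto
  ultimately obtain Y where Y: "Y \<in> uminus ` C" "D - \<Inter>C \<subseteq> Y"
    by (rule finite_subset_chain_Union) (use assms in auto)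
  then have "- Y \<in> C" "D \<inter> - Y = D \<inter> \<Inter>C" by auto
  then show ?thesis by (rule that)
qed

text \<open>A linear subspace, over the field with two elements, of the space of finite subsets of
  E, with symmetric difference as addition.\<close>

locale finite_binary_space =
  fixes E :: "'a set" and W :: "'a set set"
  assumes W_finite: "D \<in> W \<Longrightarrow> finite D"
    and W_sub: "D \<in> W \<Longrightarrow> D \<subseteq> E"
    and W_empty: "{} \<in> W"
    and W_sym_diff: "D \<in> W \<Longrightarrow> D' \<in> W \<Longrightarrow> (D - D') \<union> (D' - D) \<in> W"
begin

section \<open>Independence, span and elimination\<close>

definition indep :: "'a set set" where
  "indep = {J. J \<subseteq> E \<and> (\<forall>D\<in>W. D \<subseteq> J \<longrightarrow> D = {})}"

text \<open>Having a private member of W for each e in I amounts to missing some base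
  (\<open>coindep_iff\<close>). This form mentions no base and can be checked one element at a
  time.\<close>

definition coindep :: "'a set set" where
  "coindep = {I. I \<subseteq> E \<and> (\<forall>e\<in>I. \<exists>D\<in>W. D \<inter> I = {e})}"

lemma coindepD: "I \<in> coindep \<Longrightarrow> e \<in> I \<Longrightarrow> \<exists>D\<in>W. D \<inter> I = {e}"
  unfolding coindep_def by blast

lemma coindepI: "I \<subseteq> E \<Longrightarrow> (\<And>e. e \<in> I \<Longrightarrow> \<exists>D\<in>W. D \<inter> I = {e}) \<Longrightarrow> I \<in> coindep"
  unfolding coindep_def by blast

text \<open>Gaussian elimination. For x in K outside S, the member of W whose only element outside S
  is x can be added to D: this deletes x and changes nothing else outside S. Finitely many such
  additions clear D \<inter> K - S.\<close>

lemma eliminate: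
  assumes "D \<in> W" "\<And>x. x \<in> D \<Longrightarrow> x \<in> K \<Longrightarrow> x \<notin> S \<Longrightarrow> \<exists>D'\<in>W. x \<in> D' \<and> D' \<subseteq> insert x S"
  shows "\<exists>D'\<in>W. D' - S = D - S - K"
  using assms
proof (induction "card (D \<inter> K - S)" arbitrary: D rule: less_induct)
  case less
  show ?case
  proof (cases "D \<inter> K - S = {}")
    case True
    then show ?thesis using less.prems(1) by (intro bexI[of _ D]) auto
  next
    case False
    then obtain x where x: "x \<in> D" "x \<in> K" "x \<notin> S" by auto
    then obtain Dx where Dx: "Dx \<in> W" "x \<in> Dx" "Dx \<subseteq> insert x S" using less.prems(2) by blast
    define D1 where "D1 = (D - Dx) \<union> (Dx - D)"
    have D1: "D1 \<in> W" unfolding D1_def using W_sym_diff less.prems(1) Dx(1) by blast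
    have e: "D1 - S = D - S - {x}" unfolding D1_def using Dx x by blast
    have "D1 \<inter> K - S \<subset> D \<inter> K - S" using e x by blast
    then have "card (D1 \<inter> K - S) < card (D \<inter> K - S)"
      using W_finite[OF less.prems(1)] by (intro psubset_card_mono) auto
    moreover have "\<exists>D'\<in>W. y \<in> D' \<and> D' \<subseteq> insert y S" if "y \<in> D1" "y \<in> K" "y \<notin> S" for y
      using less.prems(2)[of y] that e by blast
    ultimately obtain D' where "D' \<in> W" "D' - S = D1 - S - K" using less.hyps D1 by blast
    then show ?thesis using e x by (intro bexI[of _ D']) auto
  qed
qed

text \<open>Transitivity of the span: if S spans the elements of K that D uses, and D shows that S
  together with K spans x, then S spans x.\<close>

corollary eliminate_single:
  assumes "D \<in> W" "D - S - K = {x}"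
    "\<And>y. y \<in> D \<Longrightarrow> y \<in> K \<Longrightarrow> y \<notin> S \<Longrightarrow> \<exists>D'\<in>W. y \<in> D' \<and> D' \<subseteq> insert y S"
  shows "\<exists>D'\<in>W. x \<in> D' \<and> D' \<subseteq> insert x S"
proof -
  obtain D' where D': "D' \<in> W" "D' - S = {x}"
    using eliminate[of D K S, OF assms(1) assms(3)] assms(2) by auto
  then have "x \<in> D'" "D' \<subseteq> insert x S" by auto
  then show ?thesis using D' by blast
qed

lemma indep_subset: "J \<in> indep \<Longrightarrow> J \<subseteq> E"
  unfolding indep_def by blast

lemma indep_sub: "J \<in> indep \<Longrightarrow> J' \<subseteq> J \<Longrightarrow> J' \<in> indep"
  unfolding indep_def by blast

lemma indep_insertI:
  assumes "J \<in> indep" "x \<in> E" "insert x J \<notin> indep"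
  shows "\<exists>D\<in>W. x \<in> D \<and> D \<subseteq> insert x J"
  using assms unfolding indep_def by blast

text \<open>Independence is of finite character: a member of W inside the union of a chain is finite
  and hence lies in one set of the chain.\<close>

lemma indep_extend:
  assumes "J \<in> indep" "J \<subseteq> X" "X \<subseteq> E"
  obtains B where "maximal_in {J'\<in>indep. J \<subseteq> J' \<and> J' \<subseteq> X} B"
proof -
  let ?F = "{J'\<in>indep. J \<subseteq> J' \<and> J' \<subseteq> X}"
  have "\<exists>M\<in>?F. \<forall>X\<in>?F. M \<subseteq> X \<longrightarrow> X = M"
  proof (rule subset_Zorn)
    fix C assume C: "subset.chain ?F C"
    show "\<exists>U\<in>?F. \<forall>X\<in>C. X \<subseteq> U"
    proof (cases "C = {}")
      case True
      then show ?thesis using assms by auto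
    next
      case False
      have "\<Union>C \<in> indep" unfolding indep_def
      proof (clarify, intro conjI ballI impI)
        show "\<Union>C \<subseteq> E" using C assms(3) unfolding subset_chain_def by blast
        fix D assume D: "D \<in> W" "D \<subseteq> \<Union>C"
        have "\<And>Y Z. Y \<in> C \<Longrightarrow> Z \<in> C \<Longrightarrow> Y \<subseteq> Z \<or> Z \<subseteq> Y"
          using C unfolding subset_chain_def by blast
        then obtain Y where "Y \<in> C" "D \<subseteq> Y"
          using finite_subset_chain_Union[OF W_finite[OF D(1)] D(2) False] by metis
        moreover have "Y \<in> indep" using C \<open>Y \<in> C\<close> unfolding subset_chain_def by blast
        ultimately show "D = {}" using D unfolding indep_def by blast
      qed
      moreover have "J \<subseteq> \<Union>C" "\<Union>C \<subseteq> X" using C False unfolding subset_chain_def by blast+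
      ultimately show ?thesis by blast
    qed
  qed
  then show ?thesis using that unfolding maximal_in_def by auto
qed

lemma maximal_within_spans:
  assumes "maximal_in {J'\<in>indep. J \<subseteq> J' \<and> J' \<subseteq> X} B" "X \<subseteq> E" "x \<in> X" "x \<notin> B"
  shows "\<exists>D\<in>W. x \<in> D \<and> D \<subseteq> insert x B"
proof (rule indep_insertI)
  show "B \<in> indep" "x \<in> E" using assms unfolding maximal_in_def by auto
  show "insert x B \<notin> indep" using assms unfolding maximal_in_def by blast
qed

lemma base_iff_spans:
  "maximal_in indep B \<longleftrightarrow> B \<in> indep \<and> (\<forall>x\<in>E - B. \<exists>D\<in>W. x \<in> D \<and> D \<subseteq> insert x B)"
proof
  assume "maximal_in indep B"
  then show "B \<in> indep \<and> (\<forall>x\<in>E - B. \<exists>D\<in>W. x \<in> D \<and> D \<subseteq> insert x B)"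
    using indep_insertI[of B] maximal_in_mem[of indep B] maximal_in_eq[of indep B] by auto
next
  assume a: "B \<in> indep \<and> (\<forall>x\<in>E - B. \<exists>D\<in>W. x \<in> D \<and> D \<subseteq> insert x B)"
  show "maximal_in indep B" unfolding maximal_in_def
  proof (intro conjI ballI impI)
    show "B \<in> indep" using a by simp
    fix B' assume B': "B' \<in> indep" "B \<subseteq> B'"
    show "B' = B"
    proof (rule ccontr)
      assume "B' \<noteq> B"
      then obtain x where x: "x \<in> B'" "x \<notin> B" using B' by blast
      then have "x \<in> E" using B' unfolding indep_def by blast
      then obtain D where "D \<in> W" "x \<in> D" "D \<subseteq> insert x B" using a x by blast
      then show False using B' x unfolding indep_def by blast
    qed
  qed
qed

lemma base_spans:
  "maximal_in indep B \<Longrightarrow> x \<in> E \<Longrightarrow> x \<notin> B \<Longrightarrow> \<exists>D\<in>W. x \<in> D \<and> D \<subseteq> insert x B"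
  unfolding base_iff_spans by blast

lemma base_if_spans:
  assumes "B \<in> indep" "\<And>x. x \<in> E - B \<Longrightarrow> \<exists>D\<in>W. x \<in> D \<and> D \<subseteq> insert x B"
  shows "maximal_in indep B"
  unfolding base_iff_spans using assms by blast

theorem matroid_indep: "matroid E indep"
  unfolding matroid_def
proof (intro conjI allI ballI impI)
  show "indep \<subseteq> Pow E" unfolding indep_def by blast
  show "{} \<in> indep" unfolding indep_def by blast
  show "\<And>I J. I \<in> indep \<Longrightarrow> J \<subseteq> I \<Longrightarrow> J \<in> indep" using indep_sub by blast
  show "\<exists>M. maximal_in {I'\<in>indep. I \<subseteq> I' \<and> I' \<subseteq> X} M" if "I \<in> indep \<and> I \<subseteq> X \<and> X \<subseteq> E" for I X
    using that indep_extend[of I X] by metis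
  fix I I' assume a: "I \<in> indep \<and> \<not> maximal_in indep I \<and> maximal_in indep I'"
  show "\<exists>x\<in>I' - I. insert x I \<in> indep"
  proof (rule ccontr)
    assume no: "\<not> ?thesis"
    have E: "I \<subseteq> E" "I' \<subseteq> E" using a maximal_in_mem[of indep I'] indep_subset by auto
    \<comment> \<open>A set that is not a base fails to span some y. If nothing of I' could be added
      to I, then I would span I', which in turn spans y.\<close>
    obtain y where y: "y \<in> E" "y \<notin> I" "\<not> (\<exists>D\<in>W. y \<in> D \<and> D \<subseteq> insert y I)"
      using base_if_spans[of I] a by auto
    have y': "y \<notin> I'" using no indep_insertI[of I y] a y by auto
    then obtain D where D: "D \<in> W" "y \<in> D" "D \<subseteq> insert y I'" using base_spans[of I' y] a y y' by blast
    have "D - I - I' = {y}" using D y y' by auto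
    moreover have "\<exists>D'\<in>W. x \<in> D' \<and> D' \<subseteq> insert x I" if "x \<in> I'" "x \<notin> I" for x
      by (rule indep_insertI) (use a no E that in auto)
    ultimately show False using y(3) eliminate_single[OF D(1)] by metis
  qed
qed

lemma circuits_indep:
  "circuits E indep = {D\<in>W. D \<noteq> {} \<and> (\<forall>D'\<in>W. D' \<noteq> {} \<longrightarrow> D' \<subseteq> D \<longrightarrow> D' = D)}"
proof (intro equalityI subsetI)
  fix C assume "C \<in> circuits E indep"
  then have C: "C \<subseteq> E" "C \<notin> indep" "\<And>D. D \<subset> C \<Longrightarrow> D \<in> indep" unfolding circuits_def by auto
  then obtain D where D: "D \<in> W" "D \<subseteq> C" "D \<noteq> {}" unfolding indep_def by blast
  have *: "D' = C" if "D' \<in> W" "D' \<noteq> {}" "D' \<subseteq> C" for D'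
    using C(3)[of D'] that unfolding indep_def by blast
  then show "C \<in> {D\<in>W. D \<noteq> {} \<and> (\<forall>D'\<in>W. D' \<noteq> {} \<longrightarrow> D' \<subseteq> D \<longrightarrow> D' = D)}" using D by blast
next
  fix D assume "D \<in> {D\<in>W. D \<noteq> {} \<and> (\<forall>D'\<in>W. D' \<noteq> {} \<longrightarrow> D' \<subseteq> D \<longrightarrow> D' = D)}"
  then have D: "D \<in> W" "D \<noteq> {}" "\<And>D'. D' \<in> W \<Longrightarrow> D' \<noteq> {} \<Longrightarrow> D' \<subseteq> D \<Longrightarrow> D' = D" by auto
  have "J \<in> indep" if "J \<subset> D" for J
    unfolding indep_def using D(3) that W_sub[OF D(1)] by auto
  then show "D \<in> circuits E indep" unfolding circuits_def using D W_sub[OF D(1)] indep_def by auto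
qed

section \<open>The dual matroid\<close>

lemma coindep_iff: "I \<in> coindep \<longleftrightarrow> I \<subseteq> E \<and> (\<exists>B. maximal_in indep B \<and> I \<inter> B = {})"
proof
  assume I: "I \<in> coindep"
  then have IE: "I \<subseteq> E" unfolding coindep_def by blast
  have "{} \<in> indep" unfolding indep_def by blast
  \<comment> \<open>B spans E - I by maximality. For x in I, the member of W that meets I in x alone
    has its remaining elements in E - I, so B spans x as well and is a base.\<close>
  then obtain B where B: "maximal_in {J'\<in>indep. {} \<subseteq> J' \<and> J' \<subseteq> E - I} B"
    using indep_extend[of "{}" "E - I"] by blast
  have BI: "B \<in> indep" "B \<subseteq> E - I" using B unfolding maximal_in_def by auto
  have sp: "\<exists>D\<in>W. x \<in> D \<and> D \<subseteq> insert x B" if "x \<in> E - I" "x \<notin> B" for x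
    using maximal_within_spans[OF B] that by blast
  have "\<exists>D\<in>W. x \<in> D \<and> D \<subseteq> insert x B" if x: "x \<in> E - B" for x
  proof (cases "x \<in> I")
    case True
    then obtain D where D: "D \<in> W" "D \<inter> I = {x}" using I unfolding coindep_def by blast
    have "D - B - (E - I) = {x}" using D W_sub[OF D(1)] x True by auto
    then show ?thesis by (rule eliminate_single[OF D(1)]) (use sp in blast)
  qed (use sp x in blast)
  then have "maximal_in indep B" by (rule base_if_spans[OF BI(1)])
  then show "I \<subseteq> E \<and> (\<exists>B. maximal_in indep B \<and> I \<inter> B = {})" using IE BI by blast
next
  assume "I \<subseteq> E \<and> (\<exists>B. maximal_in indep B \<and> I \<inter> B = {})"
  then obtain B where I: "I \<subseteq> E" and B: "maximal_in indep B" "I \<inter> B = {}" by blast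
  have "\<exists>D\<in>W. D \<inter> I = {e}" if e: "e \<in> I" for e
  proof -
    obtain D where "D \<in> W" "e \<in> D" "D \<subseteq> insert e B" using base_spans[OF B(1), of e] B(2) e I by blast
    then have "D \<inter> I = {e}" using B(2) e by auto
    then show ?thesis using \<open>D \<in> W\<close> by blast
  qed
  then show "I \<in> coindep" unfolding coindep_def using I by blast
qed

lemma coindep_sub: "I \<in> coindep \<Longrightarrow> J \<subseteq> I \<Longrightarrow> J \<in> coindep"
  unfolding coindep_iff by blast

lemma base_sub: "maximal_in indep B \<Longrightarrow> B \<subseteq> E"
  using maximal_in_mem indep_subset by blast

text \<open>A coindependent set larger than E - B would miss a base contained in B, and nested bases
  coincide.\<close>

lemma cobase_iff: "maximal_in coindep I \<longleftrightarrow> (\<exists>B. maximal_in indep B \<and> I = E - B)"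
proof
  assume I: "maximal_in coindep I"
  then obtain B where B: "maximal_in indep B" "I \<inter> B = {}" "I \<subseteq> E"
    using maximal_in_mem coindep_iff by metis
  have "E - B \<in> coindep" unfolding coindep_iff using B by blast
  moreover have "I \<subseteq> E - B" using B by blast
  ultimately have "I = E - B" using maximal_in_eq[OF I] by blast
  then show "\<exists>B. maximal_in indep B \<and> I = E - B" using B by blast
next
  assume "\<exists>B. maximal_in indep B \<and> I = E - B"
  then obtain B where B: "maximal_in indep B" "I = E - B" by blast
  show "maximal_in coindep I" unfolding maximal_in_def
  proof (intro conjI ballI impI)
    show "I \<in> coindep" unfolding coindep_iff using B by blast
    fix I' assume I': "I' \<in> coindep" "I \<subseteq> I'"
    then obtain B' where B': "maximal_in indep B'" "I' \<inter> B' = {}" "I' \<subseteq> E"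
      using coindep_iff by metis
    have "B' \<subseteq> B" using B' B I' base_sub[OF B'(1)] by blast
    then have "B = B'" using maximal_in_eq[OF B'(1) maximal_in_mem[OF B(1)]] by blast
    then show "I' = I" using B B' I' by auto
  qed
qed

lemma bases_coindep: "bases coindep = {E - B | B. B \<in> bases indep}"
  unfolding bases_def using cobase_iff by auto

theorem matroid_coindep: "matroid E coindep"
  unfolding matroid_def
proof (intro conjI allI ballI impI)
  show "coindep \<subseteq> Pow E" unfolding coindep_def by blast
  show "{} \<in> coindep" unfolding coindep_def by blast
  show "\<And>I J. I \<in> coindep \<Longrightarrow> J \<subseteq> I \<Longrightarrow> J \<in> coindep" using coindep_sub by blast
next
  fix I I' assume a: "I \<in> coindep \<and> \<not> maximal_in coindep I \<and> maximal_in coindep I'"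
  then obtain B where B: "maximal_in indep B" "I \<inter> B = {}" and IE: "I \<subseteq> E"
    using coindep_iff by auto
  obtain B' where B': "maximal_in indep B'" "I' = E - B'" using a cobase_iff by auto
  have "B' \<inter> (E - I) \<in> indep" using indep_sub[OF maximal_in_mem[OF B'(1)]] by blast
  \<comment> \<open>Keeping B' - I inside B2 forces every element of E - I outside B2 out of B',
    that is, into I'. Since B lies in E - I and spans E, so does B2; and B2 is not all of E - I
    because I is not maximal.\<close>
  then obtain B2 where B2: "maximal_in {J'\<in>indep. B' \<inter> (E - I) \<subseteq> J' \<and> J' \<subseteq> E - I} B2"
    using indep_extend[of "B' \<inter> (E - I)" "E - I"] by blast
  have B2': "B2 \<in> indep" "B' \<inter> (E - I) \<subseteq> B2" "B2 \<subseteq> E - I" using B2 unfolding maximal_in_def by auto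
  have sp: "\<exists>D\<in>W. x \<in> D \<and> D \<subseteq> insert x B2" if "x \<in> E - I" "x \<notin> B2" for x
    using maximal_within_spans[OF B2] that by blast
  have "\<exists>D\<in>W. x \<in> D \<and> D \<subseteq> insert x B2" if x: "x \<in> E - B2" for x
  proof (cases "x \<in> I")
    case True
    then have "x \<notin> B" using B by blast
    then obtain D where D: "D \<in> W" "x \<in> D" "D \<subseteq> insert x B" using base_spans[OF B(1), of x] x by blast
    have "D - B2 - B = {x}" using D x \<open>x \<notin> B\<close> by auto
    then show ?thesis by (rule eliminate_single[OF D(1)]) (use sp base_sub[OF B(1)] B(2) in blast)
  qed (use sp x in blast)
  then have base2: "maximal_in indep B2" by (rule base_if_spans[OF B2'(1)])
  have "B2 \<noteq> E - I"
  proof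
    assume "B2 = E - I"
    then have "I = E - B2" using IE by auto
    then show False using a base2 cobase_iff by auto
  qed
  then obtain x where x: "x \<in> E" "x \<notin> I" "x \<notin> B2" using B2' by blast
  then have "x \<in> I' - I" using B' B2' by blast
  moreover have "insert x I \<in> coindep" unfolding coindep_iff using base2 x IE B2' by blast
  ultimately show "\<exists>x\<in>I' - I. insert x I \<in> coindep" by blast
next
  fix I X assume a: "I \<in> coindep \<and> I \<subseteq> X \<and> X \<subseteq> E"
  then obtain B where B: "maximal_in indep B" "I \<inter> B = {}" using coindep_iff by auto
  have "{} \<in> indep" unfolding indep_def by blast
  \<comment> \<open>The order of the two extensions matters. Choosing B1 inside E - X before
    enlarging it inside E - I makes B1 alone span E - X, so a member of W can later be cleared of E
    - X without changing its elements in X.\<close>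
  then obtain B1 where B1: "maximal_in {J'\<in>indep. {} \<subseteq> J' \<and> J' \<subseteq> E - X} B1"
    using indep_extend[of "{}" "E - X"] by blast
  have B1': "B1 \<in> indep" "B1 \<subseteq> E - X" using B1 unfolding maximal_in_def by auto
  have sp1: "\<exists>D\<in>W. x \<in> D \<and> D \<subseteq> insert x B1" if "x \<in> E - X" "x \<notin> B1" for x
    using maximal_within_spans[OF B1] that by blast
  obtain B2 where B2: "maximal_in {J'\<in>indep. B1 \<subseteq> J' \<and> J' \<subseteq> E - I} B2"
    using indep_extend[of B1 "E - I"] B1' a by blast
  have B2': "B2 \<in> indep" "B1 \<subseteq> B2" "B2 \<subseteq> E - I" using B2 unfolding maximal_in_def by auto
  have sp: "\<exists>D\<in>W. x \<in> D \<and> D \<subseteq> insert x B2" if "x \<in> E - I" "x \<notin> B2" for x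
    using maximal_within_spans[OF B2] that by blast
  have "\<exists>D\<in>W. x \<in> D \<and> D \<subseteq> insert x B2" if x: "x \<in> E - B2" for x
  proof (cases "x \<in> I")
    case True
    then have "x \<notin> B" using B by blast
    then obtain D where D: "D \<in> W" "x \<in> D" "D \<subseteq> insert x B" using base_spans[OF B(1), of x] x by blast
    have "D - B2 - B = {x}" using D x \<open>x \<notin> B\<close> by auto
    then show ?thesis by (rule eliminate_single[OF D(1)]) (use sp base_sub[OF B(1)] B(2) in blast)
  qed (use sp x in blast)
  then have base2: "maximal_in indep B2" by (rule base_if_spans[OF B2'(1)])
  have "maximal_in {I'\<in>coindep. I \<subseteq> I' \<and> I' \<subseteq> X} (X - B2)"
    unfolding maximal_in_def
  proof (intro conjI ballI impI)
    show "X - B2 \<in> {I'\<in>coindep. I \<subseteq> I' \<and> I' \<subseteq> X}"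
      using base2 B2' a unfolding coindep_iff by blast
    fix I' assume "I' \<in> {I'\<in>coindep. I \<subseteq> I' \<and> I' \<subseteq> X}" and s: "X - B2 \<subseteq> I'"
    then have I': "I' \<in> coindep" "I \<subseteq> I'" "I' \<subseteq> X" by auto
    show "I' = X - B2"
    proof (rule ccontr)
      assume "I' \<noteq> X - B2"
      then obtain x where x: "x \<in> I'" "x \<in> B2" "x \<in> X" using s I' by blast
      then obtain D where D: "D \<in> W" "D \<inter> I' = {x}" using I' unfolding coindep_def by blast
      \<comment> \<open>Outside B1, the cleared member consists of x and elements of X that are not
        in I', all of which lie in B2. It would be a nonempty member of W inside the independent set
        B2.\<close>
      have "\<exists>D'\<in>W. D' - B1 = D - B1 - (E - X)"
        by (rule eliminate[OF D(1)]) (use sp1 in blast)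
      then obtain D' where D': "D' \<in> W" "D' - B1 = D - B1 - (E - X)" by blast
      have "x \<in> D'" using D D' x B1' by blast
      moreover have "D' \<subseteq> B2" 
      proof
        fix y assume "y \<in> D'"
        show "y \<in> B2"
        proof (cases "y \<in> B1")
          case False
          then have "y \<in> D" "y \<in> X" using \<open>y \<in> D'\<close> D'(2) W_sub[OF D(1)] by auto
          then show ?thesis using D(2) s x(2) by auto
        qed (use B2' in auto)
      qed
      ultimately show False using B2' D' unfolding indep_def by blast
    qed
  qed
  then show "\<exists>M. maximal_in {I'\<in>coindep. I \<subseteq> I' \<and> I' \<subseteq> X} M" by blast
qed

text \<open>Since C - {f} is independent in the dual, some D meets it in e alone; D cannot meet all
  of C in e alone, so it contains f. Conversely, a proper subset of C misses some f, and the member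
  with trace {e, f} on C isolates e in that subset.\<close>

lemma cocircuit_iff:
  "C \<in> circuits E coindep \<longleftrightarrow> C \<subseteq> E \<and> C \<noteq> {} \<and> (\<forall>D\<in>W. \<forall>e. D \<inter> C \<noteq> {e}) \<and>
     (\<forall>e\<in>C. \<forall>f\<in>C. e \<noteq> f \<longrightarrow> (\<exists>D\<in>W. D \<inter> C = {e, f}))"
proof
  assume "C \<in> circuits E coindep"
  then have C: "C \<subseteq> E" "C \<notin> coindep" "\<And>D. D \<subset> C \<Longrightarrow> D \<in> coindep" unfolding circuits_def by auto
  have ne: "C \<noteq> {}" using C(2) unfolding coindep_def by blast
  have no1: "D \<inter> C \<noteq> {e}" if D: "D \<in> W" for D e
  proof
    assume De: "D \<inter> C = {e}"
    then have e: "e \<in> C" by blast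
    then have ci: "C - {e} \<in> coindep" using C(3) by blast
    have "\<exists>D\<in>W. D \<inter> C = {f}" if f: "f \<in> C" for f
    proof (cases "f = e")
      case False
      then obtain D2 where D2: "D2 \<in> W" "D2 \<inter> (C - {e}) = {f}" using coindepD[OF ci, of f] f by auto
      show ?thesis
      proof (cases "e \<in> D2")
        case True
        have "((D2 - D) \<union> (D - D2)) \<inter> C = {f}" unfolding Int_eq_iff using D2(2)[unfolded Int_eq_iff] De[unfolded Int_eq_iff] True False f by auto
        then show ?thesis using W_sym_diff[OF D2(1) D] by blast
      next
        case False
        then have "D2 \<inter> C = {f}" using D2(2) by auto
        then show ?thesis using D2 by blast
      qed
    qed (use D De in blast)
    then show False using C(2) coindepI[OF C(1)] by auto
  qed
  have two: "\<exists>D\<in>W. D \<inter> C = {e, f}" if ef: "e \<in> C" "f \<in> C" "e \<noteq> f" for e f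
  proof -
    have "C - {f} \<in> coindep" using C(3) ef by blast
    then obtain D where D: "D \<in> W" "D \<inter> (C - {f}) = {e}" using coindepD[of "C - {f}" e] ef by auto
    then have "f \<in> D" using no1[OF D(1), of e] ef by blast
    then have "D \<inter> C = {e, f}" using D(2) ef by auto
    then show ?thesis using D by blast
  qed
  then show "C \<subseteq> E \<and> C \<noteq> {} \<and> (\<forall>D\<in>W. \<forall>e. D \<inter> C \<noteq> {e}) \<and>
     (\<forall>e\<in>C. \<forall>f\<in>C. e \<noteq> f \<longrightarrow> (\<exists>D\<in>W. D \<inter> C = {e, f}))" by (intro conjI ballI allI impI C(1) ne no1 two)
next
  assume a: "C \<subseteq> E \<and> C \<noteq> {} \<and> (\<forall>D\<in>W. \<forall>e. D \<inter> C \<noteq> {e}) \<and>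
     (\<forall>e\<in>C. \<forall>f\<in>C. e \<noteq> f \<longrightarrow> (\<exists>D\<in>W. D \<inter> C = {e, f}))"
  have "D \<in> coindep" if D: "D \<subset> C" for D
  proof -
    obtain f where f: "f \<in> C" "f \<notin> D" using D by blast
    have "\<exists>F\<in>W. F \<inter> D = {e}" if "e \<in> D" for e
    proof -
      have "e \<in> C" "e \<noteq> f" using that D f by blast+
      then obtain F where F: "F \<in> W" "F \<inter> C = {e, f}" using a f by metis
      have "F \<inter> D = {e}" using that D f F(2) by auto
      then show ?thesis using \<open>F \<in> W\<close> by blast
    qed
    then show ?thesis using D a by (intro coindepI) auto
  qed
  moreover have "C \<notin> coindep" using a coindepD[of C] by auto
  ultimately show "C \<in> circuits E coindep" unfolding circuits_def using a by simp
qed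

text \<open>In an infinite matroid a dependent set has no obvious minimal dependent subset. Fixing
  an element e that no D isolates turns the requirement into a condition on finite traces, so Zorn's
  lemma gives a minimal Y. Minimality yields the traces {e, f}, and two of these add up to a trace
  {f, g}.\<close>

lemma codependent_contains_cocircuit:
  assumes "Y0 \<subseteq> E" "Y0 \<notin> coindep"
  obtains C where "C \<in> circuits E coindep" "C \<subseteq> Y0"
proof -
  obtain e where e: "e \<in> Y0" "\<And>D. D \<in> W \<Longrightarrow> D \<inter> Y0 \<noteq> {e}" using assms unfolding coindep_def by blast
  define P where "P Y \<longleftrightarrow> e \<in> Y \<and> (\<forall>D\<in>W. D \<inter> Y \<noteq> {e})" for Y
  have "P Y0" using e P_def by blast
  have chain: "P (\<Inter>\<C>)" if c: "\<C> \<noteq> {}" "\<And>Y. Y \<in> \<C> \<Longrightarrow> P Y \<and> Y \<subseteq> Y0"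
      "\<And>Y Z. Y \<in> \<C> \<Longrightarrow> Z \<in> \<C> \<Longrightarrow> Y \<subseteq> Z \<or> Z \<subseteq> Y" for \<C>
  proof -
    have "D \<inter> \<Inter>\<C> \<noteq> {e}" if D: "D \<in> W" for D
    proof -
      obtain Y where "Y \<in> \<C>" "D \<inter> Y = D \<inter> \<Inter>\<C>"
        using chain_Inter_finite_test[OF W_finite[OF D] c(1) c(3)] by blast
      then show ?thesis using c(2)[of Y] D P_def by auto
    qed
    then show "P (\<Inter>\<C>)" unfolding P_def using c(2) P_def by auto
  qed
  have "\<exists>M. P M \<and> M \<subseteq> Y0 \<and> (\<forall>Y. P Y \<longrightarrow> Y \<subseteq> M \<longrightarrow> Y = M)"
    by (rule Zorn_minimal_of_finite_tests[of P, OF \<open>P Y0\<close> chain])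
  then obtain Y where Y: "P Y" "Y \<subseteq> Y0" and min: "\<And>Z. P Z \<Longrightarrow> Z \<subseteq> Y \<Longrightarrow> Z = Y" by metis
  have eY: "e \<in> Y" "\<And>D. D \<in> W \<Longrightarrow> D \<inter> Y \<noteq> {e}" using Y P_def by auto
  have two: "\<exists>D\<in>W. D \<inter> Y = {e, f}" if f: "f \<in> Y" "f \<noteq> e" for f
  proof -
    have "\<not> P (Y - {f})" using min[of "Y - {f}"] f by auto
    then obtain D where D: "D \<in> W" "D \<inter> (Y - {f}) = {e}" using f eY(1) unfolding P_def by auto
    have "D \<inter> Y = {e, f}" using eY(2)[OF D(1)] D(2) f by auto
    then show ?thesis using D by blast
  qed
  have no1: "D \<inter> Y \<noteq> {f}" if D: "D \<in> W" for D f
  proof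
    assume Df: "D \<inter> Y = {f}"
    then have "f \<in> Y" "f \<noteq> e" using eY(2)[OF D] by auto
    then obtain D2 where D2: "D2 \<in> W" "D2 \<inter> Y = {e, f}" using two by auto
    have "((D - D2) \<union> (D2 - D)) \<inter> Y = {e}" unfolding sym_diff_Int Df D2(2) using \<open>f \<noteq> e\<close> by auto
    then show False using eY(2)[OF W_sym_diff[OF D D2(1)]] by simp
  qed
  have pair: "\<exists>D\<in>W. D \<inter> Y = {f, g}" if fg: "f \<in> Y" "g \<in> Y" "f \<noteq> g" for f g
  proof -
    consider "f = e" | "g = e" | "f \<noteq> e" "g \<noteq> e" by blast
    then show ?thesis
    proof cases
      case 3
      then obtain D1 D2 where D: "D1 \<in> W" "D1 \<inter> Y = {e, f}" "D2 \<in> W" "D2 \<inter> Y = {e, g}"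
        using two fg by metis
      have "((D1 - D2) \<union> (D2 - D1)) \<inter> Y = {f, g}" unfolding sym_diff_Int D(2,4) using 3 fg by auto
      then show ?thesis using W_sym_diff[OF D(1,3)] by blast
    qed (use two fg insert_commute in metis)+
  qed
  then have "Y \<in> circuits E coindep" unfolding cocircuit_iff using Y(2) assms(1) eY(1)
    by (intro conjI ballI allI impI no1 pair) auto
  then show ?thesis using Y that by blast
qed

end

section \<open>Cuts and bonds\<close>

text \<open>The side A is any set of the vertex type, not only a subset of V, so that
  \<open>- A\<close> is again a side. As edges have their ends in V, only A \<inter> V matters
  (\<open>delta_Int_V\<close>).\<close>

definition cutset :: "('e \<Rightarrow> 'v \<times> 'v) \<Rightarrow> 'e set \<Rightarrow> 'v set \<Rightarrow> 'e set" where
  "cutset inc E A = {e\<in>E. (fst (inc e) \<in> A) \<noteq> (snd (inc e) \<in> A)}"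

definition bondset :: "('e \<Rightarrow> 'v \<times> 'v) \<Rightarrow> 'e set \<Rightarrow> 'e set \<Rightarrow> bool" where
  "bondset inc E D \<longleftrightarrow> D \<noteq> {} \<and> (\<exists>A. D = cutset inc E A) \<and>
     (\<forall>A. cutset inc E A \<noteq> {} \<longrightarrow> cutset inc E A \<subseteq> D \<longrightarrow> cutset inc E A = D)"

text \<open>Connectedness in terms of cuts. When it fails after an edge p is deleted, the failure
  itself supplies a cut of the original graph contained in {p}.\<close>

definition cut_connected :: "'v set \<Rightarrow> 'e set \<Rightarrow> ('e \<Rightarrow> 'v \<times> 'v) \<Rightarrow> bool" where
  "cut_connected V E inc \<longleftrightarrow> (\<forall>A. cutset inc E A = {} \<longrightarrow> V \<subseteq> A \<or> V \<inter> A = {})"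

lemma bondset_minimal:
  "bondset inc E D \<Longrightarrow> cutset inc E A \<noteq> {} \<Longrightarrow> cutset inc E A \<subseteq> D \<Longrightarrow> cutset inc E A = D"
  unfolding bondset_def by simp

lemma bondset_cutset: "bondset inc E D \<Longrightarrow> \<exists>A. D = cutset inc E A"
  unfolding bondset_def by simp

lemma bondsetI:
  assumes "cutset inc E A \<noteq> {}"
    "\<And>B. cutset inc E B \<noteq> {} \<Longrightarrow> cutset inc E B \<subseteq> cutset inc E A \<Longrightarrow> cutset inc E B = cutset inc E A"
  shows "bondset inc E (cutset inc E A)"
  unfolding bondset_def using assms by auto

lemma cutset_subset: "cutset inc E A \<subseteq> E"
  unfolding cutset_def by blast

lemma cutset_compl [simp]: "cutset inc E (- A) = cutset inc E A"
  unfolding cutset_def by blast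

lemma cutset_minus: "cutset inc (E - F) A = cutset inc E A - F"
  unfolding cutset_def by blast

lemma cutset_sym_diff:
  "cutset inc E ((A - B) \<union> (B - A)) = (cutset inc E A - cutset inc E B) \<union> (cutset inc E B - cutset inc E A)"
  unfolding cutset_def by blast

lemma cutset_Int: "cutset inc E (A \<inter> B) \<subseteq> cutset inc E A \<union> cutset inc E B"
  unfolding cutset_def by blast

lemma cutset_Un: "cutset inc E (A \<union> B) \<subseteq> cutset inc E A \<union> cutset inc E B"
  unfolding cutset_def by blast

lemma adj_minus_sym: "adj_minus E inc F u w \<Longrightarrow> adj_minus E inc F w u"
  unfolding adj_minus_def by (simp add: insert_commute)

lemma conn_minus_refl [simp]: "conn_minus E inc F u u"
  unfolding conn_minus_def by simp

lemma conn_minus_trans: "conn_minus E inc F u v \<Longrightarrow> conn_minus E inc F v w \<Longrightarrow> conn_minus E inc F u w"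
  unfolding conn_minus_def by simp

lemma conn_minus_sym: "conn_minus E inc F u w \<Longrightarrow> conn_minus E inc F w u"
proof -
  have "symp (adj_minus E inc F)" using adj_minus_sym by (metis sympI)
  then show "conn_minus E inc F u w \<Longrightarrow> conn_minus E inc F w u"
    unfolding conn_minus_def by (meson symp_rtranclp sympD)
qed

lemma adj_minus_crosses:
  assumes "ends_of inc e = {u, w}" "(u \<in> A) \<noteq> (w \<in> A)"
  shows "(fst (inc e) \<in> A) \<noteq> (snd (inc e) \<in> A)"
  using assms unfolding ends_of_def by (auto simp: doubleton_eq_iff)

lemma conn_minus_edge:
  assumes "e \<in> E - F" shows "conn_minus E inc F (fst (inc e)) (snd (inc e))"
  using assms unfolding conn_minus_def adj_minus_def ends_of_def by (intro r_into_rtranclp) blast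

lemma conn_minus_same_side:
  assumes "conn_minus E inc F u w" "cutset inc E A \<subseteq> F"
  shows "u \<in> A \<longleftrightarrow> w \<in> A"
  using assms(1) unfolding conn_minus_def
proof (induction rule: rtranclp_induct)
  case (step y z)
  then obtain e where e: "e \<in> E - F" "ends_of inc e = {y, z}" unfolding adj_minus_def by blast
  then have "e \<notin> cutset inc E A" using assms(2) by blast
  then have "y \<in> A \<longleftrightarrow> z \<in> A" using adj_minus_crosses[OF e(2), of A] e unfolding cutset_def by blast
  then show ?case using step by blast
qed simp

text \<open>Q collects the edges of a walk, forgetting their order: a side that contains one end of
  the walk but not the other must change along one of them.\<close>

lemma path_edges:
  assumes "conn_minus E inc F u w"
  shows "\<exists>Q. finite Q \<and> Q \<subseteq> E - F \<and> (\<forall>A. (u \<in> A) \<noteq> (w \<in> A) \<longrightarrow> cutset inc Q A \<noteq> {})"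
  using assms unfolding conn_minus_def
proof (induction rule: rtranclp_induct)
  case base
  then show ?case by (intro exI[of _ "{}"]) auto
next
  case (step y z)
  then obtain Q where Q: "finite Q" "Q \<subseteq> E - F" "\<And>A. (u \<in> A) \<noteq> (y \<in> A) \<Longrightarrow> cutset inc Q A \<noteq> {}"
    by blast
  obtain e where e: "e \<in> E - F" "ends_of inc e = {y, z}" using step unfolding adj_minus_def by blast
  have "cutset inc (insert e Q) A \<noteq> {}" if "(u \<in> A) \<noteq> (z \<in> A)" for A
  proof (cases "(u \<in> A) \<noteq> (y \<in> A)")
    case True
    then show ?thesis using Q(3)[of A] unfolding cutset_def by blast
  next
    case False
    then show ?thesis using adj_minus_crosses[OF e(2), of A] that unfolding cutset_def by blast
  qed
  then show ?case using Q e by (intro exI[of _ "insert e Q"]) auto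
qed

lemma cut_connected_conn:
  assumes "cut_connected V E inc" "u \<in> V" "w \<in> V"
  shows "conn_minus E inc {} u w"
proof -
  let ?A = "{x. conn_minus E inc {} u x}"
  have "cutset inc E ?A = {}"
  proof -
    have "conn_minus E inc {} u (fst (inc e)) \<longleftrightarrow> conn_minus E inc {} u (snd (inc e))" if "e \<in> E" for e
      using conn_minus_edge[of e E "{}" inc] that conn_minus_trans conn_minus_sym by (metis Diff_empty)
    then show ?thesis unfolding cutset_def by auto
  qed
  then have "V \<subseteq> ?A \<or> V \<inter> ?A = {}" using assms(1) unfolding cut_connected_def by blast
  moreover have "u \<in> V \<inter> ?A" using assms by simp
  ultimately show ?thesis using assms(3) by blast
qed

text \<open>Deleting an edge p of an n-bond leaves an (n-1)-bond, which meets every path between the ends of p.\<close>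

lemma finite_bonds_of_card:
  assumes "cut_connected V E inc" "p \<in> E" "\<And>e. e \<in> E \<Longrightarrow> fst (inc e) \<in> V \<and> snd (inc e) \<in> V"
  shows "finite {D. bondset inc E D \<and> p \<in> D \<and> finite D \<and> card D = n}"
  using assms
proof (induction n arbitrary: E p)
  case 0
  then show ?case by (auto intro: finite_subset[of _ "{}"])
next
  case (Suc n)
  let ?E = "E - {p}"
  show ?case
  proof (cases "cut_connected V ?E inc")
    case False
    then obtain A where A: "cutset inc ?E A = {}" "\<not> V \<subseteq> A" "V \<inter> A \<noteq> {}"
      unfolding cut_connected_def by blast
    have "cutset inc E A \<noteq> {}" using A Suc.prems(1) unfolding cut_connected_def by metis
    \<comment> \<open>Here p is a bridge, and {p} is the only bond through p.\<close>
    then have eq: "cutset inc E A = {p}" using A(1) unfolding cutset_minus by auto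
    have "D = {p}" if "bondset inc E D" "p \<in> D" for D
      using bondset_minimal[OF that(1), of A] that(2) eq by simp
    then have "{D. bondset inc E D \<and> p \<in> D \<and> finite D \<and> card D = Suc n} \<subseteq> {{p}}" by blast
    then show ?thesis by (rule finite_subset) simp
  next
    case True
    let ?a = "fst (inc p)" and ?b = "snd (inc p)"
    have "conn_minus ?E inc {} ?a ?b" using cut_connected_conn[OF True] Suc.prems(2,3) by simp
    from path_edges[OF this] obtain Q where Q: "finite Q" "Q \<subseteq> ?E"
      "\<And>A. (?a \<in> A) \<noteq> (?b \<in> A) \<Longrightarrow> cutset inc Q A \<noteq> {}" by auto
    let ?S = "\<lambda>q. {D. bondset inc ?E D \<and> q \<in> D \<and> finite D \<and> card D = n}"
    have "{D. bondset inc E D \<and> p \<in> D \<and> finite D \<and> card D = Suc n} \<subseteq> insert p ` (\<Union>q\<in>Q. ?S q)"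
    proof
      fix D assume "D \<in> {D. bondset inc E D \<and> p \<in> D \<and> finite D \<and> card D = Suc n}"
      then have D: "bondset inc E D" "p \<in> D" "finite D" "card D = Suc n" by auto
      then obtain A where A: "D = cutset inc E A" using bondset_cutset by metis
      have "(?a \<in> A) \<noteq> (?b \<in> A)" using D(2) unfolding A cutset_def by simp
      then obtain q where q: "q \<in> Q" "q \<in> cutset inc Q A" using Q(3)[of A] cutset_subset[of inc Q A] by blast
      have DA: "D - {p} = cutset inc ?E A" unfolding A cutset_minus by simp
      have qD: "q \<in> D - {p}" using q(2) Q(2) unfolding DA cutset_def by auto
      have min: "cutset inc ?E B = D - {p}" if B: "cutset inc ?E B \<noteq> {}" "cutset inc ?E B \<subseteq> D - {p}" for B
      proof -
        have "cutset inc E B \<noteq> {}" "cutset inc E B \<subseteq> D" using B D(2) unfolding cutset_minus by auto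
        then have "cutset inc E B = D" using bondset_minimal[OF D(1)] by simp
        then show ?thesis unfolding cutset_minus by simp
      qed
      have "bondset inc ?E (D - {p})" unfolding DA by (rule bondsetI) (use qD DA min in auto)
      then have "D - {p} \<in> ?S q" using qD D by auto
      then show "D \<in> insert p ` (\<Union>q\<in>Q. ?S q)" using q D(2) by (intro image_eqI[of _ _ "D - {p}"]) auto
    qed
    moreover have "finite (?S q)" if "q \<in> Q" for q
      using Suc.IH[OF True, of q] that Q(2) Suc.prems(3) by auto
    ultimately show ?thesis using Q(1) by (meson finite_UN_I finite_imageI finite_subset)
  qed
qed

section \<open>Finite cuts of a connected graph\<close>

locale conn_graph =
  fixes V :: "'v set" and E :: "'e set" and inc :: "'e \<Rightarrow> 'v \<times> 'v"
  assumes graph: "graph V E inc" and connected: "connected_graph V E inc"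
begin

abbreviation delta :: "'v set \<Rightarrow> 'e set" where "delta \<equiv> cutset inc E"

definition fincut :: "'v set \<Rightarrow> bool" where "fincut A \<longleftrightarrow> finite (delta A)"

definition fincuts :: "'e set set" where "fincuts = {delta A | A. fincut A}"

lemma ends_in_V: "e \<in> E \<Longrightarrow> fst (inc e) \<in> V" "e \<in> E \<Longrightarrow> snd (inc e) \<in> V"
  using graph unfolding graph_def by auto

lemma in_delta: "e \<in> E \<Longrightarrow> e \<in> delta A \<longleftrightarrow> (fst (inc e) \<in> A) \<noteq> (snd (inc e) \<in> A)"
  unfolding cutset_def by simp

lemma V_nonempty: "V \<noteq> {}" and conn_V: "u \<in> V \<Longrightarrow> w \<in> V \<Longrightarrow> conn_minus E inc {} u w"
  using connected unfolding connected_graph_def by auto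

lemma cut_connected: "cut_connected V E inc"
  unfolding cut_connected_def
proof (intro allI impI)
  fix A assume "delta A = {}"
  then have "u \<in> A \<longleftrightarrow> w \<in> A" if "u \<in> V" "w \<in> V" for u w
    using conn_minus_same_side[OF conn_V[OF that], of A] by simp
  then show "V \<subseteq> A \<or> V \<inter> A = {}" by blast
qed

lemma delta_nonempty: "u \<in> V \<Longrightarrow> w \<in> V \<Longrightarrow> u \<in> A \<Longrightarrow> w \<notin> A \<Longrightarrow> delta A \<noteq> {}"
  using cut_connected unfolding cut_connected_def by blast

lemma delta_Int_V: "delta (A \<inter> V) = delta A"
  unfolding cutset_def using ends_in_V by auto

lemma cut_iff: "cut V E inc D \<longleftrightarrow> (\<exists>A. D = delta A)"
proof
  assume "\<exists>A. D = delta A"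
  then obtain A where "D = delta (A \<inter> V)" using delta_Int_V by auto
  then show "cut V E inc D" unfolding cut_def cutset_def by (intro exI[of _ "A \<inter> V"]) simp
qed (auto simp: cut_def cutset_def)

lemma bond_iff: "bond V E inc D \<longleftrightarrow> bondset inc E D"
  unfolding bond_def bondset_def cut_iff by auto

lemma fincut_compl [simp]: "fincut (- A) \<longleftrightarrow> fincut A"
  unfolding fincut_def by simp

lemma fincut_Int [intro]: "fincut A \<Longrightarrow> fincut B \<Longrightarrow> fincut (A \<inter> B)"
  unfolding fincut_def using cutset_Int finite_subset by (metis finite_UnI)

lemma fincut_Un [intro]: "fincut A \<Longrightarrow> fincut B \<Longrightarrow> fincut (A \<union> B)"
  unfolding fincut_def using cutset_Un finite_subset by (metis finite_UnI)

lemma fincut_Diff [intro]: "fincut A \<Longrightarrow> fincut B \<Longrightarrow> fincut (A - B)"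
  using fincut_Int[of A "- B"] by (simp add: Diff_eq)

lemma fincut_UNIV [simp]: "fincut UNIV" and fincut_empty [simp]: "fincut {}"
  unfolding fincut_def cutset_def by auto

sublocale fbs: finite_binary_space E fincuts
proof
  show "\<And>D. D \<in> fincuts \<Longrightarrow> finite D" unfolding fincuts_def fincut_def by auto
  show "\<And>D. D \<in> fincuts \<Longrightarrow> D \<subseteq> E" unfolding fincuts_def cutset_def by auto
  have "delta {} = {}" unfolding cutset_def by simp
  then show "{} \<in> fincuts" unfolding fincuts_def using fincut_empty by force
  fix D D' assume "D \<in> fincuts" "D' \<in> fincuts"
  then obtain A B where "D = delta A" "D' = delta B" "fincut A" "fincut B" unfolding fincuts_def by blast
  then have "(D - D') \<union> (D' - D) = delta ((A - B) \<union> (B - A))" "fincut ((A - B) \<union> (B - A))"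
    unfolding cutset_sym_diff by auto
  then show "(D - D') \<union> (D' - D) \<in> fincuts" unfolding fincuts_def by blast
qed

text \<open>Every cut inside a finite cut is itself finite, so minimality among finite cuts agrees
  with minimality among all cuts.\<close>

lemma circuits_indep: "circuits E fbs.indep = {D. finite D \<and> bond V E inc D}"
proof -
  have iff: "D \<in> fincuts \<longleftrightarrow> finite D \<and> (\<exists>A. D = delta A)" for D
    unfolding fincuts_def fincut_def by auto
  have "(D \<in> fincuts \<and> D \<noteq> {} \<and> (\<forall>D'\<in>fincuts. D' \<noteq> {} \<longrightarrow> D' \<subseteq> D \<longrightarrow> D' = D)) \<longleftrightarrow>
      finite D \<and> bondset inc E D" for D
  proof (cases "finite D")
    case True
    then have "delta A \<subseteq> D \<Longrightarrow> delta A \<in> fincuts" for A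
      using iff finite_subset by metis
    then have *: "(\<forall>D'\<in>fincuts. D' \<noteq> {} \<longrightarrow> D' \<subseteq> D \<longrightarrow> D' = D) \<longleftrightarrow>
        (\<forall>A. delta A \<noteq> {} \<longrightarrow> delta A \<subseteq> D \<longrightarrow> delta A = D)"
      using iff by metis
    show ?thesis unfolding bondset_def * using True iff by auto
  qed (simp add: iff)
  then show ?thesis unfolding fbs.circuits_indep bond_iff by simp
qed

lemma countable_bonds:
  assumes "countable Q" "Q \<subseteq> E"
  shows "countable {D. bondset inc E D \<and> finite D \<and> D \<inter> Q \<noteq> {}}"
proof -
  let ?S = "\<lambda>p n. {D. bondset inc E D \<and> p \<in> D \<and> finite D \<and> card D = n}"
  have "countable (\<Union>p\<in>Q. \<Union>n. ?S p n)"
    using assms finite_bonds_of_card[OF cut_connected _ conjI[OF ends_in_V]]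
    by (auto intro!: countable_UN intro: countable_finite)
  moreover have "{D. bondset inc E D \<and> finite D \<and> D \<inter> Q \<noteq> {}} \<subseteq> (\<Union>p\<in>Q. \<Union>n. ?S p n)" by auto
  ultimately show ?thesis by (rule countable_subset[rotated])
qed

lemma coindepD: "I \<in> fbs.coindep \<Longrightarrow> e \<in> I \<Longrightarrow> \<exists>A. fincut A \<and> delta A \<inter> I = {e}"
  using fbs.coindepD[of I e] unfolding fincuts_def by blast

lemma cocircuit_iff:
  "C \<in> circuits E fbs.coindep \<longleftrightarrow> C \<subseteq> E \<and> C \<noteq> {} \<and> (\<forall>A. fincut A \<longrightarrow> (\<forall>e. delta A \<inter> C \<noteq> {e})) \<and>
     (\<forall>e\<in>C. \<forall>f\<in>C. e \<noteq> f \<longrightarrow> (\<exists>A. fincut A \<and> delta A \<inter> C = {e, f}))"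
proof -
  have 1: "(\<forall>D\<in>fincuts. P D) \<longleftrightarrow> (\<forall>A. fincut A \<longrightarrow> P (delta A))" for P unfolding fincuts_def by auto
  have 2: "(\<exists>D\<in>fincuts. P D) \<longleftrightarrow> (\<exists>A. fincut A \<and> P (delta A))" for P unfolding fincuts_def by auto
  show ?thesis unfolding fbs.cocircuit_iff 1 2 ..
qed

end

section \<open>Vertices and ends as ultrafilters of finite cuts\<close>

context conn_graph
begin

abbreviation ray :: "('v,'e) ray \<Rightarrow> bool" where "ray \<equiv> is_ray V E inc"
abbreviation equiv_ray :: "('v,'e) ray \<Rightarrow> ('v,'e) ray \<Rightarrow> bool" where "equiv_ray \<equiv> edge_equiv V E inc"
abbreviation conn :: "'e set \<Rightarrow> 'v \<Rightarrow> 'v \<Rightarrow> bool" where "conn \<equiv> conn_minus E inc"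

definition Ends :: "('v,'e) gpoint set" where "Ends = End ` edge_ends V E inc"
definition VE :: "('v,'e) gpoint set" where "VE = Vx ` V \<union> Ends"

definition tail_in :: "'v set \<Rightarrow> ('v,'e) ray \<Rightarrow> bool" where
  "tail_in A R \<longleftrightarrow> (\<exists>k. \<forall>n\<ge>k. fst R n \<in> A)"

text \<open>The sides A with \<open>pin A p\<close> are the ultrafilter of a vertex or end p. For an
  end, any of its rays gives the same answer when the cut of A is finite (\<open>pin_End\<close>).
  Inner points receive the default False.\<close>

fun pin :: "'v set \<Rightarrow> ('v,'e) gpoint \<Rightarrow> bool" where
  "pin A (Vx v) \<longleftrightarrow> v \<in> A"
| "pin A (End \<omega>) \<longleftrightarrow> (\<exists>R\<in>\<omega>. tail_in A R)"
| "pin A (Inner e t) \<longleftrightarrow> False"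

lemma ray_D:
  assumes "ray R"
  shows "fst R n \<in> V" "snd R n \<in> E" "ends_of inc (snd R n) = {fst R n, fst R (Suc n)}" "inj (fst R)"
  using assms unfolding is_ray_def by auto

lemma ray_edges_inj:
  assumes "ray R" shows "inj (snd R)"
proof (rule injI)
  fix m n assume "snd R m = snd R n"
  then have "{fst R m, fst R (Suc m)} = {fst R n, fst R (Suc n)}" using ray_D(3)[OF assms] by metis
  then have "fst R m = fst R n \<or> fst R m = fst R (Suc n) \<and> fst R (Suc m) = fst R n"
    by (auto simp: doubleton_eq_iff)
  then show "m = n"
  proof
    assume "fst R m = fst R n"
    then show ?thesis using ray_D(4)[OF assms] by (auto dest: injD)
  next
    assume "fst R m = fst R (Suc n) \<and> fst R (Suc m) = fst R n"
    then have "m = Suc n" "Suc m = n" using ray_D(4)[OF assms] by (meson injD)+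
    then show ?thesis by simp
  qed
qed

lemma ray_avoids_finite:
  assumes "ray R" "finite F" shows "\<exists>k. \<forall>n\<ge>k. snd R n \<notin> F"
proof -
  have "finite {n. snd R n \<in> F}"
    using finite_vimageI[OF assms(2) ray_edges_inj[OF assms(1)]] by (simp add: vimage_def)
  then obtain k where "\<forall>n\<in>{n. snd R n \<in> F}. n < k" using finite_nat_set_iff_bounded by blast
  then show ?thesis by (intro exI[of _ k]) (auto simp: not_less)
qed

lemma ray_conn_tail:
  assumes "ray R" "\<And>n. n \<ge> k \<Longrightarrow> snd R n \<notin> F" "n \<ge> k"
  shows "conn F (fst R k) (fst R n)"
  using assms(3)
proof (induction n rule: dec_induct)
  case (step n)
  have "adj_minus E inc F (fst R n) (fst R (Suc n))"
    unfolding adj_minus_def using ray_D(2,3)[OF assms(1), of n] assms(2)[OF step(1)] by auto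
  then show ?case using step.IH unfolding conn_minus_def by simp
qed simp

lemma tail_in_or_compl:
  assumes "ray R" "fincut A" shows "tail_in A R \<or> tail_in (- A) R"
proof -
  obtain k where k: "\<forall>n\<ge>k. snd R n \<notin> delta A"
    using ray_avoids_finite[OF assms(1)] assms(2) unfolding fincut_def by blast
  have "fst R k \<in> A \<longleftrightarrow> fst R n \<in> A" if "n \<ge> k" for n
    using conn_minus_same_side[OF ray_conn_tail[OF assms(1) _ that, of "delta A"], of A] k by simp
  then show ?thesis unfolding tail_in_def by (cases "fst R k \<in> A") auto
qed

lemma tail_in_Int: "tail_in (A \<inter> B) R \<longleftrightarrow> tail_in A R \<and> tail_in B R"
proof
  assume "tail_in A R \<and> tail_in B R"
  then obtain k l where "\<forall>n\<ge>k. fst R n \<in> A" "\<forall>n\<ge>l. fst R n \<in> B" unfolding tail_in_def by blast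
  then show "tail_in (A \<inter> B) R" unfolding tail_in_def by (intro exI[of _ "max k l"]) simp
qed (auto simp: tail_in_def)

lemma tail_in_empty [simp]: "\<not> tail_in {} R"
  unfolding tail_in_def by auto

lemma tail_in_compl:
  assumes "ray R" "fincut A" shows "tail_in (- A) R \<longleftrightarrow> \<not> tail_in A R"
  using tail_in_or_compl[OF assms] tail_in_Int[of A "- A" R] by auto

lemma equiv_ray_refl: assumes "ray R" shows "equiv_ray R R"
  unfolding edge_equiv_def
proof (intro conjI allI impI assms)
  fix F assume F: "F \<subseteq> E \<and> finite F"
  then obtain k where k: "\<forall>n\<ge>k. snd R n \<notin> F" using ray_avoids_finite[OF assms] by blast
  let ?C = "{w\<in>V. conn F (fst R k) w}"
  have "?C \<in> components_minus V E inc F" unfolding components_minus_def using ray_D(1)[OF assms] by blast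
  moreover have "subray_in F ?C R k" unfolding subray_in_def
    using k ray_conn_tail[OF assms, of k F] ray_D(1)[OF assms] by auto
  ultimately show "\<exists>C\<in>components_minus V E inc F. \<exists>k1 k2. subray_in F C R k1 \<and> subray_in F C R k2"
    by blast
qed

lemma equiv_ray_conn:
  assumes "equiv_ray R R'" "F \<subseteq> E" "finite F"
  shows "\<exists>k. \<forall>m\<ge>k. \<forall>n\<ge>k. conn F (fst R m) (fst R' n) \<and> snd R m \<notin> F \<and> snd R' n \<notin> F"
proof -
  obtain C k1 k2 where C: "C \<in> components_minus V E inc F" "subray_in F C R k1" "subray_in F C R' k2"
    using assms unfolding edge_equiv_def by blast
  obtain v where v: "C = {w\<in>V. conn F v w}" using C(1) unfolding components_minus_def by blast
  show ?thesis
  proof (intro exI[of _ "max k1 k2"] allI impI)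
    fix m n assume "max k1 k2 \<le> m" "max k1 k2 \<le> n"
    then have "conn F v (fst R m)" "conn F v (fst R' n)" "snd R m \<notin> F" "snd R' n \<notin> F"
      using C(2,3) unfolding v subray_in_def by auto
    then show "conn F (fst R m) (fst R' n) \<and> snd R m \<notin> F \<and> snd R' n \<notin> F"
      using conn_minus_sym conn_minus_trans by metis
  qed
qed

text \<open>Late vertices of the two rays are joined without edges of the finite cut of A, so they
  are all on the same side of it.\<close>

lemma equiv_ray_tail_in:
  assumes "equiv_ray R R'" "fincut A" shows "tail_in A R \<longleftrightarrow> tail_in A R'"
proof -
  obtain k where k: "\<forall>m\<ge>k. \<forall>n\<ge>k. conn (delta A) (fst R m) (fst R' n)"
    using equiv_ray_conn[OF assms(1), of "delta A"] assms(2) cutset_subset unfolding fincut_def by metis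
  have eq: "fst R m \<in> A \<longleftrightarrow> fst R' n \<in> A" if "m \<ge> k" "n \<ge> k" for m n
    by (rule conn_minus_same_side[of E inc "delta A"]) (use k that in auto)
  show ?thesis
  proof
    assume "tail_in A R"
    then obtain l where l: "\<forall>n\<ge>l. fst R n \<in> A" unfolding tail_in_def by blast
    then have "fst R' n \<in> A" if "n \<ge> k" for n using eq[of "max k l" n] that by simp
    then show "tail_in A R'" unfolding tail_in_def by blast
  next
    assume "tail_in A R'"
    then obtain l where l: "\<forall>n\<ge>l. fst R' n \<in> A" unfolding tail_in_def by blast
    then have "fst R n \<in> A" if "n \<ge> k" for n using eq[of n "max k l"] that by simp
    then show "tail_in A R" unfolding tail_in_def by blast
  qed
qed

lemma equiv_ray_rays: "equiv_ray R R' \<Longrightarrow> ray R \<and> ray R'"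
  unfolding edge_equiv_def by blast

lemma end_rays:
  assumes "End \<omega> \<in> Ends" obtains R where "ray R" "R \<in> \<omega>" "\<omega> = {R'. equiv_ray R R'}"
proof -
  have "\<omega> \<in> edge_ends V E inc" using assms unfolding Ends_def by auto
  then obtain R where "ray R" "\<omega> = {R'. equiv_ray R R'}" unfolding edge_ends_def by blast
  then show ?thesis using that equiv_ray_refl by blast
qed

lemma end_of_ray: "ray R \<Longrightarrow> End {R'. equiv_ray R R'} \<in> Ends"
  unfolding Ends_def edge_ends_def by blast

lemma end_ray_ray: "End \<omega> \<in> Ends \<Longrightarrow> R \<in> \<omega> \<Longrightarrow> ray R"
  using end_rays equiv_ray_rays by (metis mem_Collect_eq)

lemma pin_End:
  assumes "End \<omega> \<in> Ends" "R \<in> \<omega>" "fincut A"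
  shows "pin A (End \<omega>) \<longleftrightarrow> tail_in A R"
proof -
  obtain R0 where R0: "\<omega> = {R'. equiv_ray R0 R'}" using end_rays assms(1) by blast
  then have "tail_in A R' \<longleftrightarrow> tail_in A R" if "R' \<in> \<omega>" for R'
    using equiv_ray_tail_in[OF _ assms(3), of R0] assms(2) that by blast
  then have "(\<exists>R'\<in>\<omega>. tail_in A R') \<longleftrightarrow> tail_in A R" using assms(2) by metis
  then show ?thesis by simp
qed

lemma VE_cases:
  assumes "p \<in> VE"
  obtains v where "p = Vx v" "v \<in> V" | \<omega> R where "p = End \<omega>" "End \<omega> \<in> Ends" "ray R" "R \<in> \<omega>"
proof -
  consider v where "p = Vx v" "v \<in> V" | \<omega> where "p = End \<omega>" "End \<omega> \<in> Ends"
    using assms unfolding VE_def Ends_def by auto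
  then show ?thesis using that end_rays by metis
qed

lemma pin_compl: "p \<in> VE \<Longrightarrow> fincut A \<Longrightarrow> pin (- A) p \<longleftrightarrow> \<not> pin A p"
  by (elim VE_cases) (simp_all add: pin_End tail_in_compl del: pin.simps(2))

lemma pin_Int: "p \<in> VE \<Longrightarrow> fincut A \<Longrightarrow> fincut B \<Longrightarrow> pin (A \<inter> B) p \<longleftrightarrow> pin A p \<and> pin B p"
  by (elim VE_cases) (simp_all add: pin_End tail_in_Int fincut_Int del: pin.simps(2))

lemma pin_Un:
  assumes "p \<in> VE" "fincut A" "fincut B" shows "pin (A \<union> B) p \<longleftrightarrow> pin A p \<or> pin B p"
proof -
  have "pin (- (A \<union> B)) p \<longleftrightarrow> pin (- A) p \<and> pin (- B) p"
    unfolding Compl_Un using pin_Int[of p "- A" "- B"] assms by simp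
  then show ?thesis using pin_compl[OF assms(1)] assms(2,3) fincut_Un[OF assms(2,3)] by metis
qed

lemma pin_Diff: "p \<in> VE \<Longrightarrow> fincut A \<Longrightarrow> fincut B \<Longrightarrow> pin (A - B) p \<longleftrightarrow> pin A p \<and> \<not> pin B p"
  using pin_Int[of p A "- B"] pin_compl[of p B] by (simp add: Diff_eq)

lemma pin_empty: "\<not> pin {} p"
  by (cases p) auto

definition adj_in :: "'v set \<Rightarrow> 'v \<Rightarrow> 'v \<Rightarrow> bool" where
  "adj_in A u w \<longleftrightarrow> u \<in> A \<and> w \<in> A \<and> (\<exists>e\<in>E. ends_of inc e = {u, w})"

definition conn_set :: "'v set \<Rightarrow> bool" where
  "conn_set A \<longleftrightarrow> (\<forall>u\<in>A. \<forall>w\<in>A. (adj_in A)\<^sup>*\<^sup>* u w)"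

lemma ends_cases:
  assumes "ends_of inc e = {u, w}"
  obtains "fst (inc e) = u" "snd (inc e) = w" | "fst (inc e) = w" "snd (inc e) = u"
  using assms unfolding ends_of_def by (auto simp: doubleton_eq_iff)

lemma conn_set_same_side:
  assumes "conn_set B" "\<And>e. e \<in> delta A \<Longrightarrow> \<not> ends_of inc e \<subseteq> B" "u \<in> B" "w \<in> B"
  shows "u \<in> A \<longleftrightarrow> w \<in> A"
proof -
  have "(adj_in B)\<^sup>*\<^sup>* u w" using assms(1,3,4) unfolding conn_set_def by simp
  then show ?thesis
  proof (induction rule: rtranclp_induct)
    case (step y z)
    then obtain e where e: "e \<in> E" "ends_of inc e = {y, z}" "y \<in> B" "z \<in> B" unfolding adj_in_def by blast
    then have "e \<notin> delta A" using assms(2)[of e] by auto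
    then have "y \<in> A \<longleftrightarrow> z \<in> A" using e in_delta[OF e(1), of A] ends_cases[OF e(2)] by metis
    then show ?case using step by blast
  qed simp
qed

end

section \<open>Ultrafilters of finite cuts realised by vertices and rays\<close>

locale cut_ultrafilter = conn_graph V E inc for V :: "'v set" and E :: "'e set" and inc +
  fixes U :: "'v set \<Rightarrow> bool"
  assumes U_fincut: "U A \<Longrightarrow> fincut A"
    and U_V: "U V"
    and U_compl: "fincut A \<Longrightarrow> U (- A) \<longleftrightarrow> \<not> U A"
    and U_Int: "U A \<Longrightarrow> U B \<Longrightarrow> U (A \<inter> B)"
    and U_not_empty: "\<not> U {}"
begin

text \<open>A side may contain elements outside V; the axiom \<open>U V\<close> ensures that every
  member contains a vertex of the graph.\<close>

lemma U_Int_V: "U A \<Longrightarrow> U (A \<inter> V)" "U A \<Longrightarrow> A \<inter> V \<noteq> {}"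
  using U_Int[OF _ U_V] U_not_empty by metis+

text \<open>A member with a smallest cut inside a given one is connected: of two separated parts of it
  one belongs to the ultrafilter, with a strictly smaller cut.\<close>

lemma connected_member:
  assumes "U A0"
  obtains A where "U A" "A \<subseteq> A0" "A \<subseteq> V" "conn_set A"
proof -
  let ?P = "\<lambda>A. U A \<and> A \<subseteq> A0 \<inter> V"
  have "?P (A0 \<inter> V)" using assms U_Int_V by simp
  then obtain A where A: "?P A" and min: "\<And>B. ?P B \<Longrightarrow> card (delta A) \<le> card (delta B)"
    using ex_has_least_nat[of ?P "A0 \<inter> V" "\<lambda>A. card (delta A)"] by metis
  have "conn_set A" unfolding conn_set_def
  proof (intro ballI, rule ccontr)
    fix u w assume uw: "u \<in> A" "w \<in> A" "\<not> (adj_in A)\<^sup>*\<^sup>* u w"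
    define X where "X = {x\<in>A. (adj_in A)\<^sup>*\<^sup>* u x}"
    define Y where "Y = A - X"
    have ne: "u \<in> X" "w \<in> Y" "u \<in> V" "w \<in> V" using uw A unfolding X_def Y_def by auto
    have XA: "X \<subseteq> A" "Y \<subseteq> A" "X \<inter> Y = {}" "X \<union> Y = A" unfolding X_def Y_def by auto
    have step: "y \<in> X \<longleftrightarrow> z \<in> X" if "e \<in> E" "ends_of inc e = {y, z}" "y \<in> A" "z \<in> A" for e y z
    proof -
      have "adj_in A y z" "adj_in A z y" using that unfolding adj_in_def by (auto simp: insert_commute)
      then show ?thesis unfolding X_def using that by (auto intro: rtranclp.rtrancl_into_rtrancl)
    qed
    have no: "fst (inc e) \<in> X \<longleftrightarrow> snd (inc e) \<in> X" if "e \<in> E" "fst (inc e) \<in> A" "snd (inc e) \<in> A" for e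
      by (rule step[OF that(1) _ that(2,3)]) (simp add: ends_of_def)
    have dX: "delta X \<subseteq> delta A" "delta Y \<subseteq> delta A" "delta X \<inter> delta Y = {}"
      using no XA unfolding cutset_def Y_def by blast+
    have nX: "delta X \<noteq> {}" "delta Y \<noteq> {}"
      using delta_nonempty[of u w X] delta_nonempty[of w u Y] ne XA by auto
    have fA: "finite (delta A)" using A U_fincut unfolding fincut_def by blast
    then have fX: "fincut X" "fincut Y" unfolding fincut_def using dX finite_subset[OF _ fA] by auto
    have "delta X \<subset> delta A" "delta Y \<subset> delta A" using dX nX by blast+
    then have lt: "card (delta X) < card (delta A)" "card (delta Y) < card (delta A)"
      using psubset_card_mono[OF fA] by auto
    have "U X \<or> U Y"
    proof (rule disjCI)
      assume "\<not> U Y"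
      then have "U (A \<inter> - Y)" using U_compl[OF fX(2)] U_Int A by blast
      moreover have "A \<inter> - Y = X" using XA by auto
      ultimately show "U X" by simp
    qed
    then show False using min[of X] min[of Y] lt XA A by force
  qed
  then show ?thesis using that A by blast
qed

lemma avoid_finite:
  assumes "finite S" "\<And>v. v \<in> S \<Longrightarrow> \<exists>A. U A \<and> v \<notin> A"
  shows "\<exists>A. U A \<and> A \<inter> S = {}"
  using assms
proof (induction S rule: finite_induct)
  case empty
  then show ?case using U_V by auto
next
  case (insert v S)
  then obtain A B where "U A" "A \<inter> S = {}" "U B" "v \<notin> B" by blast
  then show ?case using U_Int[of A B] by (intro exI[of _ "A \<inter> B"]) auto
qed

lemma finite_ends: "finite F \<Longrightarrow> finite (\<Union>(ends_of inc ` F))"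
  by (auto simp: ends_of_def)

text \<open>The members shrink so fast that no edge of the cut of \<open>A n\<close> has an end in
  \<open>A (Suc n)\<close>. This rules out a vertex common to all of them, and connectedness of each
  set lets a ray proceed from one to the next.\<close>

definition good_seq :: "(nat \<Rightarrow> 'v set) \<Rightarrow> bool" where
  "good_seq A \<longleftrightarrow> (\<forall>n. U (A n) \<and> A n \<subseteq> V \<and> conn_set (A n) \<and> A n \<noteq> V \<and> A (Suc n) \<subseteq> A n \<and>
      (\<forall>e\<in>delta (A n). ends_of inc e \<inter> A (Suc n) = {}))"

lemma good_seq_exists:
  assumes novertex: "\<And>v. v \<in> V \<Longrightarrow> \<exists>A. U A \<and> v \<notin> A"
  shows "\<exists>A. good_seq A"
proof -
  let ?P = "\<lambda>A. U A \<and> A \<subseteq> V \<and> conn_set A \<and> A \<noteq> V"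
  have "\<exists>A. \<forall>n. ?P (A n) \<and> (A (Suc n) \<subseteq> A n \<and> (\<forall>e\<in>delta (A n). ends_of inc e \<inter> A (Suc n) = {}))"
  proof (rule dependent_nat_choice)
    obtain v where v: "v \<in> V" using V_nonempty by blast
    then obtain A where "U A" "v \<notin> A" using novertex by blast
    then show "\<exists>A. ?P A" using connected_member[of A] v by (metis subsetD)
  next
    fix A n assume A: "?P A"
    let ?S = "\<Union>(ends_of inc ` delta A)"
    have "finite ?S" using finite_ends U_fincut A unfolding fincut_def by blast
    moreover have "?S \<subseteq> V" using ends_in_V cutset_subset[of inc E A] unfolding ends_of_def by auto
    ultimately obtain B where B: "U B" "B \<inter> ?S = {}" using avoid_finite[of ?S] novertex by blast
    have "U (A \<inter> B)" using U_Int A B by blast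
    then obtain C where C: "U C" "C \<subseteq> A \<inter> B" "C \<subseteq> V" "conn_set C" by (rule connected_member)
    have "C \<noteq> V" using C(2) A by auto
    moreover have "\<forall>e\<in>delta A. ends_of inc e \<inter> C = {}" using B(2) C(2) by blast
    ultimately show "\<exists>C. ?P C \<and> C \<subseteq> A \<and> (\<forall>e\<in>delta A. ends_of inc e \<inter> C = {})"
      using C by (intro exI[of _ C]) auto
  qed
  then show ?thesis unfolding good_seq_def by blast
qed

lemma good_seq_antimono: "good_seq A \<Longrightarrow> m \<le> n \<Longrightarrow> A n \<subseteq> A m"
  unfolding good_seq_def by (simp add: lift_Suc_antimono_le)

text \<open>A vertex in every \<open>A n\<close> would pass this on to its neighbours, since an edge
  leaving \<open>A n\<close> has no end in \<open>A (Suc n)\<close>. By connectedness of the graph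
  \<open>A 0\<close> would then be all of V.\<close>

lemma good_seq_Inter:
  assumes good: "good_seq A" and v: "v \<in> V"
  shows "\<exists>n. v \<notin> A n"
proof (rule ccontr)
  have A: "U (A n)" "A n \<subseteq> V" "conn_set (A n)" "A n \<noteq> V" "A (Suc n) \<subseteq> A n"
    "\<And>e. e \<in> delta (A n) \<Longrightarrow> ends_of inc e \<inter> A (Suc n) = {}" for n
    using good unfolding good_seq_def by blast+
  assume "\<nexists>n. v \<notin> A n"
  then have vA: "\<forall>n. v \<in> A n" by blast
  have edge: "\<forall>n. z \<in> A n" if e: "e \<in> E" "ends_of inc e = {y, z}" "\<forall>n. y \<in> A n" for e y z
  proof
    fix n
    have "e \<notin> delta (A n)" using A(6)[of e n] e by auto
    then show "z \<in> A n" using e(3) in_delta[OF e(1), of "A n"] ends_cases[OF e(2)] by metis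
  qed
  have "\<forall>n. w \<in> A n" if "w \<in> V" for w
  proof -
    have "(adj_minus E inc {})\<^sup>*\<^sup>* v w" using conn_V[OF v that] unfolding conn_minus_def .
    then show ?thesis
    proof (induction rule: rtranclp_induct)
      case (step y z)
      then obtain e where "e \<in> E" "ends_of inc e = {y, z}" unfolding adj_minus_def by blast
      then show ?case using edge step.IH by blast
    qed (rule vA)
  qed
  then show False using A(2,4)[of 0] by blast
qed

text \<open>The ray is a greedy walk: at a vertex of A n outside A (n + 1) it follows a shortest path inside
  A n towards A (n + 1), so the pair (level, distance) strictly improves and no vertex repeats.\<close>

lemma good_seq_ray:
  assumes good: "good_seq A"
  shows "\<exists>R. ray R \<and> (\<forall>n. tail_in (A n) R)"
proof -
  have A: "U (A n)" "A n \<subseteq> V" "conn_set (A n)" "A n \<noteq> V" "A (Suc n) \<subseteq> A n"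
    "\<And>e. e \<in> delta (A n) \<Longrightarrow> ends_of inc e \<inter> A (Suc n) = {}" for n
    using good unfolding good_seq_def by blast+
  have anti: "A n \<subseteq> A m" if "m \<le> n" for m n
    using good_seq_antimono[OF good that] .
  have out: "\<exists>n. v \<notin> A n" if "v \<in> V" for v
    using good_seq_Inter[OF good that] .
  define L where "L v = (LEAST n. v \<notin> A n)" for v
  have L: "v \<in> A m \<longleftrightarrow> m < L v" if "v \<in> V" for v m
  proof
    assume "v \<in> A m"
    show "m < L v"
    proof (rule ccontr)
      assume "\<not> m < L v"
      then have "v \<in> A (L v)" using anti[of "L v" m] \<open>v \<in> A m\<close> by auto
      then show False using out[OF that] unfolding L_def by (metis LeastI_ex)
    qed
  qed (auto simp: L_def dest: not_less_Least)
  \<comment> \<open>\<open>L v\<close> is the first level that misses v, so v still lies in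
    \<open>A (L v - 1)\<close>; d is the distance inside that set to the next one,
    \<open>A (L v)\<close>.\<close>
  define d where "d v = (LEAST k. \<exists>u\<in>A (L v). (adj_in (A (L v - 1)) ^^ k) v u)" for v
  define better where "better v w \<longleftrightarrow> L w > L v \<or> (L w = L v \<and> d w < d v)" for v w
  have step: "\<exists>w e. e \<in> E \<and> ends_of inc e = {v, w} \<and> w \<in> A 0 \<and> better v w" if v0: "v \<in> A 0" for v
  proof -
    have vV: "v \<in> V" using v0 A(2) by blast
    then have Lv: "L v > 0" using L v0 by blast
    define m where "m = L v - 1"
    have m: "L v = Suc m" using Lv m_def by simp
    have vm: "v \<in> A m" "v \<notin> A (Suc m)" using L[OF vV] m by auto
    obtain u where u: "u \<in> A (Suc m)" using A(1)[of "Suc m"] U_Int_V(2) by blast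
    then have "(adj_in (A m))\<^sup>*\<^sup>* v u" using A(3)[of m] A(5) vm unfolding conn_set_def by blast
    then have "\<exists>k. \<exists>u\<in>A (L v). (adj_in (A (L v - 1)) ^^ k) v u"
      using u m by (auto simp: rtranclp_power)
    then have "\<exists>u\<in>A (L v). (adj_in (A (L v - 1)) ^^ d v) v u" unfolding d_def by (rule LeastI_ex)
    then obtain u where u: "u \<in> A (Suc m)" "(adj_in (A m) ^^ d v) v u" using m by auto
    have "d v \<noteq> 0" using u vm by (metis relpowp_0_E)
    then obtain k where k: "d v = Suc k" using not0_implies_Suc by blast
    then obtain w where w: "adj_in (A m) v w" "(adj_in (A m) ^^ k) w u" using u(2) relpowp_Suc_D2 by metis
    then obtain e where e: "e \<in> E" "ends_of inc e = {v, w}" "w \<in> A m" unfolding adj_in_def by blast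
    have wV: "w \<in> V" using e(3) A(2) by blast
    then have "L w > m" using L e(3) by blast
    moreover have "d w < d v" if "L w = Suc m"
    proof -
      have "d w \<le> k" unfolding d_def by (rule Least_le) (use that w u in auto)
      then show ?thesis using k by simp
    qed
    ultimately have "better v w" unfolding better_def using m by linarith
    then show ?thesis using e anti[of 0 m] by auto
  qed
  then obtain nx ne where nx: "\<And>v. v \<in> A 0 \<Longrightarrow> ne v \<in> E" "\<And>v. v \<in> A 0 \<Longrightarrow> ends_of inc (ne v) = {v, nx v}"
    "\<And>v. v \<in> A 0 \<Longrightarrow> nx v \<in> A 0" "\<And>v. v \<in> A 0 \<Longrightarrow> better v (nx v)" by metis
  obtain x0 where x0: "x0 \<in> A 0" using A(1)[of 0] U_Int_V(2) by blast
  define x where "x n = (nx ^^ n) x0" for n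
  have xA: "x n \<in> A 0" for n unfolding x_def by (induction n) (auto simp: x0 nx(3))
  then have xV: "x n \<in> V" for n using A(2) by blast
  have xS: "x (Suc n) = nx (x n)" for n unfolding x_def by simp
  have bS: "better (x n) (x (Suc n))" for n unfolding xS using nx(4) xA by blast
  have lt: "better (x i) (x j)" if "i < j" for i j
    using that
  proof (induction j rule: less_Suc_induct)
    case (2 i j k)
    then show ?case unfolding better_def by auto
  qed (rule bS)
  have "inj x"
  proof (rule injI)
    fix i j assume eq: "x i = x j"
    have "\<not> better v v" for v unfolding better_def by simp
    then show "i = j" using lt[of i j] lt[of j i] eq by (metis linorder_neqE_nat)
  qed
  then have ray: "ray (x, \<lambda>n. ne (x n))"
    unfolding is_ray_def using xV xA nx(1,2) xS by simp
  have mono: "L (x i) \<le> L (x j)" if "i \<le> j" for i j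
    using that lt[of i j] unfolding better_def by (cases "i = j") auto
  have up: "\<exists>m. L (x m) > L (x n)" for n
  proof (rule ccontr)
    assume "\<nexists>m. L (x m) > L (x n)"
    then have const: "L (x (n + i)) = L (x n)" for i using mono[of n "n + i"] by (metis le_add1 le_neq_implies_less)
    \<comment> \<open>While the level stands still, d drops at every step, which is possible for at
      most \<open>d (x n)\<close> steps.\<close>
    have "d (x (n + i)) + i \<le> d (x n)" for i
    proof (induction i)
      case (Suc i)
      have "d (x (Suc (n + i))) < d (x (n + i))"
        using bS[of "n + i"] const[of "Suc i"] const[of i] unfolding better_def by simp
      then show ?case using Suc by simp
    qed simp
    from this[of "Suc (d (x n))"] show False by simp
  qed
  have reach: "\<exists>m. L (x m) > N" for N
  proof (induction N)
    case 0
    then show ?case using up[of 0] by (metis gr0I not_less_zero)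
  next
    case (Suc N)
    then obtain m where "L (x m) > N" by blast
    then show ?case using up[of m] by (metis Suc_lessI less_trans_Suc)
  qed
  have "tail_in (A N) (x, \<lambda>n. ne (x n))" for N
  proof -
    obtain m where "L (x m) > N" using reach by blast
    then have "x n \<in> A N" if "n \<ge> m" for n using L[OF xV] mono[OF that] by simp
    then show ?thesis unfolding tail_in_def by auto
  qed
  then show ?thesis using ray by blast
qed

text \<open>A vertex common to all members realises U. Otherwise the end of the ray of a good
  sequence does: for a member B and large N, no end of an edge of the cut of B is in
  \<open>A N\<close>, so the connected set \<open>A N\<close> lies on one side of B. It meets B,
  hence lies in B, and so does a tail of the ray.\<close>

theorem ultrafilter_realized: "\<exists>p\<in>VE. \<forall>B. fincut B \<longrightarrow> (U B \<longleftrightarrow> pin B p)"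
proof (cases "\<exists>v\<in>V. \<forall>B. U B \<longrightarrow> v \<in> B")
  case True
  then obtain v where v: "v \<in> V" "\<And>B. U B \<Longrightarrow> v \<in> B" by blast
  have "U B \<longleftrightarrow> v \<in> B" if "fincut B" for B
    using v(2)[of B] v(2)[of "- B"] U_compl[OF that] by blast
  then show ?thesis using v(1) unfolding VE_def by (intro bexI[of _ "Vx v"]) auto
next
  case False
  then obtain A where A: "good_seq A" using good_seq_exists by blast
  then have A': "U (A n)" "conn_set (A n)" "A (Suc n) \<subseteq> A n"
    "\<And>e. e \<in> delta (A n) \<Longrightarrow> ends_of inc e \<inter> A (Suc n) = {}" for n
    unfolding good_seq_def by blast+
  from good_seq_ray[OF A] obtain R where R: "ray R" "\<And>n. tail_in (A n) R" by blast
  have anti: "A n \<subseteq> A m" if "m \<le> n" for m n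
    using good_seq_antimono[OF A that] .
  have tail: "tail_in B R" if "U B" for B
  proof -
    let ?S = "\<Union>(ends_of inc ` delta B)"
    have "finite (delta B)" using U_fincut[OF that] unfolding fincut_def .
    then have fin: "finite ?S" by (rule finite_ends)
    have "?S \<subseteq> V" using ends_in_V cutset_subset[of inc E B] unfolding ends_of_def by auto
    then have "\<forall>s\<in>?S. \<exists>n. s \<notin> A n" using good_seq_Inter[OF A] by blast
    then obtain f where f: "\<And>s. s \<in> ?S \<Longrightarrow> s \<notin> A (f s)" by metis
    obtain N where N: "\<forall>n\<in>f ` ?S. n < N" using finite_nat_set_iff_bounded fin by blast
    have "s \<notin> A N" if s: "s \<in> ?S" for s
    proof -
      have "f s \<le> N" using bspec[OF N imageI[OF s]] by (rule less_imp_le)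
      then show ?thesis using f[OF s] anti by blast
    qed
    then have dis: "?S \<inter> A N = {}" by blast
    have "\<not> ends_of inc e \<subseteq> A N" if "e \<in> delta B" for e
    proof -
      have "ends_of inc e \<subseteq> ?S" "ends_of inc e \<noteq> {}" using that unfolding ends_of_def by auto
      then show ?thesis using dis by blast
    qed
    then have side: "u \<in> B \<longleftrightarrow> w \<in> B" if "u \<in> A N" "w \<in> A N" for u w
      using conn_set_same_side[OF A'(2)] that by metis
    have "A N \<inter> B \<noteq> {}" using U_Int[OF A'(1) that] U_not_empty by metis
    then have "A N \<subseteq> B" using side by blast
    then show ?thesis using R(2)[of N] unfolding tail_in_def by blast
  qed
  let ?p = "End {R'. equiv_ray R R'}"
  have p: "?p \<in> Ends" by (rule end_of_ray[OF R(1)])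
  have "U B \<longleftrightarrow> pin B ?p" if B: "fincut B" for B
  proof -
    have "pin B ?p \<longleftrightarrow> tail_in B R" using pin_End[OF p _ B] equiv_ray_refl[OF R(1)] by blast
    also have "\<dots> \<longleftrightarrow> U B" using tail[of B] tail[of "- B"] U_compl[OF B] tail_in_compl[OF R(1) B] by blast
    finally show ?thesis by blast
  qed
  then show ?thesis using p unfolding VE_def by blast
qed

end

section \<open>The topology\<close>

context conn_graph
begin

abbreviation XX :: "('v,'e) gpoint set" where "XX \<equiv> XG V E"
abbreviation XT :: "('v,'e) gpoint topology" where "XT \<equiv> XG_top V E inc"
abbreviation GT :: "('v,'e) gpoint topology" where "GT \<equiv> G_top V E inc"
abbreviation emap :: "'e \<Rightarrow> real \<Rightarrow> ('v,'e) gpoint" where "emap \<equiv> edge_map inc"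

lemma emap_simps [simp]:
  "emap e 0 = Vx (fst (inc e))" "emap e 1 = Vx (snd (inc e))"
  "0 < t \<Longrightarrow> t < 1 \<Longrightarrow> emap e t = Inner e t"
  unfolding edge_map_def by auto

lemma emap_in_XX: "e \<in> E \<Longrightarrow> t \<in> {0..1} \<Longrightarrow> emap e t \<in> XX"
  unfolding edge_map_def XG_def inner_points_def using ends_in_V by auto

lemma XX_cases:
  assumes "p \<in> XX"
  obtains v where "p = Vx v" "v \<in> V" | e t where "p = Inner e t" "e \<in> E" "0 < t" "t < 1"
  using assms unfolding XG_def inner_points_def by auto

lemma openin_XT:
  "openin XT U \<longleftrightarrow> U \<subseteq> XX \<and> (\<forall>e\<in>E. openin (top_of_set {0..1}) {t\<in>{0..1::real}. emap e t \<in> U})"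
proof -
  let ?P = "\<lambda>U. U \<subseteq> XX \<and> (\<forall>e\<in>E. openin (top_of_set {0..1}) {t\<in>{0..1::real}. emap e t \<in> U})"
  have "istopology ?P"
    unfolding istopology_def
  proof (intro conjI allI impI)
    fix S T assume S: "?P S" and T: "?P T"
    show "S \<inter> T \<subseteq> XX" using S by blast
    show "\<forall>e\<in>E. openin (top_of_set {0..1}) {t\<in>{0..1::real}. emap e t \<in> S \<inter> T}"
    proof
      fix e assume "e \<in> E"
      then have "openin (top_of_set {0..1}) ({t\<in>{0..1::real}. emap e t \<in> S} \<inter> {t\<in>{0..1::real}. emap e t \<in> T})"
        using S T by (intro openin_Int) auto
      moreover have "{t\<in>{0..1::real}. emap e t \<in> S} \<inter> {t\<in>{0..1::real}. emap e t \<in> T} = {t\<in>{0..1::real}. emap e t \<in> S \<inter> T}" by auto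
      ultimately show "openin (top_of_set {0..1}) {t\<in>{0..1::real}. emap e t \<in> S \<inter> T}" by simp
    qed
  next
    fix K assume K: "\<forall>S\<in>K. ?P S"
    show "\<Union>K \<subseteq> XX" using K by blast
    show "\<forall>e\<in>E. openin (top_of_set {0..1}) {t\<in>{0..1::real}. emap e t \<in> \<Union>K}"
    proof
      fix e assume "e \<in> E"
      then have "openin (top_of_set {0..1}) (\<Union>S\<in>K. {t\<in>{0..1::real}. emap e t \<in> S})"
        using K by (intro openin_Union) auto
      moreover have "(\<Union>S\<in>K. {t\<in>{0..1::real}. emap e t \<in> S}) = {t\<in>{0..1::real}. emap e t \<in> \<Union>K}" by auto
      ultimately show "openin (top_of_set {0..1}) {t\<in>{0..1::real}. emap e t \<in> \<Union>K}" by simp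
    qed
  qed
  then show ?thesis unfolding XG_top_def by (simp add: topology_inverse')
qed

lemma topspace_XT [simp]: "topspace XT = XX"
proof
  show "topspace XT \<subseteq> XX" using openin_XT[of "topspace XT"] by simp
  have "{t\<in>{0..1::real}. emap e t \<in> XX} = {0..1}" if "e \<in> E" for e
    using emap_in_XX[OF that] by auto
  then have "openin XT XX" unfolding openin_XT by simp
  then show "XX \<subseteq> topspace XT" by (rule openin_subset)
qed

lemma continuous_emap:
  assumes "e \<in> E" shows "continuous_map (top_of_set {0..1}) XT (emap e)"
  unfolding continuous_map_def
proof (intro conjI allI impI)
  show "emap e \<in> topspace (top_of_set {0..1}) \<rightarrow> topspace XT" using emap_in_XX[OF assms] by auto
  fix U assume "openin XT U"
  then show "openin (top_of_set {0..1}) {x \<in> topspace (top_of_set {0..1}). emap e x \<in> U}"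
    unfolding openin_XT using assms by simp
qed

lemma connectedin_emap:
  assumes "e \<in> E" "connected I" "I \<subseteq> {0..1}" shows "connectedin XT (emap e ` I)"
  by (rule connectedin_continuous_map_image[OF continuous_emap[OF assms(1)]])
    (use assms in \<open>simp add: connectedin_subtopology\<close>)

section \<open>Components after deleting inner points of edges\<close>

definition gcomp :: "('v,'e) gpoint set \<Rightarrow> ('v,'e) gpoint \<Rightarrow> ('v,'e) gpoint set" where
  "gcomp Z x = {y. \<exists>T. connectedin XT T \<and> T \<subseteq> XX - Z \<and> x \<in> T \<and> y \<in> T}"

lemma gcomp_eq: "gcomp Z x = connected_component_of_set (subtopology XT (XX - Z)) x"
  unfolding gcomp_def connected_component_of_def connectedin_subtopology by auto

lemma gcomp_connected: "connectedin XT (gcomp Z x)"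
  using connectedin_connected_component_of[of "subtopology XT (XX - Z)" x]
  unfolding gcomp_eq connectedin_subtopology by simp

lemma gcomp_sub: "gcomp Z x \<subseteq> XX - Z"
  unfolding gcomp_def by blast

lemma gcomp_refl: "x \<in> XX - Z \<Longrightarrow> x \<in> gcomp Z x"
  unfolding gcomp_def using connectedin_sing[of XT x] by (auto intro!: exI[of _ "{x}"])

lemma gcomp_maximal: "connectedin XT T \<Longrightarrow> T \<subseteq> XX - Z \<Longrightarrow> y \<in> T \<Longrightarrow> y \<in> gcomp Z x \<Longrightarrow> T \<subseteq> gcomp Z x"
proof
  fix z assume T: "connectedin XT T" "T \<subseteq> XX - Z" "y \<in> T" "y \<in> gcomp Z x" "z \<in> T"
  have "connected_component_of (subtopology XT (XX - Z)) x y"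
    "connected_component_of (subtopology XT (XX - Z)) y z"
    using T unfolding gcomp_eq connected_component_of_def connectedin_subtopology by auto
  then show "z \<in> gcomp Z x" unfolding gcomp_eq using connected_component_of_trans by fastforce
qed

definition edges_of :: "('v,'e) gpoint set \<Rightarrow> 'e set" where
  "edges_of Z = {e. \<exists>t. Inner e t \<in> Z}"

lemma finite_edges_of: "finite Z \<Longrightarrow> finite (edges_of Z)"
proof -
  assume "finite Z"
  then have "finite ((\<lambda>p. case p of Inner e t \<Rightarrow> e | _ \<Rightarrow> undefined) ` Z)" by simp
  moreover have "edges_of Z \<subseteq> (\<lambda>p. case p of Inner e t \<Rightarrow> e | _ \<Rightarrow> undefined) ` Z"
    unfolding edges_of_def by force
  ultimately show ?thesis by (rule finite_subset[rotated])
qed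

lemma edges_of_sub: "Z \<subseteq> inner_points E \<Longrightarrow> edges_of Z \<subseteq> E"
  unfolding edges_of_def inner_points_def by auto

lemma edge_avoids:
  assumes "e \<in> E" "e \<notin> edges_of Z" "Z \<subseteq> inner_points E"
  shows "emap e ` {0..1} \<subseteq> XX - Z"
proof -
  have "emap e t \<notin> Z" for t
    using assms(2,3) unfolding edges_of_def inner_points_def edge_map_def by auto
  then show ?thesis using emap_in_XX[OF assms(1)] by auto
qed

lemma edge_in_comp:
  assumes "e \<in> E" "e \<notin> edges_of Z" "Z \<subseteq> inner_points E" "t \<in> {0..1}" "emap e t \<in> gcomp Z x" "s \<in> {0..1}"
  shows "emap e s \<in> gcomp Z x"
proof -
  have "connectedin XT (emap e ` {0..1})" by (rule connectedin_emap[OF assms(1)]) auto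
  then have "emap e ` {0..1} \<subseteq> gcomp Z x"
    by (rule gcomp_maximal[OF _ edge_avoids[OF assms(1-3)] imageI[OF assms(4)] assms(5)])
  then show ?thesis using assms(6) by blast
qed

lemma inner_of_emap: "p \<in> inner_of e \<Longrightarrow> \<exists>t. 0 < t \<and> t < 1 \<and> p = emap e t"
  unfolding inner_of_def by auto

text \<open>A walk in the graph that avoids every edge with a deleted point traces out a connected
  set in X_G - Z.\<close>

lemma conn_in_comp:
  assumes "conn (edges_of Z) u w" "Z \<subseteq> inner_points E" "Vx u \<in> gcomp Z x"
  shows "Vx w \<in> gcomp Z x"
  using assms(1) unfolding conn_minus_def
proof (induction rule: rtranclp_induct)
  case (step y z)
  then obtain e where e: "e \<in> E - edges_of Z" "ends_of inc e = {y, z}" unfolding adj_minus_def by blast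
  from e(2) show ?case
  proof (cases rule: ends_cases)
    case 1
    then show ?thesis using edge_in_comp[of e Z 0 x 1] e assms(2) step.IH by auto
  next
    case 2
    then show ?thesis using edge_in_comp[of e Z 1 x 0] e assms(2) step.IH by auto
  qed
qed (rule assms(3))

lemma basic_iff:
  "T \<in> basic_open_sets V E inc \<longleftrightarrow>
    (\<exists>Z x. finite Z \<and> Z \<subseteq> inner_points E \<and> x \<in> XX - Z \<and> T = tilde V E inc (gcomp Z x))"
proof -
  have ts: "topspace (subtopology XT (XX - Z)) = XX - Z" for Z by auto
  show ?thesis unfolding basic_open_sets_def connected_components_of_def gcomp_eq ts by auto
qed

definition ray_tail :: "nat \<Rightarrow> ('v,'e) ray \<Rightarrow> ('v,'e) ray" where
  "ray_tail k R = (\<lambda>n. fst R (n + k), \<lambda>n. snd R (n + k))"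

lemma ray_ray_tail: "ray R \<Longrightarrow> ray (ray_tail k R)"
  unfolding is_ray_def ray_tail_def inj_def by (metis add_Suc add_right_cancel fst_conv snd_conv)

lemma equiv_ray_tail: "equiv_ray R0 R \<Longrightarrow> equiv_ray R0 (ray_tail k R)"
proof -
  assume a: "equiv_ray R0 R"
  have "subray_in F C (ray_tail k R) j" if "subray_in F C R j" for F C j
    using that unfolding subray_in_def ray_tail_def by auto
  then show ?thesis using a ray_ray_tail[of R k] unfolding edge_equiv_def by meson
qed

lemma end_ray_tail: "End \<omega> \<in> Ends \<Longrightarrow> R \<in> \<omega> \<Longrightarrow> ray_tail k R \<in> \<omega>"
  by (erule end_rays) (simp add: equiv_ray_tail)

lemma ray_in_comp:
  assumes "ray R" "Z \<subseteq> inner_points E" "\<And>n. snd R n \<notin> edges_of Z" "Vx (fst R m) \<in> gcomp Z x"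
  shows "ray_in_set (gcomp Z x) R"
  unfolding ray_in_set_def
proof
  fix n
  have c: "conn (edges_of Z) (fst R 0) (fst R i)" for i
    using ray_conn_tail[OF assms(1), of 0 "edges_of Z" i] assms(3) by simp
  then have "conn (edges_of Z) (fst R m) (fst R i)" for i
    using conn_minus_sym conn_minus_trans by metis
  then have v: "Vx (fst R i) \<in> gcomp Z x" for i using conn_in_comp[OF _ assms(2,4)] by blast
  have e: "snd R n \<in> E" using ray_D(2)[OF assms(1)] .
  have "fst (inc (snd R n)) \<in> {fst R n, fst R (Suc n)}" using ray_D(3)[OF assms(1), of n] unfolding ends_of_def by auto
  then have "emap (snd R n) 0 \<in> gcomp Z x" using v by auto
  have "inner_of (snd R n) \<subseteq> gcomp Z x"
  proof
    fix p :: "('v,'e) gpoint" assume "p \<in> inner_of (snd R n)"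
    then obtain t where "0 < t" "t < 1" "p = emap (snd R n) t" using inner_of_emap by blast
    then show "p \<in> gcomp Z x"
      using edge_in_comp[OF e assms(3,2), of 0 x t] \<open>emap (snd R n) 0 \<in> _\<close> by simp
  qed
  then show "Vx (fst R n) \<in> gcomp Z x \<and> inner_of (snd R n) \<subseteq> gcomp Z x" using v by blast
qed

lemma tilde_iff:
  "C \<subseteq> XX \<Longrightarrow> p \<in> tilde V E inc C \<longleftrightarrow> p \<in> C \<or> (\<exists>\<omega>. p = End \<omega> \<and> p \<in> Ends \<and> (\<exists>R\<in>\<omega>. ray_in_set C R))"
  unfolding tilde_def Ends_def by auto

lemma tilde_sub: "C \<subseteq> tilde V E inc C"
  unfolding tilde_def by blast

lemma Ends_disjoint: "p \<in> Ends \<Longrightarrow> p \<notin> XX"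
  unfolding Ends_def XG_def inner_points_def by auto

lemma ray_in_set_mono: "ray_in_set C R \<Longrightarrow> C \<subseteq> D \<Longrightarrow> ray_in_set D R"
  unfolding ray_in_set_def by blast

lemma tilde_mono:
  assumes "C \<subseteq> D" shows "tilde V E inc C \<subseteq> tilde V E inc D"
proof -
  have "ray_in_set C R \<Longrightarrow> ray_in_set D R" for R :: "('v,'e) ray"
    using ray_in_set_mono assms by metis
  then have "{End \<omega> |\<omega>. \<omega> \<in> edge_ends V E inc \<and> (\<exists>R\<in>\<omega>. ray_in_set C R)}
    \<subseteq> {End \<omega> |\<omega>. \<omega> \<in> edge_ends V E inc \<and> (\<exists>R\<in>\<omega>. ray_in_set D R)}" by fast
  then show ?thesis unfolding tilde_def using assms by (rule Un_mono[rotated])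
qed

lemma gcomp_refine:
  assumes "Z1 \<subseteq> Z" "q \<in> gcomp Z1 x" shows "gcomp Z q \<subseteq> gcomp Z1 x"
proof (cases "q \<in> gcomp Z q")
  case True
  have "gcomp Z q \<subseteq> XX - Z1" using gcomp_sub[of Z q] assms(1) by blast
  then show ?thesis using gcomp_maximal[OF gcomp_connected _ True assms(2)] by blast
next
  case False
  then have "gcomp Z q = {}" unfolding gcomp_def by blast
  then show ?thesis by simp
qed

text \<open>At a point of X_G, its component after deleting both sets of points works. At an end,
  the two witnessing rays may differ, but both are equivalent to R0, so late vertices of them are
  joined without edges touched by either set. A late vertex of one ray thus lies in both components
  and serves as the centre q.\<close>

lemma basic_Int:
  assumes "T1 \<in> basic_open_sets V E inc" "T2 \<in> basic_open_sets V E inc" "p \<in> T1" "p \<in> T2"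
  shows "\<exists>T\<in>basic_open_sets V E inc. p \<in> T \<and> T \<subseteq> T1 \<inter> T2"
proof -
  obtain Z1 x1 where 1: "finite Z1" "Z1 \<subseteq> inner_points E" "x1 \<in> XX - Z1" "T1 = tilde V E inc (gcomp Z1 x1)"
    using assms(1) unfolding basic_iff by blast
  obtain Z2 x2 where 2: "finite Z2" "Z2 \<subseteq> inner_points E" "x2 \<in> XX - Z2" "T2 = tilde V E inc (gcomp Z2 x2)"
    using assms(2) unfolding basic_iff by blast
  define Z where "Z = Z1 \<union> Z2"
  have Z: "finite Z" "Z \<subseteq> inner_points E" "Z1 \<subseteq> Z" "Z2 \<subseteq> Z" using 1 2 unfolding Z_def by auto
  have key: "\<exists>T\<in>basic_open_sets V E inc. p \<in> T \<and> T \<subseteq> T1 \<inter> T2"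
    if q: "q \<in> gcomp Z1 x1" "q \<in> gcomp Z2 x2" and p: "p \<in> tilde V E inc (gcomp Z q)" for q
  proof (intro bexI conjI)
    have "q \<in> XX - Z" using q gcomp_sub[of Z1 x1] gcomp_sub[of Z2 x2] unfolding Z_def by blast
    then show "tilde V E inc (gcomp Z q) \<in> basic_open_sets V E inc" unfolding basic_iff using Z by blast
    show "tilde V E inc (gcomp Z q) \<subseteq> T1 \<inter> T2" unfolding 1(4) 2(4)
      using tilde_mono gcomp_refine[OF Z(3) q(1)] gcomp_refine[OF Z(4) q(2)] by (metis Int_greatest)
  qed (rule p)
  have c1: "gcomp Z1 x1 \<subseteq> XX" and c2: "gcomp Z2 x2 \<subseteq> XX" using gcomp_sub by blast+
  show ?thesis
  proof (cases "p \<in> Ends")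
    case False
    then have p: "p \<in> gcomp Z1 x1" "p \<in> gcomp Z2 x2"
      using assms(3,4) unfolding 1(4) 2(4) tilde_iff[OF c1] tilde_iff[OF c2] by blast+
    then have "p \<in> XX - Z" using gcomp_sub[of Z1 x1] gcomp_sub[of Z2 x2] unfolding Z_def by blast
    then show ?thesis using key[OF p] gcomp_refl[of p Z] unfolding tilde_def by blast
  next
    case True
    then have "p \<notin> gcomp Z1 x1" "p \<notin> gcomp Z2 x2" using Ends_disjoint c1 c2 by blast+
    then obtain \<omega> R1 R2 where p: "p = End \<omega>" and R: "R1 \<in> \<omega>" "ray_in_set (gcomp Z1 x1) R1"
        "R2 \<in> \<omega>" "ray_in_set (gcomp Z2 x2) R2"
      using assms(3,4) unfolding 1(4) 2(4) tilde_iff[OF c1] tilde_iff[OF c2] by blast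
    have w: "End \<omega> \<in> Ends" using True p by simp
    obtain R0 where R0: "\<omega> = {R'. equiv_ray R0 R'}" using end_rays[OF w] by blast
    let ?F = "edges_of Z"
    have F: "?F \<subseteq> E" "finite ?F" using edges_of_sub finite_edges_of Z by blast+
    obtain k1 where k1: "\<forall>m\<ge>k1. \<forall>n\<ge>k1. conn ?F (fst R0 m) (fst R1 n) \<and> snd R0 m \<notin> ?F \<and> snd R1 n \<notin> ?F"
      using equiv_ray_conn[of R0 R1 ?F] F R(1) R0 by blast
    obtain k2 where k2: "\<forall>m\<ge>k2. \<forall>n\<ge>k2. conn ?F (fst R0 m) (fst R2 n) \<and> snd R0 m \<notin> ?F \<and> snd R2 n \<notin> ?F"
      using equiv_ray_conn[of R0 R2 ?F] F R(3) R0 by blast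
    define k where "k = max k1 k2"
    have "conn ?F (fst R0 k) (fst R1 k)" "conn ?F (fst R0 k) (fst R2 k)"
      using k1 k2 unfolding k_def by auto
    then have c: "conn ?F (fst R2 k) (fst R1 k)" using conn_minus_sym conn_minus_trans by metis
    let ?q = "Vx (fst R1 k)"
    have q1: "?q \<in> gcomp Z1 x1" using R(2) unfolding ray_in_set_def by blast
    have "Vx (fst R2 k) \<in> gcomp Z2 x2" using R(4) unfolding ray_in_set_def by blast
    moreover have "Vx (fst R2 k) \<in> XX - Z"
      using gcomp_sub[of Z2 x2] calculation Z(2) unfolding inner_points_def by auto
    ultimately have "?q \<in> gcomp Z2 x2"
      using conn_in_comp[OF c Z(2) gcomp_refl] gcomp_refine[OF Z(4)] by blast
    moreover have "End \<omega> \<in> tilde V E inc (gcomp Z ?q)"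
    proof -
      have rr: "ray (ray_tail k R1)" "ray_tail k R1 \<in> \<omega>"
        using end_ray_ray[OF w R(1)] ray_ray_tail end_ray_tail[OF w R(1)] by blast+
      have "?q \<in> XX - Z" using q1 gcomp_sub[of Z1 x1] Z(2) unfolding inner_points_def by auto
      moreover have "snd R1 (n + k) \<notin> edges_of Z" for n using k1[rule_format, of k "n + k"] unfolding k_def by simp
      ultimately have "ray_in_set (gcomp Z ?q) (ray_tail k R1)"
        using ray_in_comp[OF rr(1) Z(2), of 0 ?q] gcomp_refl[of ?q Z] unfolding ray_tail_def by simp
      then show ?thesis using w rr(2) tilde_iff[of "gcomp Z ?q"] gcomp_sub[of Z ?q] by blast
    qed
    ultimately show ?thesis using key[OF q1] p by blast
  qed
qed

lemma openin_GT:
  "openin GT U \<longleftrightarrow> (\<forall>p\<in>U. \<exists>T\<in>basic_open_sets V E inc. p \<in> T \<and> T \<subseteq> U)"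
proof -
  let ?Q = "\<lambda>U. \<forall>p\<in>U. \<exists>T\<in>basic_open_sets V E inc. p \<in> T \<and> T \<subseteq> U"
  have eq: "(\<exists>\<B>\<subseteq>basic_open_sets V E inc. U = \<Union>\<B>) \<longleftrightarrow> ?Q U" for U
  proof
    assume "?Q U"
    then have "U = \<Union>{T\<in>basic_open_sets V E inc. T \<subseteq> U}" by blast
    then show "\<exists>\<B>\<subseteq>basic_open_sets V E inc. U = \<Union>\<B>"
      by (intro exI[of _ "{T\<in>basic_open_sets V E inc. T \<subseteq> U}"]) auto
  qed blast
  have "istopology ?Q"
    unfolding istopology_def
  proof (intro conjI allI impI ballI)
    fix S T p assume "?Q S" "?Q T" "p \<in> S \<inter> T"
    then obtain T1 T2 where "T1 \<in> basic_open_sets V E inc" "T2 \<in> basic_open_sets V E inc"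
      "p \<in> T1" "p \<in> T2" "T1 \<subseteq> S" "T2 \<subseteq> T" by blast
    then show "\<exists>T'\<in>basic_open_sets V E inc. p \<in> T' \<and> T' \<subseteq> S \<inter> T" using basic_Int by (meson Int_mono subset_trans)
  next
    fix K p assume K: "\<forall>S\<in>K. ?Q S" "p \<in> \<Union>K"
    then obtain S where "S \<in> K" "p \<in> S" by blast
    then obtain T where "T \<in> basic_open_sets V E inc" "p \<in> T" "T \<subseteq> S" using K by blast
    then show "\<exists>T\<in>basic_open_sets V E inc. p \<in> T \<and> T \<subseteq> \<Union>K" using \<open>S \<in> K\<close> by blast
  qed
  then show ?thesis unfolding G_top_def eq by (simp add: topology_inverse')
qed

lemma basic_sub: "T \<in> basic_open_sets V E inc \<Longrightarrow> T \<subseteq> XX \<union> Ends"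
  unfolding basic_iff using gcomp_sub by (auto simp: tilde_def Ends_def)

lemma topspace_GT [simp]: "topspace GT = XX \<union> Ends"
proof
  show "topspace GT \<subseteq> XX \<union> Ends"
  proof
    fix p assume "p \<in> topspace GT"
    then obtain T where "T \<in> basic_open_sets V E inc" "p \<in> T"
      using openin_GT[of "topspace GT"] by auto
    then show "p \<in> XX \<union> Ends" using basic_sub by blast
  qed
next
  obtain v where v: "v \<in> V" using V_nonempty by blast
  \<comment> \<open>With no point deleted, X_G is a single component, and every end has a ray in
    it.\<close>
  let ?C = "gcomp {} (Vx v)"
  have e: "edges_of {} = {}" unfolding edges_of_def by simp
  have vC: "Vx v \<in> ?C" using v by (intro gcomp_refl) (auto simp: XG_def)
  have wC: "Vx w \<in> ?C" if "w \<in> V" for w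
    using conn_in_comp[of "{}" v w "Vx v"] conn_V[OF v that] vC e by simp
  have "XX \<subseteq> ?C"
  proof
    fix p assume "p \<in> XX"
    then show "p \<in> ?C"
    proof (cases rule: XX_cases)
      case (2 e t)
      then have "emap e t \<in> ?C"
        using edge_in_comp[of e "{}" 0 "Vx v" t] wC[OF ends_in_V(1)] e by auto
      then show ?thesis using 2 by simp
    qed (use wC in simp)
  qed
  then have C: "?C = XX" using gcomp_sub by blast
  have "Ends \<subseteq> tilde V E inc XX"
  proof
    fix p assume p: "p \<in> Ends"
    then obtain \<omega> where w: "p = End \<omega>" "End \<omega> \<in> Ends" unfolding Ends_def by blast
    then obtain R where R: "ray R" "R \<in> \<omega>" using end_rays by metis
    have "ray_in_set XX R" unfolding ray_in_set_def
      using ray_D(1,2)[OF R(1)] by (auto simp: XG_def inner_points_def inner_of_def)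
    then show "p \<in> tilde V E inc XX" using tilde_iff[of XX p] w R by blast
  qed
  then have "XX \<union> Ends \<subseteq> tilde V E inc ?C" unfolding C tilde_def by blast
  moreover have b: "tilde V E inc ?C \<in> basic_open_sets V E inc"
    unfolding basic_iff using v by (intro exI[of _ "{}"] exI[of _ "Vx v"]) (auto simp: XG_def)
  moreover have "openin GT (tilde V E inc ?C)" unfolding openin_GT using b by blast
  ultimately show "XX \<union> Ends \<subseteq> topspace GT" using openin_subset by blast
qed

text \<open>The finite set Z contains the frontier of W in X_G: W \<inter> X_G and the rest of X_G
  outside Z are both open, so a component of X_G - Z that meets W lies in W. The two conditions on
  rays extend this to the ends added by \<open>tilde\<close>.\<close>

lemma openin_GT_criterion:
  assumes W: "W \<subseteq> XX \<union> Ends" and Z: "finite Z" "Z \<subseteq> inner_points E" "Z \<inter> W = {}"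
    and o1: "openin XT (W \<inter> XX)" and o2: "openin XT (XX - Z - W)"
    and in_end: "\<And>\<omega>. End \<omega> \<in> W \<Longrightarrow> End \<omega> \<in> Ends \<Longrightarrow> \<exists>R\<in>\<omega>. ray_in_set W R"
    and end_in: "\<And>\<omega> R. End \<omega> \<in> Ends \<Longrightarrow> R \<in> \<omega> \<Longrightarrow> ray_in_set W R \<Longrightarrow> End \<omega> \<in> W"
  shows "openin GT W"
  unfolding openin_GT
proof
  fix p assume p: "p \<in> W"
  have split: "gcomp Z x \<subseteq> W" if x: "x \<in> W \<inter> XX" for x
  proof -
    have xc: "x \<in> gcomp Z x" using x Z(3) by (intro gcomp_refl) auto
    have "\<not> (gcomp Z x \<inter> (XX - Z - W) \<noteq> {})"
    proof
      assume "gcomp Z x \<inter> (XX - Z - W) \<noteq> {}"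
      moreover have "gcomp Z x \<inter> (W \<inter> XX) \<noteq> {}" using xc x by blast
      moreover have "gcomp Z x \<subseteq> (W \<inter> XX) \<union> (XX - Z - W)" using gcomp_sub[of Z x] by blast
      moreover have "(W \<inter> XX) \<inter> (XX - Z - W) \<inter> gcomp Z x = {}" by blast
      ultimately show False using gcomp_connected[of Z x] o1 o2 unfolding connectedin
        by (metis Int_commute)
    qed
    then show ?thesis using gcomp_sub[of Z x] by blast
  qed
  have sub: "tilde V E inc (gcomp Z x) \<subseteq> W" if x: "x \<in> W \<inter> XX" for x
  proof
    fix q assume q: "q \<in> tilde V E inc (gcomp Z x)"
    have "gcomp Z x \<subseteq> XX" using gcomp_sub by blast
    from q[unfolded tilde_iff[OF this]] show "q \<in> W"
    proof
      assume "q \<in> gcomp Z x"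
      then show ?thesis using split[OF x] by blast
    next
      assume "\<exists>\<omega>. q = End \<omega> \<and> q \<in> Ends \<and> (\<exists>R\<in>\<omega>. ray_in_set (gcomp Z x) R)"
      then show ?thesis using end_in ray_in_set_mono[OF _ split[OF x]] by blast
    qed
  qed
  have basic: "tilde V E inc (gcomp Z x) \<in> basic_open_sets V E inc" if "x \<in> W \<inter> XX" for x
    unfolding basic_iff using that Z by blast
  show "\<exists>T\<in>basic_open_sets V E inc. p \<in> T \<and> T \<subseteq> W"
  proof (cases "p \<in> XX")
    case True
    have "p \<notin> Z" using p Z(3) by blast
    then have "p \<in> tilde V E inc (gcomp Z p)" using True gcomp_refl[of p Z] tilde_sub by blast
    moreover have "p \<in> W \<inter> XX" using p True by simp
    ultimately show ?thesis using basic[of p] sub[of p] by blast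
  next
    case False
    then have pE: "p \<in> Ends" using p W by blast
    then obtain \<omega> where w: "p = End \<omega>" "End \<omega> \<in> Ends" unfolding Ends_def by blast
    then obtain R where R: "R \<in> \<omega>" "ray_in_set W R" using in_end p by blast
    have ray: "ray R" using end_ray_ray[OF w(2) R(1)] .
    obtain k where k: "\<forall>n\<ge>k. snd R n \<notin> edges_of Z"
      using ray_avoids_finite[OF ray finite_edges_of[OF Z(1)]] by blast
    let ?R = "ray_tail k R" and ?x = "Vx (fst R k)"
    have x: "?x \<in> W \<inter> XX" using R(2) ray_D(1)[OF ray] unfolding ray_in_set_def XG_def by auto
    then have "?x \<in> gcomp Z ?x" using Z(3) by (intro gcomp_refl) auto
    then have "ray_in_set (gcomp Z ?x) ?R"
      using ray_in_comp[OF ray_ray_tail[OF ray] Z(2), of k 0 ?x] k unfolding ray_tail_def by simp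
    then have "p \<in> tilde V E inc (gcomp Z ?x)"
      using tilde_iff[of "gcomp Z ?x"] gcomp_sub[of Z ?x] w pE end_ray_tail[OF w(2) R(1)] by blast
    then show ?thesis using basic[OF x] sub[OF x] by blast
  qed
qed

section \<open>The function of a finite cut\<close>

definition side :: "'v set \<Rightarrow> 'v \<Rightarrow> real" where "side A v = (if v \<in> A then 0 else 1)"

fun gval :: "'v set \<Rightarrow> ('v,'e) gpoint \<Rightarrow> real" where
  "gval A (Vx v) = side A v"
| "gval A (End \<omega>) = (if pin A (End \<omega>) then 0 else 1)"
| "gval A (Inner e t) = (1 - t) * side A (fst (inc e)) + t * side A (snd (inc e))"

lemma gval_emap: "gval A (emap e t) = (1 - t) * side A (fst (inc e)) + t * side A (snd (inc e))"
  unfolding edge_map_def by simp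

lemma gval_VE: "p \<in> VE \<Longrightarrow> gval A p = (if pin A p then 0 else 1)"
  by (elim VE_cases) (simp_all add: side_def)

lemma VE_sub: "VE \<subseteq> XX \<union> Ends"
  unfolding VE_def XG_def by blast

lemma GT_cases:
  assumes "p \<in> XX \<union> Ends"
  obtains "p \<in> VE" | e t where "p = Inner e t" "e \<in> E" "0 < t" "t < 1"
proof (cases "p \<in> XX")
  case True
  then show ?thesis
  proof (cases rule: XX_cases)
    case (1 v)
    then have "p \<in> VE" unfolding VE_def by simp
    then show ?thesis by (rule that(1))
  next
    case (2 e t)
    then show ?thesis by (rule that(2))
  qed
next
  case False
  then have "p \<in> VE" using assms unfolding VE_def by simp
  then show ?thesis by (rule that(1))
qed

lemma gval_compl:
  assumes "p \<in> XX \<union> Ends" "fincut A" shows "gval (- A) p = 1 - gval A p"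
  using assms(1)
proof (cases rule: GT_cases)
  case 1
  then show ?thesis using gval_VE[OF 1] pin_compl[OF 1 assms(2)] by simp
next
  case (2 e t)
  have s: "side (- A) v = 1 - side A v" for v unfolding side_def by simp
  show ?thesis unfolding 2(1) gval.simps s by (simp add: algebra_simps)
qed

text \<open>The level set at c consists of one inner point on each edge of the finite cut, at
  parameter c or 1 - c according to the orientation, and serves as the deleted set Z. Vertices and
  ends have value 0 or 1 and thus stay off the level.\<close>

lemma openin_gval_less:
  assumes A: "fincut A" and c: "0 < c" "c < 1"
  shows "openin GT {p \<in> XX \<union> Ends. gval A p < c}" (is "openin GT ?W")
proof (rule openin_GT_criterion)
  let ?Z = "{p \<in> inner_points E. gval A p = c}"
  have "?Z \<subseteq> (\<lambda>e. Inner e c) ` delta A \<union> (\<lambda>e. Inner e (1 - c)) ` delta A"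
  proof
    fix p assume "p \<in> ?Z"
    then obtain e t where p: "p = Inner e t" "e \<in> E" "gval A (Inner e t) = c"
      unfolding inner_points_def by auto
    then show "p \<in> (\<lambda>e. Inner e c) ` delta A \<union> (\<lambda>e. Inner e (1 - c)) ` delta A"
      using c in_delta[OF p(2), of A] by (auto simp: side_def split: if_splits)
  qed
  then show "finite ?Z" using A unfolding fincut_def by (meson finite_UnI finite_imageI finite_subset)
  have op: "openin (top_of_set {0..1}) {t\<in>{0..1::real}. P (gval A (emap e t))}" if "open {x. P x}" for P e
  proof -
    have "continuous_on {0..1::real} (\<lambda>t. gval A (emap e t))"
      unfolding gval_emap by (intro continuous_intros)
    then have "openin (top_of_set {0..1}) ({0..1} \<inter> (\<lambda>t. gval A (emap e t)) -` {x. P x})"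
      using that by (rule continuous_openin_preimage_gen)
    moreover have "{0..1} \<inter> (\<lambda>t. gval A (emap e t)) -` {x. P x} = {t\<in>{0..1::real}. P (gval A (emap e t))}" by auto
    ultimately show ?thesis by simp
  qed
  have "openin (top_of_set {0..1}) {t\<in>{0..1::real}. emap e t \<in> ?W \<inter> XX}" if e: "e \<in> E" for e
  proof -
    have "{t\<in>{0..1::real}. emap e t \<in> ?W \<inter> XX} = {t\<in>{0..1::real}. gval A (emap e t) < c}"
      using emap_in_XX[OF e] by auto
    then show ?thesis using op[of "\<lambda>x. x < c" e] by (simp add: open_lessThan[unfolded lessThan_def])
  qed
  then show "openin XT (?W \<inter> XX)" unfolding openin_XT by blast
  have "XX - ?Z - ?W = {p\<in>XX. gval A p > c}"
  proof -
    have "gval A p \<noteq> c" if "p \<in> XX" "p \<notin> inner_points E" for p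
      using that c unfolding XG_def by (auto simp: side_def split: if_splits)
    then show ?thesis by fastforce
  qed
  moreover have "openin (top_of_set {0..1}) {t\<in>{0..1::real}. emap e t \<in> {p\<in>XX. gval A p > c}}" if e: "e \<in> E" for e
  proof -
    have "{t\<in>{0..1::real}. emap e t \<in> {p\<in>XX. gval A p > c}} = {t\<in>{0..1::real}. gval A (emap e t) > c}"
      using emap_in_XX[OF e] by auto
    then show ?thesis using op[of "\<lambda>x. x > c" e] by (simp add: open_greaterThan[unfolded greaterThan_def])
  qed
  then have "openin XT {p\<in>XX. gval A p > c}" unfolding openin_XT by blast
  ultimately show "openin XT (XX - ?Z - ?W)" by simp
next
  fix \<omega> assume w: "End \<omega> \<in> ?W" "End \<omega> \<in> Ends"
  obtain R where R: "ray R" "R \<in> \<omega>" using end_rays[OF w(2)] by blast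
  have "pin A (End \<omega>)" using w c by (auto split: if_splits)
  then have "tail_in A R" using pin_End[OF w(2) R(2) A] by simp
  then obtain k where k: "\<forall>n\<ge>k. fst R n \<in> A" unfolding tail_in_def by blast
  have "ray_in_set ?W (ray_tail k R)"
    unfolding ray_in_set_def
  proof (intro allI conjI)
    fix n
    show "Vx (fst (ray_tail k R) n) \<in> ?W"
      using k c ray_D(1)[OF R(1)] unfolding ray_tail_def by (auto simp: side_def XG_def)
    have e: "snd R (n + k) \<in> E" using ray_D(2)[OF R(1)] .
    have "fst (inc (snd R (n + k))) \<in> A" "snd (inc (snd R (n + k))) \<in> A"
      using ray_D(3)[OF R(1), of "n + k"] k unfolding ends_of_def by (auto simp: doubleton_eq_iff)
    then show "inner_of (snd (ray_tail k R) n) \<subseteq> ?W"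
      using e c unfolding ray_tail_def inner_of_def XG_def inner_points_def by (auto simp: side_def)
  qed
  then show "\<exists>R\<in>\<omega>. ray_in_set ?W R" using end_ray_tail[OF w(2) R(2)] by blast
next
  fix \<omega> R assume w: "End \<omega> \<in> Ends" "R \<in> \<omega>" "ray_in_set ?W R"
  have "fst R n \<in> A" for n
  proof -
    have "gval A (Vx (fst R n)) < c" using w(3) unfolding ray_in_set_def by blast
    then show ?thesis using c by (auto simp: side_def split: if_splits)
  qed
  then have "pin A (End \<omega>)" using pin_End[OF w(1,2) A] unfolding tail_in_def by blast
  then show "End \<omega> \<in> ?W" using c w(1) by simp
next
  show "?W \<subseteq> XX \<union> Ends" by blast
  show "{p \<in> inner_points E. gval A p = c} \<subseteq> inner_points E" by blast
  show "{p \<in> inner_points E. gval A p = c} \<inter> ?W = {}" by force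
qed

lemma openin_gval_greater:
  assumes A: "fincut A" and c: "0 < c" "c < 1"
  shows "openin GT {p \<in> XX \<union> Ends. gval A p > c}"
proof -
  have "{p \<in> XX \<union> Ends. gval A p > c} = {p \<in> XX \<union> Ends. gval (- A) p < 1 - c}"
    using gval_compl[OF _ A] by auto
  then show ?thesis using openin_gval_less[of "- A" "1 - c"] A c by simp
qed

section \<open>Segments of edges and neighbourhoods of points\<close>

lemma Inner_image_emap:
  assumes "e \<in> E" "e' \<in> E" "0 < a" "b < 1"
  shows "{t\<in>{0..1::real}. emap e' t \<in> Inner e ` {a<..<b}} = (if e' = e then {a<..<b} else {})"
  using assms(3,4) unfolding edge_map_def by auto

lemma coInner_image_emap:
  assumes "e \<in> E" "e' \<in> E" "0 < a" "b < 1"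
  shows "{t\<in>{0..1::real}. emap e' t \<in> XX - Inner e ` {a..b}} = (if e' = e then {0..1} \<inter> - {a..b} else {0..1})"
proof -
  have "{t\<in>{0..1::real}. emap e' t \<in> XX - Inner e ` {a..b}} = {t\<in>{0..1::real}. emap e' t \<notin> Inner e ` {a..b}}"
    using emap_in_XX[OF assms(2)] by auto
  also have "\<dots> = (if e' = e then {0..1} \<inter> - {a..b} else {0..1})"
    using assms(3,4) unfolding edge_map_def by auto
  finally show ?thesis .
qed

lemma XT_open_segment:
  assumes "e \<in> E" "0 < a" "b < 1"
  shows "openin XT (Inner e ` {a<..<b})" "openin XT (XX - Inner e ` {a..b})"
proof -
  have "openin (top_of_set {0..1}) {a<..<b}"
    using assms(2,3) by (auto simp: openin_open intro!: exI[of _ "{a<..<b}"])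
  then have "openin (top_of_set {0..1}) {t\<in>{0..1::real}. emap e' t \<in> Inner e ` {a<..<b}}" if "e' \<in> E" for e'
    unfolding Inner_image_emap[OF assms(1) that assms(2,3)] by simp
  moreover have "Inner e ` {a<..<b} \<subseteq> XX" using assms unfolding XG_def inner_points_def by auto
  ultimately show "openin XT (Inner e ` {a<..<b})" unfolding openin_XT by blast
  have "openin (top_of_set {0..1::real}) ({0..1} \<inter> - {a..b})" by (intro openin_open_Int) auto
  then have "openin (top_of_set {0..1}) {t\<in>{0..1::real}. emap e' t \<in> XX - Inner e ` {a..b}}" if "e' \<in> E" for e'
    unfolding coInner_image_emap[OF assms(1) that assms(2,3)] by simp
  then show "openin XT (XX - Inner e ` {a..b})" unfolding openin_XT by blast
qed

lemma not_ray_in_segment: "\<not> ray_in_set (Inner e ` I) R"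
  unfolding ray_in_set_def by auto

lemma GT_open_segment_aux:
  assumes e: "e \<in> E" and ab: "0 < a" "a \<le> b" "b < 1"
  shows "openin GT (Inner e ` {a<..<b})"
proof (rule openin_GT_criterion[where Z = "{Inner e a, Inner e b}"])
  show W: "Inner e ` {a<..<b} \<subseteq> XX \<union> Ends" using e ab unfolding XG_def inner_points_def by auto
  show "{Inner e a, Inner e b} \<subseteq> inner_points E" using e ab unfolding inner_points_def by auto
  have "Inner e ` {a<..<b} \<inter> XX = Inner e ` {a<..<b}" using e ab unfolding XG_def inner_points_def by auto
  then show "openin XT (Inner e ` {a<..<b} \<inter> XX)" using XT_open_segment[OF e ab(1,3)] by simp
  have "{a, b} \<union> {a<..<b} = {a..b}" using ab by auto
  then have "(Inner e ` {a..b} :: ('v,'e) gpoint set) = {Inner e a, Inner e b} \<union> Inner e ` {a<..<b}" by (metis image_Un image_insert image_empty)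
  then have "XX - {Inner e a, Inner e b} - Inner e ` {a<..<b} = XX - Inner e ` {a..b}" by (simp only: Diff_eq Compl_Un Int_assoc)
  then show "openin XT (XX - {Inner e a, Inner e b} - Inner e ` {a<..<b})"
    using XT_open_segment[OF e ab(1,3)] by simp
next
  fix \<omega> and R :: "('v,'e) ray" assume "ray_in_set (Inner e ` {a<..<b}) R"
  then show "End \<omega> \<in> Inner e ` {a<..<b}" using not_ray_in_segment by metis
qed auto

text \<open>A segment that reaches 0 or 1 is not bounded by inner points, and only inner points may
  be deleted; it is exhausted by shorter segments that are.\<close>

lemma GT_open_segment:
  assumes e: "e \<in> E" and ab: "0 \<le> a" "b \<le> 1"
  shows "openin GT (Inner e ` {a<..<b})"
proof -
  have "(Inner e ` {a<..<b} :: ('v,'e) gpoint set) = (\<Union>(c, d)\<in>{(c, d). a < c \<and> c \<le> d \<and> d < b}. Inner e ` {c<..<d})" (is "?L = ?R")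
  proof
    show "?L \<subseteq> ?R"
    proof
      fix p :: "('v,'e) gpoint" assume "p \<in> ?L"
      then obtain t where t: "p = Inner e t" "a < t" "t < b" by auto
      then have "(a + t) / 2 < t \<and> t < (t + b) / 2 \<and> a < (a + t) / 2 \<and> (t + b) / 2 < b" by simp
      then have "p \<in> Inner e ` {(a + t) / 2<..<(t + b) / 2}" "((a + t) / 2, (t + b) / 2) \<in> {(c, d). a < c \<and> c \<le> d \<and> d < b}"
        using t by auto
      then show "p \<in> ?R" by blast
    qed
    show "?R \<subseteq> ?L" by auto
  qed
  moreover have "openin GT ?R"
    by (intro openin_Union) (use GT_open_segment_aux[OF e] ab in auto)
  ultimately show ?thesis by (simp only:)
qed

lemma inner_of_eq: "inner_of e = Inner e ` {0<..<1}"
  unfolding inner_of_def by auto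

lemma GT_open_inner_of: "e \<in> E \<Longrightarrow> openin GT (inner_of e)"
  unfolding inner_of_eq by (rule GT_open_segment) auto

lemma GT_open_cosegment:
  assumes e: "e \<in> E" and ab: "0 < a" "a \<le> b" "b < 1"
  shows "openin GT (XX \<union> Ends - Inner e ` {a..b})"
proof (rule openin_GT_criterion[where Z = "{Inner e a, Inner e b}"])
  let ?W = "XX \<union> Ends - Inner e ` {a..b}"
  show "{Inner e a, Inner e b} \<subseteq> inner_points E" using e ab unfolding inner_points_def by auto
  show "{Inner e a, Inner e b} \<inter> ?W = {}" using ab by auto
  have "?W \<inter> XX = XX - Inner e ` {a..b}" using Ends_disjoint by blast
  then show "openin XT (?W \<inter> XX)" using XT_open_segment[OF e ab(1,3)] by simp
  have "Inner e ` {a..b} \<subseteq> XX" using e ab unfolding XG_def inner_points_def by auto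
  then have "XX - {Inner e a, Inner e b} - ?W = Inner e ` ({a..b} - {a, b})" by auto
  moreover have "{a..b} - {a, b} = {a<..<b}" by auto
  ultimately show "openin XT (XX - {Inner e a, Inner e b} - ?W)"
    using XT_open_segment(1)[OF e ab(1,3)] by simp
  fix \<omega> assume w: "End \<omega> \<in> ?W" "End \<omega> \<in> Ends"
  obtain R where R: "ray R" "R \<in> \<omega>" using end_rays[OF w(2)] by blast
  obtain k where k: "\<forall>n\<ge>k. snd R n \<notin> {e}" using ray_avoids_finite[OF R(1), of "{e}"] by auto
  have "snd R (n + k) \<noteq> e" for n using k by simp
  then have "ray_in_set ?W (ray_tail k R)"
    using ray_D(1,2)[OF R(1)] unfolding ray_in_set_def ray_tail_def XG_def inner_of_def inner_points_def by auto
  then show "\<exists>R\<in>\<omega>. ray_in_set ?W R" using end_ray_tail[OF w(2) R(2)] by blast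
qed auto

lemma openin_GT_tilde:
  assumes "openin GT U" "p \<in> U"
  shows "\<exists>Z x. finite Z \<and> Z \<subseteq> inner_points E \<and> p \<in> tilde V E inc (gcomp Z x) \<and> tilde V E inc (gcomp Z x) \<subseteq> U"
proof -
  obtain T where T: "T \<in> basic_open_sets V E inc" "p \<in> T" "T \<subseteq> U"
    using assms unfolding openin_GT by metis
  then show ?thesis unfolding basic_iff by metis
qed

text \<open>Finitely many deleted points leave an interval around t untouched; being connected, it
  stays within the component of its centre.\<close>

lemma nbhd_inner:
  assumes U: "openin GT U" "Inner e t \<in> U" and e: "e \<in> E" "0 < t" "t < 1"
  shows "\<exists>a b. 0 < a \<and> a < t \<and> t < b \<and> b < 1 \<and> Inner e ` {a<..<b} \<subseteq> U"
proof -
  obtain Z x where Z: "finite Z" "Inner e t \<in> tilde V E inc (gcomp Z x)" "tilde V E inc (gcomp Z x) \<subseteq> U"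
    using openin_GT_tilde[OF U] by metis
  have "gcomp Z x \<subseteq> XX" using gcomp_sub by blast
  then have t: "Inner e t \<in> gcomp Z x" using Z(2) tilde_iff[of "gcomp Z x" "Inner e t"] by auto
  have "finite (Inner e -` Z)" using Z(1) by (rule finite_vimageI) (auto simp: inj_def)
  then have "open ({0<..<1} - Inner e -` Z)" by (intro open_Diff finite_imp_closed) auto
  moreover have "t \<in> {0<..<1} - Inner e -` Z" using t gcomp_sub[of Z x] e by auto
  ultimately obtain d where d: "d > 0" "ball t d \<subseteq> {0<..<1} - Inner e -` Z"
    unfolding open_contains_ball by blast
  \<comment> \<open>Halving d places the closed interval of radius r inside the ball, so that t - r
    and t + r also lie strictly between 0 and 1.\<close>
  define r where "r = d / 2"
  have "ball t d = {t - d<..<t + d}" by (rule ball_eq_greaterThanLessThan)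
  moreover have "{t - r..t + r} \<subseteq> {t - d<..<t + d}" using d unfolding r_def by auto
  ultimately have sub: "{t - r..t + r} \<subseteq> {0<..<1} - Inner e -` Z" using d(2) by (metis order_trans)
  have r: "r > 0" using d r_def by simp
  have in01: "0 < t - r" "t + r < 1" using subsetD[OF sub, of "t - r"] subsetD[OF sub, of "t + r"] r by auto
  have im: "emap e ` {t - r<..<t + r} = Inner e ` {t - r<..<t + r}"
    using in01 by (intro image_cong) auto
  have "connectedin XT (Inner e ` {t - r<..<t + r})"
    using connectedin_emap[OF e(1), of "{t - r<..<t + r}"] in01 unfolding im
    by (simp add: subset_iff)
  moreover have "Inner e ` {t - r<..<t + r} \<subseteq> XX - Z"
  proof
    fix q :: "('v,'e) gpoint" assume "q \<in> Inner e ` {t - r<..<t + r}"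
    then obtain s where s: "q = Inner e s" "s \<in> {t - r<..<t + r}" by blast
    then have "s \<in> {0<..<1} - Inner e -` Z" by (intro subsetD[OF sub]) auto
    then show "q \<in> XX - Z" using s(1) e(1) unfolding XG_def inner_points_def by auto
  qed
  moreover have "Inner e t \<in> Inner e ` {t - r<..<t + r}" using r by auto
  ultimately have "Inner e ` {t - r<..<t + r} \<subseteq> gcomp Z x" by (rule gcomp_maximal[OF _ _ _ t])
  then have "Inner e ` {t - r<..<t + r} \<subseteq> U" using tilde_sub[of "gcomp Z x"] Z(3) by blast
  then show ?thesis using r in01 by (intro exI[of _ "t - r"] exI[of _ "t + r"]) auto
qed

lemma small_for_finite:
  fixes S :: "real set"
  assumes "finite S" "\<And>s. s \<in> S \<Longrightarrow> 0 < s" shows "\<exists>r>0. \<forall>s\<in>S. r < s"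
  using assms
proof (induction S rule: finite_induct)
  case (insert s S)
  then obtain r where r: "r > 0" "\<forall>s\<in>S. r < s" by auto
  then show ?case using insert.prems[of s] by (intro exI[of _ "min r (s / 2)"]) auto
qed (auto intro: exI[of _ 1])

text \<open>F consists of the edges with a deleted point, and A of the vertices joined in G - F to a
  vertex of the component, so the cut of A lies in F. With r below the distance of every deleted
  point from both ends of its edge, a point with \<open>gval A\<close> below r that avoids the
  middle parts of the edges in F reaches A within X_G - Z.\<close>

lemma nbhd_VE:
  assumes U: "openin GT U" "p \<in> U" and p: "p \<in> VE"
  shows "\<exists>A F r. fincut A \<and> finite F \<and> F \<subseteq> E \<and> 0 < r \<and> r < 1/2 \<and> pin A p \<and>
    (\<forall>q\<in>XX \<union> Ends. gval A q < r \<longrightarrow> (\<forall>e\<in>F. q \<notin> Inner e ` {r..1 - r}) \<longrightarrow> q \<in> U)"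
proof -
  obtain Z x where Z: "finite Z" "Z \<subseteq> inner_points E" "p \<in> tilde V E inc (gcomp Z x)" "tilde V E inc (gcomp Z x) \<subseteq> U"
    using openin_GT_tilde[OF U] by metis
  have CX: "gcomp Z x \<subseteq> XX" using gcomp_sub by blast
  define F where "F = edges_of Z"
  have F: "finite F" "F \<subseteq> E" unfolding F_def using finite_edges_of edges_of_sub Z by blast+
  have "\<exists>v. Vx v \<in> gcomp Z x \<and> pin {w. conn F v w} p"
    using p
  proof (cases rule: VE_cases)
    case (1 v)
    then have "Vx v \<in> gcomp Z x" using Z(3) tilde_iff[OF CX] by auto
    then show ?thesis using 1 by (intro exI[of _ v]) simp
  next
    case (2 \<omega>)
    then have "p \<notin> gcomp Z x" using Ends_disjoint CX by blast
    then obtain R where R: "R \<in> \<omega>" "ray_in_set (gcomp Z x) R" using Z(3) tilde_iff[OF CX] 2(1) by auto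
    have ray: "ray R" using end_ray_ray[OF 2(2) R(1)] .
    obtain k where k: "\<forall>n\<ge>k. snd R n \<notin> F" using ray_avoids_finite[OF ray F(1)] by blast
    have "conn F (fst R k) (fst R n)" if "n \<ge> k" for n using ray_conn_tail[OF ray _ that] k by blast
    then have "tail_in {w. conn F (fst R k) w} R" unfolding tail_in_def by blast
    then have "pin {w. conn F (fst R k) w} p" unfolding 2(1) using R(1) by auto
    then show ?thesis using R(2) unfolding ray_in_set_def by blast
  qed
  then obtain v where v: "Vx v \<in> gcomp Z x" "pin {w. conn F v w} p" by blast
  define A where "A = {w. conn F v w}"
  have "delta A \<subseteq> F"
  proof
    fix e assume e: "e \<in> delta A"
    show "e \<in> F"
    proof (rule ccontr)
      assume "e \<notin> F"
      then have "e \<in> E - F" using e unfolding cutset_def by simp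
      then have "conn F (fst (inc e)) (snd (inc e))" by (rule conn_minus_edge)
      then have "fst (inc e) \<in> A \<longleftrightarrow> snd (inc e) \<in> A"
        unfolding A_def using conn_minus_trans conn_minus_sym by (metis mem_Collect_eq)
      then show False using e unfolding cutset_def by auto
    qed
  qed
  then have fA: "fincut A" unfolding fincut_def using F finite_subset by blast
  have wA: "Vx w \<in> gcomp Z x" if "w \<in> A" for w
    using conn_in_comp[OF _ Z(2) v(1), of w] that unfolding A_def F_def by simp
  \<comment> \<open>Including both t and 1 - t keeps each deleted point strictly between r and 1 -
    r, and 1/2 forces r < 1/2. The default 1 merely makes the case distinction total: Z consists of
    inner points.\<close>
  let ?S = "(\<lambda>q. case q of Inner e t \<Rightarrow> t | _ \<Rightarrow> 1) ` Z \<union> (\<lambda>q. case q of Inner e t \<Rightarrow> 1 - t | _ \<Rightarrow> 1) ` Z \<union> {1/2}"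
  have "\<exists>r>0. \<forall>s\<in>?S. r < s"
    by (rule small_for_finite) (use Z(1,2) in \<open>auto simp: inner_points_def\<close>)
  then obtain r where r: "0 < r" "\<forall>s\<in>?S. r < s" by blast
  have r12: "r < 1/2" using r by simp
  have rZ: "r < t \<and> t < 1 - r" if "Inner e t \<in> Z" for e t
  proof -
    have "t \<in> ?S" "1 - t \<in> ?S" using that by force+
    then have "r < t" "r < 1 - t" using r(2) by (metis bspec)+
    then show ?thesis by simp
  qed
  have "q \<in> U" if q: "q \<in> XX \<union> Ends" "gval A q < r" "\<forall>e\<in>F. q \<notin> Inner e ` {r..1 - r}" for q
  proof -
    have "q \<in> tilde V E inc (gcomp Z x)"
      using q(1)
    proof (cases rule: GT_cases)
      case 1
      have pinq: "pin A q" using q(2) gval_VE[OF 1, of A] r12 by (auto split: if_splits)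
      from 1 show ?thesis
      proof (cases rule: VE_cases)
        case (1 w)
        then show ?thesis using pinq wA tilde_sub[of "gcomp Z x"] by auto
      next
        case (2 \<omega> R)
        have "tail_in A R" using pinq pin_End[OF 2(2,4) fA] 2(1) by simp
        then obtain k where k: "\<forall>n\<ge>k. fst R n \<in> A" unfolding tail_in_def by blast
        obtain l where l: "\<forall>n\<ge>l. snd R n \<notin> F" using ray_avoids_finite[OF 2(3) F(1)] by blast
        let ?R = "ray_tail (max k l) R"
        have "fst ?R 0 \<in> A" "snd ?R n \<notin> edges_of Z" for n using k l unfolding ray_tail_def F_def by auto
        then have "ray_in_set (gcomp Z x) ?R"
          using ray_in_comp[OF ray_ray_tail[OF 2(3)] Z(2)] wA by blast
        then show ?thesis using tilde_iff[OF CX] 2(1,2) end_ray_tail[OF 2(2,4)] by blast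
      qed
    next
      case (2 e t)
      have conn_seg: "emap e s \<in> gcomp Z x" if "I \<subseteq> {0..1}" "connected I" "u \<in> I" "emap e u \<in> gcomp Z x" "s \<in> I"
        "\<And>y. y \<in> I \<Longrightarrow> 0 < y \<Longrightarrow> y < 1 \<Longrightarrow> Inner e y \<notin> Z" for I u s
      proof -
        have "emap e ` I \<subseteq> XX - Z"
        proof
          fix q assume "q \<in> emap e ` I"
          then obtain y where y: "q = emap e y" "y \<in> I" by blast
          then have "y \<in> {0..1}" using that(1) by blast
          moreover have "emap e y \<notin> Z"
          proof (cases "0 < y \<and> y < 1")
            case True
            then show ?thesis using that(6)[OF y(2)] by simp
          next
            case False
            then have "y = 0 \<or> y = 1" using \<open>y \<in> {0..1}\<close> by auto
            then show ?thesis using Z(2) unfolding inner_points_def by auto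
          qed
          ultimately show "q \<in> XX - Z" using emap_in_XX[OF 2(2)] y(1) by blast
        qed
        then have "emap e ` I \<subseteq> gcomp Z x"
          using gcomp_maximal[OF connectedin_emap[OF 2(2) that(2,1)]] that(3,4) by blast
        then show ?thesis using that(5) by blast
      qed
      have g: "(1 - t) * side A (fst (inc e)) + t * side A (snd (inc e)) < r" using q(2) 2(1) by simp
      have "emap e t \<in> gcomp Z x"
      proof (cases "e \<in> F")
        case False
        then have "e \<notin> delta A" using \<open>delta A \<subseteq> F\<close> by blast
        then have eq: "fst (inc e) \<in> A \<longleftrightarrow> snd (inc e) \<in> A" using in_delta[OF 2(2)] by simp
        have "fst (inc e) \<in> A"
        proof (rule ccontr)
          assume "fst (inc e) \<notin> A"
          then show False using g eq r12 by (simp add: side_def)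
        qed
        then have "emap e 0 \<in> gcomp Z x" using wA by simp
        moreover have "Inner e y \<notin> Z" for y using False unfolding F_def edges_of_def by blast
        ultimately show ?thesis using conn_seg[of "{0..1}" 0 t] 2 by auto
      next
        case True
        then have "t < r \<or> t > 1 - r" using q(3) 2(1) by force
        then show ?thesis
        proof
          assume t: "t < r"
          have "fst (inc e) \<in> A"
          proof (rule ccontr)
            assume "fst (inc e) \<notin> A"
            then have "(1 - t) + t * side A (snd (inc e)) < r" using g by (simp add: side_def)
            moreover have "0 \<le> t * side A (snd (inc e))" using 2 by (simp add: side_def)
            ultimately show False using t r12 by linarith
          qed
          then have "emap e 0 \<in> gcomp Z x" using wA by simp
          then show ?thesis using conn_seg[of "{0..t}" 0 t] 2 rZ[of e] t by fastforce
        next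
          assume t: "t > 1 - r"
          have "snd (inc e) \<in> A"
          proof (rule ccontr)
            assume "snd (inc e) \<notin> A"
            then have "(1 - t) * side A (fst (inc e)) + t < r" using g by (simp add: side_def)
            moreover have "0 \<le> (1 - t) * side A (fst (inc e))" using 2 by (simp add: side_def)
            ultimately show False using t r12 by linarith
          qed
          then have "emap e 1 \<in> gcomp Z x" using wA by simp
          then show ?thesis using conn_seg[of "{t..1}" 1 t] 2 rZ[of e] t by fastforce
        qed
      qed
      then show ?thesis using 2 tilde_sub[of "gcomp Z x"] by auto
    qed
    then show ?thesis using Z(4) by blast
  qed
  then show ?thesis using fA F r(1) r12 v(2) unfolding A_def[symmetric] by blast
qed

text \<open>Points of \<open>VE\<close> lie on no segment, so for q only the test against A remains
  of the neighbourhood in \<open>nbhd_VE\<close>, and q passes it because p does.\<close>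

lemma nbhd_VE_indistinguishable:
  assumes "openin GT U" "p \<in> U" "p \<in> VE" "q \<in> VE" "\<And>A. fincut A \<Longrightarrow> pin A p \<Longrightarrow> pin A q"
  shows "q \<in> U"
proof -
  obtain A F r where A: "fincut A" "0 < r" "pin A p"
    "\<forall>q\<in>XX \<union> Ends. gval A q < r \<longrightarrow> (\<forall>e\<in>F. q \<notin> Inner e ` {r..1 - r}) \<longrightarrow> q \<in> U"
    using nbhd_VE[OF assms(1-3)] by blast
  have "q \<notin> Inner e ` I" for e I using assms(4) unfolding VE_def Ends_def by auto
  then show ?thesis using A assms(5)[OF A(1,3)] gval_VE[OF assms(4), of A] VE_sub assms(4) by auto
qed

text \<open>By \<open>nbhd_VE\<close> and \<open>nbhd_inner\<close> the topology is generated by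
  sublevel sets of \<open>gval\<close>, open segments and complements of closed segments, so their
  preimages decide continuity.\<close>

lemma continuous_map_into_GT:
  assumes f: "f \<in> topspace T \<rightarrow> XX \<union> Ends"
    and g: "\<And>A. fincut A \<Longrightarrow> continuous_map T euclideanreal (\<lambda>y. gval A (f y))"
    and o: "\<And>e a b. e \<in> E \<Longrightarrow> 0 < a \<Longrightarrow> a < b \<Longrightarrow> b < 1 \<Longrightarrow> openin T {y \<in> topspace T. f y \<in> Inner e ` {a<..<b}}"
    and c: "\<And>e a b. e \<in> E \<Longrightarrow> 0 < a \<Longrightarrow> a < b \<Longrightarrow> b < 1 \<Longrightarrow> openin T {y \<in> topspace T. f y \<notin> Inner e ` {a..b}}"
  shows "continuous_map T GT f"
  unfolding continuous_map_def
proof (intro conjI allI impI)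
  show "f \<in> topspace T \<rightarrow> topspace GT" using f by simp
  fix U assume U: "openin GT U"
  show "openin T {y \<in> topspace T. f y \<in> U}"
  proof (subst openin_subopen, intro ballI)
    fix y assume y: "y \<in> {y \<in> topspace T. f y \<in> U}"
    then have "f y \<in> XX \<union> Ends" using f by blast
    then show "\<exists>W. openin T W \<and> y \<in> W \<and> W \<subseteq> {y \<in> topspace T. f y \<in> U}"
    proof (cases rule: GT_cases)
      case 1
      obtain A F r where A: "fincut A" "finite F" "F \<subseteq> E" "0 < r" "r < 1/2" "pin A (f y)"
        "\<forall>q\<in>XX \<union> Ends. gval A q < r \<longrightarrow> (\<forall>e\<in>F. q \<notin> Inner e ` {r..1 - r}) \<longrightarrow> q \<in> U"
        using nbhd_VE[OF U _ 1] y by blast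
      define W where "W = {y \<in> topspace T. gval A (f y) < r} \<inter> topspace T \<inter> (\<Inter>e\<in>F. {y \<in> topspace T. f y \<notin> Inner e ` {r..1 - r}})"
      have "openin T {y \<in> topspace T. gval A (f y) < r}"
        using g[OF A(1)] unfolding continuous_map_upper_lower_semicontinuous_lt by blast
      moreover have "openin T (topspace T \<inter> (\<Inter>e\<in>F. {y \<in> topspace T. f y \<notin> Inner e ` {r..1 - r}}))"
      proof (cases "F = {}")
        case False
        have "openin T (\<Inter>e\<in>F. {y \<in> topspace T. f y \<notin> Inner e ` {r..1 - r}})"
          by (rule openin_INT2) (use A(2-5) False c in auto)
        then show ?thesis by (rule openin_Int[OF openin_topspace])
      qed simp
      ultimately have "openin T W" unfolding W_def Int_assoc by (rule openin_Int)
      moreover have "f y \<notin> Inner e ` I" for e I using 1 unfolding VE_def Ends_def by auto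
      then have "y \<in> W" unfolding W_def using y A(4,6) gval_VE[OF 1, of A] by auto
      moreover have "W \<subseteq> {y \<in> topspace T. f y \<in> U}"
      proof
        fix z assume "z \<in> W"
        then have "z \<in> topspace T" "gval A (f z) < r" "\<forall>e\<in>F. f z \<notin> Inner e ` {r..1 - r}" unfolding W_def by auto
        moreover have "f z \<in> XX \<union> Ends" using f \<open>z \<in> topspace T\<close> by blast
        ultimately show "z \<in> {y \<in> topspace T. f y \<in> U}" using A(7) by blast
      qed
      ultimately show ?thesis by blast
    next
      case (2 e t)
      then have "Inner e t \<in> U" using y by simp
      then obtain a b where ab: "0 < a" "a < t" "t < b" "b < 1" "Inner e ` {a<..<b} \<subseteq> U"
        using nbhd_inner[OF U _ 2(2-4)] by blast
      have "openin T {y \<in> topspace T. f y \<in> Inner e ` {a<..<b}}" using o[OF 2(2), of a b] ab by simp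
      moreover have "y \<in> {y \<in> topspace T. f y \<in> Inner e ` {a<..<b}}" using y 2(1) ab by auto
      ultimately show ?thesis using ab(5) by (intro exI[of _ "{y \<in> topspace T. f y \<in> Inner e ` {a<..<b}}"]) auto
    qed
  qed
qed

end

section \<open>Links\<close>

context conn_graph
begin

definition separates :: "'v set \<Rightarrow> ('v,'e) gpoint \<Rightarrow> ('v,'e) gpoint \<Rightarrow> bool" where
  "separates A x y \<longleftrightarrow> fincut A \<and> pin A x \<and> \<not> pin A y"

text \<open>The last clause is minimality of P among the sets meeting every separating cut,
  witnessed edge by edge.\<close>

definition link :: "'e set \<Rightarrow> ('v,'e) gpoint \<Rightarrow> ('v,'e) gpoint \<Rightarrow> bool" where
  "link P x y \<longleftrightarrow> P \<subseteq> E \<and> x \<in> VE \<and> y \<in> VE \<and> (\<forall>A. separates A x y \<longrightarrow> delta A \<inter> P \<noteq> {}) \<and>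
     (\<forall>e\<in>P. \<exists>A. separates A x y \<and> delta A \<inter> P = {e})"

text \<open>For an end, the edges of one of its rays form Q: a finite cut that misses them keeps the
  whole ray on the side of its first vertex.\<close>

lemma countable_spine:
  assumes "p \<in> VE"
  shows "\<exists>Q v. countable Q \<and> Q \<subseteq> E \<and> v \<in> V \<and> (\<forall>A. fincut A \<longrightarrow> pin A p \<noteq> (v \<in> A) \<longrightarrow> delta A \<inter> Q \<noteq> {})"
  using assms
proof (cases rule: VE_cases)
  case (1 v)
  then show ?thesis by (intro exI[of _ "{}"] exI[of _ v]) auto
next
  case (2 \<omega> R)
  have "delta A \<inter> range (snd R) \<noteq> {}" if A: "fincut A" "pin A p \<noteq> (fst R 0 \<in> A)" for A
  proof
    assume "delta A \<inter> range (snd R) = {}"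
    then have "fst R 0 \<in> A \<longleftrightarrow> fst R n \<in> A" for n
      using conn_minus_same_side[OF ray_conn_tail[OF 2(3), of 0 "delta A" n], of A] by auto
    then have "tail_in A R \<longleftrightarrow> fst R 0 \<in> A" unfolding tail_in_def by auto
    then show False using A pin_End[OF 2(2,4) A(1)] 2(1) by simp
  qed
  moreover have "range (snd R) \<subseteq> E" using ray_D(2)[OF 2(3)] by blast
  ultimately show ?thesis using ray_D(1)[OF 2(3), of 0] by (intro exI[of _ "range (snd R)"] exI[of _ "fst R 0"]) auto
qed

text \<open>Although E may be uncountable, the spines of x and y together with a finite path between
  their base vertices meet every separating cut: the side must change on one of these three
  pieces.\<close>

lemma countable_separator:
  assumes "x \<in> VE" "y \<in> VE"
  shows "\<exists>Q. countable Q \<and> Q \<subseteq> E \<and> (\<forall>A. separates A x y \<longrightarrow> delta A \<inter> Q \<noteq> {})"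
proof -
  obtain Q1 u where 1: "countable Q1" "Q1 \<subseteq> E" "u \<in> V" "\<And>A. fincut A \<Longrightarrow> pin A x \<noteq> (u \<in> A) \<Longrightarrow> delta A \<inter> Q1 \<noteq> {}"
    using countable_spine[OF assms(1)] by metis
  obtain Q2 v where 2: "countable Q2" "Q2 \<subseteq> E" "v \<in> V" "\<And>A. fincut A \<Longrightarrow> pin A y \<noteq> (v \<in> A) \<Longrightarrow> delta A \<inter> Q2 \<noteq> {}"
    using countable_spine[OF assms(2)] by metis
  obtain Q3 where 3: "finite Q3" "Q3 \<subseteq> E - {}" "\<forall>A. (u \<in> A) \<noteq> (v \<in> A) \<longrightarrow> cutset inc Q3 A \<noteq> {}"
    using path_edges[OF conn_V[OF 1(3) 2(3)]] by metis
  have "delta A \<inter> (Q1 \<union> Q2 \<union> Q3) \<noteq> {}" if A: "separates A x y" for A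
  proof (cases "(u \<in> A) = (v \<in> A)")
    case True
    then have "pin A x \<noteq> (u \<in> A) \<or> pin A y \<noteq> (v \<in> A)" using A unfolding separates_def by auto
    then show ?thesis using 1(4)[of A] 2(4)[of A] A unfolding separates_def by blast
  next
    case False
    then have "cutset inc Q3 A \<noteq> {}" using 3(3) by simp
    then show ?thesis using 3(2) unfolding cutset_def by auto
  qed
  then show ?thesis using 1(1,2) 2(1,2) 3(1,2) by (intro exI[of _ "Q1 \<union> Q2 \<union> Q3"]) (auto intro: countable_finite)
qed

text \<open>A separating cut that meets P in e alone and is smallest with this property is a bond.\<close>

lemma link_countable:
  assumes link: "link P x y" shows "countable P"
proof -
  have l: "x \<in> VE" "y \<in> VE" "\<And>A. separates A x y \<Longrightarrow> delta A \<inter> P \<noteq> {}"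
    "\<And>e. e \<in> P \<Longrightarrow> \<exists>A. separates A x y \<and> delta A \<inter> P = {e}" using link unfolding link_def by simp_all
  obtain Q where Q: "countable Q" "Q \<subseteq> E" "\<And>A. separates A x y \<Longrightarrow> delta A \<inter> Q \<noteq> {}"
    using countable_separator[OF l(1,2)] by metis
  have "\<exists>D. bondset inc E D \<and> finite D \<and> D \<inter> Q \<noteq> {} \<and> D \<inter> P = {e}" if e: "e \<in> P" for e
  proof -
    let ?S = "\<lambda>A. separates A x y \<and> delta A \<inter> P = {e}"
    obtain A0 where "?S A0" using l(4)[OF e] by metis
    then obtain A where A: "?S A" and min: "\<And>B. ?S B \<Longrightarrow> card (delta A) \<le> card (delta B)"
      using ex_has_least_nat[of ?S A0 "\<lambda>A. card (delta A)"] by metis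
    have fin: "finite (delta A)" using A unfolding separates_def fincut_def by simp
    have "delta B = delta A" if B: "delta B \<noteq> {}" "delta B \<subseteq> delta A" for B
    proof (rule ccontr)
      assume ne: "delta B \<noteq> delta A"
      have fB: "fincut B" using B(2) fin finite_subset unfolding fincut_def by metis
      have fA: "fincut A" using A unfolding separates_def by simp
      have key: False if s: "separates C x y" "delta C \<subset> delta A" for C
      proof -
        have "delta C \<inter> P \<subseteq> {e}" using s(2) A by auto
        then have "delta C \<inter> P = {e}" using l(3)[OF s(1)] by auto
        then have "card (delta A) \<le> card (delta C)" using min s(1) by simp
        then show False using psubset_card_mono[OF fin s(2)] by simp
      qed
      \<comment> \<open>A nonempty cut properly inside that of A splits it into the cuts of B and C.
        Since A is the symmetric difference of B and C, one of these or its complement separates x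
        from y, with a smaller cut.\<close>
      define C where "C = (A - B) \<union> (B - A)"
      have dC: "delta C = delta A - delta B" using B(2) unfolding C_def cutset_sym_diff by auto
      have fC: "fincut C" unfolding fincut_def dC using fin by simp
      have lt: "delta C \<subset> delta A" "delta B \<subset> delta A" using dC B ne by auto
      have pC: "pin C p \<longleftrightarrow> (pin A p \<noteq> pin B p)" if "p \<in> VE" for p
        unfolding C_def using pin_Un[OF that, of "A - B" "B - A"] pin_Diff[OF that fA fB] pin_Diff[OF that fB fA]
          fincut_Diff fA fB by auto
      have AxAy: "pin A x" "\<not> pin A y" using A unfolding separates_def by auto
      consider "pin B x" "\<not> pin B y" | "\<not> pin B x" "pin B y" | "pin B x = pin B y" by auto
      then show False
      proof cases
        case 1
        then show False using key[of B] fB lt unfolding separates_def by simp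
      next
        case 2
        then have "separates (- B) x y" using pin_compl[OF l(1) fB] pin_compl[OF l(2) fB] fB unfolding separates_def by simp
        then show False using key[of "- B"] lt by simp
      next
        case 3
        show False
        proof (cases "pin B x")
          case True
          then have "separates (- C) x y" using pC[OF l(1)] pC[OF l(2)] 3 AxAy fC
              pin_compl[OF l(1) fC] pin_compl[OF l(2) fC] unfolding separates_def by simp
          then show False using key[of "- C"] lt by simp
        next
          case False
          then have "separates C x y" using pC[OF l(1)] pC[OF l(2)] 3 AxAy fC unfolding separates_def by simp
          then show False using key[of C] lt by simp
        qed
      qed
    qed
    moreover have "delta A \<noteq> {}" using A by auto
    ultimately have "bondset inc E (delta A)" by (intro bondsetI)
    then show ?thesis using A fin Q(3) by (intro exI[of _ "delta A"]) auto
  qed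
  then obtain D where D: "\<And>e. e \<in> P \<Longrightarrow> bondset inc E (D e) \<and> finite (D e) \<and> D e \<inter> Q \<noteq> {}"
    "\<And>e. e \<in> P \<Longrightarrow> D e \<inter> P = {e}" by metis
  have "inj_on D P" using D(2) by (metis inj_onI singleton_inject)
  moreover have "countable (D ` P)"
    by (rule countable_subset[OF _ countable_bonds[OF Q(1,2)]]) (use D(1) in auto)
  ultimately show ?thesis by (rule countable_image_inj_on[rotated])
qed

end

section \<open>The linear order on a link\<close>

locale link_path = conn_graph V E inc for V :: "'v set" and E :: "'e set" and inc +
  fixes P :: "'e set" and x y :: "('v,'e) gpoint"
  assumes link: "link P x y"
begin

lemma PE: "e \<in> P \<Longrightarrow> e \<in> E" and xVE: "x \<in> VE" and yVE: "y \<in> VE"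
  using link unfolding link_def by auto

definition K :: "'e \<Rightarrow> 'v set" where "K e = (SOME A. separates A x y \<and> delta A \<inter> P = {e})"

lemma K:
  assumes "e \<in> P"
  shows "fincut (K e)" "pin (K e) x" "\<not> pin (K e) y" "\<And>f. f \<in> P \<Longrightarrow> f \<in> delta (K e) \<longleftrightarrow> f = e"
proof -
  have "\<exists>A. separates A x y \<and> delta A \<inter> P = {e}" using link assms unfolding link_def by simp
  then have *: "separates (K e) x y \<and> delta (K e) \<inter> P = {e}" unfolding K_def by (rule someI_ex)
  then show "fincut (K e)" "pin (K e) x" "\<not> pin (K e) y" unfolding separates_def by auto
  show "\<And>f. f \<in> P \<Longrightarrow> f \<in> delta (K e) \<longleftrightarrow> f = e" using * by auto
qed

lemma no_crossing:
  assumes "fincut B" "\<And>f. f \<in> P \<Longrightarrow> f \<notin> delta B" shows "pin B x \<longleftrightarrow> pin B y"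
proof -
  have e: "delta B \<inter> P = {}" using assms(2) by auto
  have l: "separates A x y \<Longrightarrow> delta A \<inter> P \<noteq> {}" for A using link unfolding link_def by simp
  have "\<not> separates B x y" "\<not> separates (- B) x y" using l[of B] l[of "- B"] e by auto
  then show ?thesis using assms(1) pin_compl[OF xVE assms(1)] pin_compl[OF yVE assms(1)] unfolding separates_def by auto
qed

text \<open>The symmetric difference with \<open>K e\<close> cancels the crossing at e and leaves a
  cut that no edge of P crosses. That cut has x and y on the same side, whereas \<open>K e\<close>
  separates them.\<close>

lemma one_crossing:
  assumes B: "fincut B" and e: "e \<in> P" and only: "\<And>f. f \<in> P \<Longrightarrow> f \<in> delta B \<longleftrightarrow> f = e"
  shows "pin B x \<noteq> pin B y"
proof
  assume eq: "pin B x = pin B y"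
  define C where "C = (K e - B) \<union> (B - K e)"
  have fC: "fincut C" unfolding C_def using B K(1)[OF e] by auto
  have "f \<notin> delta C" if "f \<in> P" for f
    unfolding C_def cutset_sym_diff using only[OF that] K(4)[OF e that] by auto
  then have "pin C x \<longleftrightarrow> pin C y" by (rule no_crossing[OF fC])
  moreover have "pin C p \<longleftrightarrow> (pin (K e) p \<noteq> pin B p)" if "p \<in> VE" for p
    unfolding C_def using pin_Un[OF that, of "K e - B" "B - K e"] pin_Diff[OF that K(1)[OF e] B] pin_Diff[OF that B K(1)[OF e]]
      fincut_Diff K(1)[OF e] B by auto
  ultimately show False using K(2,3)[OF e] xVE yVE eq by auto
qed

text \<open>For f \<noteq> e in P the edge f does not cross \<open>K e\<close>, so its first end
  decides on which side all of f lies; the side of x counts as earlier.\<close>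

definition before :: "'e \<Rightarrow> 'e \<Rightarrow> bool" where
  "before f e \<longleftrightarrow> f \<in> P \<and> e \<in> P \<and> f \<noteq> e \<and> fst (inc f) \<in> K e"

text \<open>The end of e on the side of x. Together with \<open>tgt\<close> it directs e from x
  towards y, whatever the order of its ends in \<open>inc\<close>.\<close>

definition src :: "'e \<Rightarrow> 'v" where "src e = (if fst (inc e) \<in> K e then fst (inc e) else snd (inc e))"
definition tgt :: "'e \<Rightarrow> 'v" where "tgt e = (if fst (inc e) \<in> K e then snd (inc e) else fst (inc e))"

lemma src_tgt: assumes "e \<in> P" shows "src e \<in> K e" "tgt e \<notin> K e"
  using K(4)[OF assms assms] in_delta[OF PE[OF assms], of "K e"] unfolding src_def tgt_def by auto

lemma delta_src_tgt: "e \<in> P \<Longrightarrow> e \<in> delta B \<longleftrightarrow> (src e \<in> B) \<noteq> (tgt e \<in> B)"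
  using in_delta[OF PE] unfolding src_def tgt_def by auto

lemma before_ends:
  assumes "f \<in> P" "e \<in> P" "f \<noteq> e"
  shows "src f \<in> K e \<longleftrightarrow> before f e" "tgt f \<in> K e \<longleftrightarrow> before f e"
  using assms K(4)[OF assms(2,1)] in_delta[OF PE[OF assms(1)], of "K e"] unfolding before_def src_def tgt_def by auto

lemma before_irrefl: "\<not> before e e" and before_P: "before f e \<Longrightarrow> f \<in> P \<and> e \<in> P"
  unfolding before_def by auto

text \<open>If each edge came before the other, no edge of P would cross the union of
  \<open>K e\<close> and \<open>K f\<close>; if neither did, none would cross the intersection. Both
  sets contain x but not y, so P would miss a separating cut.\<close>

lemma before_total:
  assumes "e \<in> P" "f \<in> P" "e \<noteq> f" shows "before e f \<longleftrightarrow> \<not> before f e"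
proof
  assume ef: "before e f"
  show "\<not> before f e"
  proof
    assume fe: "before f e"
    let ?B = "K e \<union> K f"
    have "g \<notin> delta ?B" if g: "g \<in> P" for g
      unfolding delta_src_tgt[OF g] using before_ends[OF g assms(1)] before_ends[OF g assms(2)] ef fe assms(3)
      by (cases "g = e"; cases "g = f") auto
    then have "pin ?B x \<longleftrightarrow> pin ?B y" using K(1)[OF assms(1)] K(1)[OF assms(2)] by (intro no_crossing) auto
    then show False using pin_Un[OF xVE K(1)[OF assms(1)] K(1)[OF assms(2)]] pin_Un[OF yVE K(1)[OF assms(1)] K(1)[OF assms(2)]]
        K(2,3)[OF assms(1)] K(3)[OF assms(2)] by simp
  qed
next
  assume fe: "\<not> before f e"
  show "before e f"
  proof (rule ccontr)
    assume ef: "\<not> before e f"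
    let ?B = "K e \<inter> K f"
    have "g \<notin> delta ?B" if g: "g \<in> P" for g
      unfolding delta_src_tgt[OF g] using before_ends[OF g assms(1)] before_ends[OF g assms(2)] ef fe assms(3)
      by (cases "g = e"; cases "g = f") auto
    then have "pin ?B x \<longleftrightarrow> pin ?B y" using K(1)[OF assms(1)] K(1)[OF assms(2)] by (intro no_crossing) auto
    then show False using pin_Int[OF xVE K(1)[OF assms(1)] K(1)[OF assms(2)]] pin_Int[OF yVE K(1)[OF assms(1)] K(1)[OF assms(2)]]
        K(2,3)[OF assms(1)] K(2)[OF assms(2)] by simp
  qed
qed

text \<open>A cyclic triple d, e, f would put each edge inside the \<open>K\<close> of the next one.
  Then no edge of P crosses the union of the three sides, which contains x but not y.\<close>

lemma before_trans:
  assumes de: "before d e" and ef: "before e f" shows "before d f"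
proof (rule ccontr)
  assume ndf: "\<not> before d f"
  have P: "d \<in> P" "e \<in> P" "f \<in> P" using before_P[OF de] before_P[OF ef] by auto
  have ne: "d \<noteq> e" "e \<noteq> f" using de ef before_irrefl by auto
  have "d \<noteq> f" using de ef before_total[OF P(1,2) ne(1)] by auto
  then have fd: "before f d" using before_total[OF P(3,1)] ndf by auto
  let ?B = "K d \<union> K e \<union> K f"
  have "g \<notin> delta ?B" if g: "g \<in> P" for g
  proof -
    consider "g = d" | "g = e" | "g = f" | "g \<noteq> d" "g \<noteq> e" "g \<noteq> f" by blast
    then show ?thesis
    proof cases
      case 1
      then show ?thesis unfolding delta_src_tgt[OF g] using before_ends[OF P(1,2) ne(1)] de by simp
    next
      case 2
      then show ?thesis unfolding delta_src_tgt[OF g] using before_ends[OF P(2,3) ne(2)] ef by simp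
    next
      case 3
      then show ?thesis unfolding delta_src_tgt[OF g] using before_ends[OF P(3,1)] \<open>d \<noteq> f\<close> fd by simp
    next
      case 4
      then show ?thesis unfolding delta_src_tgt[OF g]
        using before_ends[OF g P(1)] before_ends[OF g P(2)] before_ends[OF g P(3)] by simp
    qed
  qed
  moreover have fB: "fincut (K d)" "fincut (K e)" "fincut (K f)" "fincut (K d \<union> K e)" "fincut ?B" using K(1) P by auto
  ultimately have "pin ?B x \<longleftrightarrow> pin ?B y" by (intro no_crossing) auto
  then show False using pin_Un[OF xVE fB(4,3)] pin_Un[OF yVE fB(4,3)] pin_Un[OF xVE fB(1,2)] pin_Un[OF yVE fB(1,2)]
      K(2,3)[OF P(1)] K(3)[OF P(2)] K(3)[OF P(3)] by simp
qed

lemma before_max: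
  assumes "finite S" "S \<subseteq> P" "S \<noteq> {}" shows "\<exists>m\<in>S. \<forall>f\<in>S. f = m \<or> before f m"
  using assms(1,3,2)
proof (induction S rule: finite_ne_induct)
  case (insert e S)
  then obtain m where m: "m \<in> S" "\<forall>f\<in>S. f = m \<or> before f m" by auto
  have P: "e \<in> P" "m \<in> P" "e \<noteq> m" using insert m by auto
  then consider "before e m" | "before m e" using before_total by blast
  then show ?case
  proof cases
    case 2
    then have "f = e \<or> before f e" if "f \<in> insert e S" for f
      using m(2) before_trans[of f m e] that by (cases "f = m") auto
    then show ?thesis by blast
  qed (use m in auto)
qed simp

lemma before_min:
  assumes "finite S" "S \<subseteq> P" "S \<noteq> {}" shows "\<exists>m\<in>S. \<forall>f\<in>S. f = m \<or> before m f"
  using assms(1,3,2)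
proof (induction S rule: finite_ne_induct)
  case (insert e S)
  then obtain m where m: "m \<in> S" "\<forall>f\<in>S. f = m \<or> before m f" by auto
  have P: "e \<in> P" "m \<in> P" "e \<noteq> m" using insert m by auto
  then consider "before m e" | "before e m" using before_total by blast
  then show ?case
  proof cases
    case 2
    then have "f = e \<or> before e f" if "f \<in> insert e S" for f
      using m(2) before_trans[of e m f] that by (cases "f = m") auto
    then show ?thesis by blast
  qed (use m in auto)
qed simp

text \<open>Along P, a finite cut changes sides only at the edges of P it contains.\<close>

lemma same_side_start:
  assumes B: "fincut B" and e: "e \<in> P" and no: "\<And>f. before f e \<Longrightarrow> f \<notin> delta B"
  shows "src e \<in> B \<longleftrightarrow> pin B x"
proof -
  have *: "src e \<in> B" if B: "fincut B" and no: "\<And>f. before f e \<Longrightarrow> f \<notin> delta B" and px: "pin B x" for B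
  proof (rule ccontr)
    assume t: "src e \<notin> B"
    let ?C = "K e \<inter> B"
    have "g \<notin> delta ?C" if g: "g \<in> P" for g
      unfolding delta_src_tgt[OF g] using before_ends[OF g e] no[of g] t src_tgt[OF e] delta_src_tgt[OF g, of B]
      by (cases "g = e") auto
    then have "pin ?C x \<longleftrightarrow> pin ?C y" using K(1)[OF e] B by (intro no_crossing) auto
    then show False using pin_Int[OF xVE K(1)[OF e] B] pin_Int[OF yVE K(1)[OF e] B] K(2,3)[OF e] px by simp
  qed
  show ?thesis
    using *[OF B no] *[of "- B"] B no pin_compl[OF xVE B] by auto
qed

lemma same_side_end:
  assumes B: "fincut B" and e: "e \<in> P" and no: "\<And>f. before e f \<Longrightarrow> f \<notin> delta B"
  shows "tgt e \<in> B \<longleftrightarrow> pin B y"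
proof -
  have *: "tgt e \<in> B" if B: "fincut B" and no: "\<And>f. before e f \<Longrightarrow> f \<notin> delta B" and py: "pin B y" for B
  proof (rule ccontr)
    assume t: "tgt e \<notin> B"
    let ?C = "B - K e"
    have "g \<notin> delta ?C" if g: "g \<in> P" for g
      unfolding delta_src_tgt[OF g] using before_ends[OF g e] no[of g] t src_tgt[OF e] delta_src_tgt[OF g, of B]
        before_total[OF e g] by (cases "g = e") auto
    then have "pin ?C x \<longleftrightarrow> pin ?C y" using K(1)[OF e] B by (intro no_crossing) auto
    then show False using pin_Diff[OF xVE B K(1)[OF e]] pin_Diff[OF yVE B K(1)[OF e]] K(2,3)[OF e] py by simp
  qed
  show ?thesis
    using *[OF B no] *[of "- B"] B no pin_compl[OF yVE B] by auto
qed

text \<open>\<open>K e' - K e\<close> is the stretch from the target of e to the source of e' and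
  contains neither x nor y. If B contained the first of these vertices but not the second, e would
  be the only edge of P crossing the intersection of the stretch with B, against
  \<open>one_crossing\<close>.\<close>

lemma same_side_between:
  assumes B: "fincut B" and ee: "before e e'" and no: "\<And>f. before e f \<Longrightarrow> before f e' \<Longrightarrow> f \<notin> delta B"
  shows "tgt e \<in> B \<longleftrightarrow> src e' \<in> B"
proof -
  have e: "e \<in> P" "e' \<in> P" "e \<noteq> e'" using before_P[OF ee] ee before_irrefl by auto
  have *: "src e' \<in> B" if B: "fincut B" and no: "\<And>f. before e f \<Longrightarrow> before f e' \<Longrightarrow> f \<notin> delta B" and h: "tgt e \<in> B" for B
  proof (rule ccontr)
    assume t: "src e' \<notin> B"
    let ?C = "(K e' - K e) \<inter> B"
    have fC: "fincut (K e' - K e)" "fincut ?C" using K(1)[OF e(1)] K(1)[OF e(2)] B by auto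
    have "g \<in> delta ?C \<longleftrightarrow> g = e" if g: "g \<in> P" for g
    proof -
      consider "g = e" | "g = e'" | "before g e" | "before e' g" | "before e g" "before g e'"
        using before_total[OF g e(1)] before_total[OF g e(2)] by blast
      then show ?thesis
      proof cases
        case 1
        then show ?thesis unfolding delta_src_tgt[OF g] using src_tgt[OF e(1)] before_ends[OF e] ee h by auto
      next
        case 2
        then show ?thesis unfolding delta_src_tgt[OF g] using src_tgt[OF e(2)] t e(3) by auto
      next
        case 3
        then have "g \<noteq> e" using before_irrefl by auto
        then show ?thesis unfolding delta_src_tgt[OF g] using before_ends[OF g e(1)] 3 by auto
      next
        case 4
        then have "\<not> before g e'" "g \<noteq> e'" "g \<noteq> e"
          using before_total[OF e(2) g] before_irrefl ee before_total[OF e(1,2)] e(3) by auto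
        then show ?thesis unfolding delta_src_tgt[OF g] using before_ends[OF g e(2)] by auto
      next
        case 5
        then have "g \<noteq> e" "g \<noteq> e'" "\<not> before g e" using before_irrefl before_total[OF e(1) g] by auto
        then show ?thesis unfolding delta_src_tgt[OF g]
          using before_ends[OF g e(2)] before_ends[OF g e(1)] 5 no[OF 5] delta_src_tgt[OF g, of B] by auto
      qed
    qed
    then have "pin ?C x \<noteq> pin ?C y" by (rule one_crossing[OF fC(2) e(1)])
    then show False using pin_Int[OF xVE fC(1) B] pin_Int[OF yVE fC(1) B]
        pin_Diff[OF xVE K(1)[OF e(2)] K(1)[OF e(1)]] pin_Diff[OF yVE K(1)[OF e(2)] K(1)[OF e(1)]]
        K(2,3)[OF e(1)] K(3)[OF e(2)] by simp
  qed
  show ?thesis using *[OF B no] *[of "- B"] B no by auto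
qed

section \<open>The side of a cut after an initial segment of the link\<close>

definition px :: "'v set \<Rightarrow> real" where "px B = (if pin B x then 0 else 1)"
definition jump :: "'v set \<Rightarrow> 'e \<Rightarrow> real" where "jump B e = side B (tgt e) - side B (src e)"
text \<open>The side of x, corrected by the signed change at each edge of L in the cut of B. For an
  initial segment L and a finite cut this is 0 or 1, with 0 for the side B as in
  \<open>side\<close>, and tells on which side the position right after L lies.\<close>

definition val :: "'v set \<Rightarrow> 'e set \<Rightarrow> real" where "val B L = px B + sum (jump B) (delta B \<inter> L)"

lemma jump_zero: "e \<in> P \<Longrightarrow> e \<notin> delta B \<Longrightarrow> jump B e = 0"
  using delta_src_tgt[of e B] unfolding jump_def side_def by auto

text \<open>Induction on the number of crossings before e. After the last of them, m, nothing
  crosses B until e, so \<open>tgt m\<close> and \<open>src e\<close> are on the same side.\<close>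

lemma val_before: "fincut B \<Longrightarrow> e \<in> P \<Longrightarrow> val B {f. before f e} = side B (src e)"
proof (induction "card (delta B \<inter> {f. before f e})" arbitrary: e rule: less_induct)
  case less
  have fin: "finite (delta B \<inter> {f. before f e})" using less.prems unfolding fincut_def by blast
  show ?case
  proof (cases "delta B \<inter> {f. before f e} = {}")
    case True
    then have "src e \<in> B \<longleftrightarrow> pin B x" using same_side_start[OF less.prems] by blast
    then show ?thesis unfolding val_def True px_def side_def by simp
  next
    case False
    obtain m where m: "m \<in> delta B" "before m e" "\<And>f. f \<in> delta B \<Longrightarrow> before f e \<Longrightarrow> f = m \<or> before f m"
      using before_max[OF fin _ False] before_P by blast
    have eq: "delta B \<inter> {f. before f e} = insert m (delta B \<inter> {f. before f m})"
      using m before_trans by blast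
    have notin: "m \<notin> delta B \<inter> {f. before f m}" using before_irrefl by blast
    have fin': "finite (delta B \<inter> {f. before f m})" using fin unfolding eq by simp
    have "card (delta B \<inter> {f. before f m}) < card (delta B \<inter> {f. before f e})"
      unfolding eq using notin fin' by simp
    then have "val B {f. before f m} = side B (src m)" using less.hyps less.prems(1) before_P[OF m(2)] by blast
    then have "val B {f. before f e} = side B (tgt m)"
      unfolding val_def eq sum.insert[OF fin' notin] jump_def by simp
    moreover have "tgt m \<in> B \<longleftrightarrow> src e \<in> B"
    proof (rule same_side_between[OF less.prems(1) m(2)])
      fix f assume f: "before m f" "before f e"
      then have "f \<noteq> m" "\<not> before f m" using before_irrefl before_total before_P by metis+
      then show "f \<notin> delta B" using m(3) f by blast
    qed
    ultimately show ?thesis unfolding side_def by simp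
  qed
qed

definition initial :: "'e set \<Rightarrow> bool" where
  "initial L \<longleftrightarrow> L \<subseteq> P \<and> (\<forall>e\<in>L. \<forall>f. before f e \<longrightarrow> f \<in> L)"

text \<open>Here m is an edge of L after which L has no crossing of B, whether or not m itself
  crosses B; one m can therefore serve several cuts at once in \<open>val_common\<close>.\<close>

lemma val_last:
  assumes B: "fincut B" and L: "initial L" "m \<in> L" and last: "\<And>f. f \<in> delta B \<Longrightarrow> f \<in> L \<Longrightarrow> f = m \<or> before f m"
  shows "val B L = side B (tgt m)"
proof -
  have mP: "m \<in> P" using L unfolding initial_def by blast
  have vb: "val B {f. before f m} = side B (src m)" by (rule val_before[OF B mP])
  have fin: "finite (delta B \<inter> {f. before f m})" using B unfolding fincut_def by blast
  have notin: "m \<notin> delta B \<inter> {f. before f m}" using before_irrefl by blast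
  show ?thesis
  proof (cases "m \<in> delta B")
    case True
    then have "delta B \<inter> L = insert m (delta B \<inter> {f. before f m})"
      using L last unfolding initial_def by blast
    then have "val B L = val B {f. before f m} + jump B m" unfolding val_def by (simp add: sum.insert[OF fin notin])
    then show ?thesis unfolding vb jump_def by simp
  next
    case False
    then have "delta B \<inter> L = delta B \<inter> {f. before f m}"
      using L last unfolding initial_def by blast
    then show ?thesis using vb jump_zero[OF mP False] unfolding val_def jump_def by simp
  qed
qed

lemma val_empty: "delta B \<inter> L = {} \<Longrightarrow> val B L = px B"
  unfolding val_def by simp

text \<open>The last edge m of L that crosses any of the cuts works for all: each of them takes at L
  the side of \<open>tgt m\<close>. Boolean relations between finitely many sides can thus be read
  off at a single vertex, or at x.\<close>

lemma val_common:
  assumes L: "initial L" and fin: "finite \<B>" "\<And>B. B \<in> \<B> \<Longrightarrow> fincut B"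
  shows "(\<forall>B\<in>\<B>. val B L = px B) \<or> (\<exists>v. \<forall>B\<in>\<B>. val B L = side B v)"
proof -
  let ?D = "(\<Union>B\<in>\<B>. delta B) \<inter> L"
  have "finite ?D" using fin unfolding fincut_def by blast
  show ?thesis
  proof (cases "?D = {}")
    case True
    then have "\<forall>B\<in>\<B>. val B L = px B" using val_empty by blast
    then show ?thesis by blast
  next
    case False
    have "?D \<subseteq> P" using L unfolding initial_def by blast
    then obtain m where m: "m \<in> ?D" "\<forall>f\<in>?D. f = m \<or> before f m"
      using before_max[OF \<open>finite ?D\<close> _ False] by blast
    have "val B L = side B (tgt m)" if "B \<in> \<B>" for B
      by (rule val_last[OF fin(2)[OF that] L]) (use m that in auto)
    then show ?thesis by blast
  qed
qed

lemma val_compl: "fincut B \<Longrightarrow> val (- B) L = 1 - val B L"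
proof -
  assume B: "fincut B"
  have "jump (- B) e = - jump B e" for e unfolding jump_def side_def by simp
  moreover have "px (- B) = 1 - px B" unfolding px_def using pin_compl[OF xVE B] by simp
  ultimately show ?thesis unfolding val_def by (simp add: sum_negf)
qed

lemma val_P: assumes B: "fincut B" shows "val B P = (if pin B y then 0 else 1)"
proof (cases "delta B \<inter> P = {}")
  case True
  then have "pin B x \<longleftrightarrow> pin B y" using no_crossing[OF B] by blast
  then show ?thesis using val_empty[OF True] unfolding px_def by simp
next
  case False
  have fin: "finite (delta B \<inter> P)" using B unfolding fincut_def by blast
  obtain m where m: "m \<in> delta B \<inter> P" "\<forall>f\<in>delta B \<inter> P. f = m \<or> before f m"
    using before_max[OF fin _ False] by blast
  have init: "initial P" unfolding initial_def using before_P by blast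
  have "val B P = side B (tgt m)" by (rule val_last[OF B init]) (use m in auto)
  moreover have "tgt m \<in> B \<longleftrightarrow> pin B y"
  proof (rule same_side_end[OF B])
    fix f assume f: "before m f"
    then have "f \<noteq> m" "\<not> before f m" using before_irrefl before_total before_P by metis+
    then show "f \<notin> delta B" using m(2) before_P[OF f] by blast
  qed (use m in blast)
  ultimately show ?thesis unfolding side_def by simp
qed

text \<open>The position right after L may have neither a last edge before it nor a next edge after
  it. The sides B with val B L = 0 still form an ultrafilter, checked on A, B and A \<inter> B at
  the common vertex from \<open>val_common\<close>.\<close>

lemma cut_point_exists:
  assumes L: "initial L"
  shows "\<exists>p\<in>VE. \<forall>B. fincut B \<longrightarrow> val B L = (if pin B p then 0 else 1)"
proof -
  have "pin V x" using xVE by (cases rule: VE_cases) (auto simp: tail_in_def dest: ray_D)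
  then have pxe: "px {} = 1" "px V = 0" unfolding px_def using pin_empty by auto
  have dV: "delta V = {}" "delta {} = {}" unfolding cutset_def using ends_in_V by auto
  have v01: "val B L = 0 \<or> val B L = 1" if "fincut B" for B
  proof -
    have "val B L = px B \<or> (\<exists>v. val B L = side B v)" using val_common[OF L, of "{B}"] that by simp
    then show ?thesis unfolding px_def side_def by (metis (full_types))
  qed
  interpret cut_ultrafilter V E inc "\<lambda>B. fincut B \<and> val B L = 0"
  proof
    show "fincut V \<and> val V L = 0" using val_empty[of V L] dV pxe unfolding fincut_def by simp
    show "\<not> (fincut {} \<and> val {} L = 0)" using val_empty[of "{}" L] dV pxe by simp
    show "fincut (- A) \<and> val (- A) L = 0 \<longleftrightarrow> \<not> (fincut A \<and> val A L = 0)" if "fincut A" for A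
      using val_compl[OF that, of L] v01[OF that] that by auto
    fix A B assume AB: "fincut A \<and> val A L = 0" "fincut B \<and> val B L = 0"
    then have f: "fincut (A \<inter> B)" by blast
    have "val (A \<inter> B) L = 0"
      using val_common[OF L, of "{A, B, A \<inter> B}"]
    proof
      assume "\<forall>C\<in>{A, B, A \<inter> B}. val C L = px C"
      then show ?thesis using AB pin_Int[OF xVE, of A B] unfolding px_def by (auto split: if_splits)
    next
      assume "\<exists>v. \<forall>C\<in>{A, B, A \<inter> B}. val C L = side C v"
      then show ?thesis using AB unfolding side_def by (auto split: if_splits)
    qed (use AB f in auto)
    then show "fincut (A \<inter> B) \<and> val (A \<inter> B) L = 0" using f by simp
  qed simp
  obtain p where p: "p \<in> VE" "\<And>B. fincut B \<Longrightarrow> (fincut B \<and> val B L = 0) \<longleftrightarrow> pin B p"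
    using ultrafilter_realized by metis
  then have "val B L = (if pin B p then 0 else 1)" if "fincut B" for B using v01[OF that] that by auto
  then show ?thesis using p(1) by blast
qed

text \<open>The two extreme positions receive the prescribed points x and y, since a point chosen by
  its ultrafilter might only be indistinguishable from them. For P = {} the point x takes
  precedence.\<close>

definition pt :: "'e set \<Rightarrow> ('v,'e) gpoint" where
  "pt L = (if L = {} then x else if L = P then y
     else SOME p. p \<in> VE \<and> (\<forall>B. fincut B \<longrightarrow> val B L = (if pin B p then 0 else 1)))"

lemma pt:
  assumes "initial L"
  shows "pt L \<in> VE" "fincut B \<Longrightarrow> val B L = (if pin B (pt L) then 0 else 1)"
proof -
  have "pt L \<in> VE \<and> (\<forall>B. fincut B \<longrightarrow> val B L = (if pin B (pt L) then 0 else 1))"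
  proof -
    consider "L = {}" | "L \<noteq> {}" "L = P" | "L \<noteq> {}" "L \<noteq> P" by blast
    then show ?thesis
    proof cases
      case 1
      then show ?thesis using xVE val_empty[of _ L] unfolding pt_def px_def by simp
    next
      case 2
      then show ?thesis using yVE val_P unfolding pt_def by simp
    next
      case 3
      then have eq: "pt L = (SOME p. p \<in> VE \<and> (\<forall>B. fincut B \<longrightarrow> val B L = (if pin B p then 0 else 1)))"
        unfolding pt_def by simp
      show ?thesis unfolding eq by (rule someI_ex[OF cut_point_exists[OF assms, unfolded Bex_def]])
    qed
  qed
  then show "pt L \<in> VE" "fincut B \<Longrightarrow> val B L = (if pin B (pt L) then 0 else 1)" by (blast, blast)
qed

section \<open>Parametrising a link by lengths of edges\<close>

definition wt :: "'e \<Rightarrow> real" where "wt e = (1 / 2) ^ to_nat_on P e"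
definition len :: "'e set \<Rightarrow> real" where "len Q = infsum wt Q"

lemma wt_pos: "0 < wt e" unfolding wt_def by simp

text \<open>The enumeration \<open>to_nat_on P\<close> is injective on the countable set P, so the
  weights are distinct terms of a geometric series.\<close>

lemma wt_summable: assumes "Q \<subseteq> P" shows "wt summable_on Q"
proof -
  have inj: "inj_on (to_nat_on P) Q"
    using inj_on_to_nat_on[OF link_countable[OF link]] assms by (rule inj_on_subset)
  have "summable (\<lambda>n. norm ((1 / 2 :: real) ^ n))" by simp
  then have "(\<lambda>n. (1 / 2 :: real) ^ n) summable_on UNIV" by (rule norm_summable_imp_summable_on)
  then have "(\<lambda>n. (1 / 2 :: real) ^ n) summable_on (to_nat_on P ` Q)" by (rule summable_on_subset_banach) simp
  then have "((\<lambda>n. (1 / 2 :: real) ^ n) \<circ> to_nat_on P) summable_on Q" using summable_on_reindex[OF inj] by blast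
  then show ?thesis unfolding wt_def comp_def .
qed

lemma len_nonneg: "0 \<le> len Q"
  unfolding len_def using wt_pos by (intro infsum_nonneg) (simp add: less_imp_le)

lemma len_Un: "A \<subseteq> P \<Longrightarrow> B \<subseteq> P \<Longrightarrow> A \<inter> B = {} \<Longrightarrow> len (A \<union> B) = len A + len B"
  unfolding len_def by (intro infsum_Un_disjoint wt_summable)

lemma len_mono: assumes "A \<subseteq> B" "B \<subseteq> P" shows "len A \<le> len B"
proof -
  have "len B = len A + len (B - A)" using len_Un[of A "B - A"] assms by (simp add: Un_absorb1 subset_trans Diff_subset_conv le_supI2)
  then show ?thesis using len_nonneg[of "B - A"] by simp
qed

lemma len_finite: "finite F \<Longrightarrow> len F = sum wt F"
  unfolding len_def by simp

lemma len_insert: "e \<in> P \<Longrightarrow> A \<subseteq> P \<Longrightarrow> e \<notin> A \<Longrightarrow> len (insert e A) = len A + wt e"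
  using len_Un[of A "{e}"] len_finite[of "{e}"] by simp

lemma len_le: "Q \<subseteq> P \<Longrightarrow> (\<And>F. finite F \<Longrightarrow> F \<subseteq> Q \<Longrightarrow> sum wt F \<le> c) \<Longrightarrow> len Q \<le> c"
  unfolding len_def by (intro infsum_le_finite_sums wt_summable)

text \<open>Edge e occupies the open interval from \<open>pos e\<close> to \<open>fin e\<close>. The
  parameters between 0 and W in no such interval are the gaps, where vertices and ends are
  placed.\<close>

definition pos :: "'e \<Rightarrow> real" where "pos e = len {f. before f e}"
definition fin :: "'e \<Rightarrow> real" where "fin e = pos e + wt e"
definition W :: real where "W = len P"

lemma W_empty: "P = {} \<Longrightarrow> W = 0" unfolding W_def len_def by simp

lemma pos_nonneg: "0 \<le> pos e" unfolding pos_def by (rule len_nonneg)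

lemma pos_fin: "pos e < fin e" unfolding fin_def using wt_pos by simp

lemma before_sub: "{f. before f e} \<subseteq> P" using before_P by blast

lemma fin_eq: "e \<in> P \<Longrightarrow> fin e = len (insert e {f. before f e})"
  unfolding fin_def pos_def using len_insert[OF _ before_sub, of e e] before_irrefl by simp

lemma fin_le_pos: assumes "before e f" shows "fin e \<le> pos f"
proof -
  have e: "e \<in> P" using before_P[OF assms] by simp
  have "insert e {f. before f e} \<subseteq> {g. before g f}" using assms before_trans by blast
  then show ?thesis unfolding fin_eq[OF e] pos_def using len_mono before_sub by blast
qed

lemma fin_le_W: assumes "e \<in> P" shows "fin e \<le> W"
  unfolding fin_eq[OF assms] W_def by (rule len_mono) (use assms before_sub in auto)

definition on :: "'e \<Rightarrow> real \<Rightarrow> bool" where "on e t \<longleftrightarrow> e \<in> P \<and> pos e < t \<and> t < fin e"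

lemma on_unique: assumes "on e t" "on f t" shows "e = f"
proof (rule ccontr)
  assume ne: "e \<noteq> f"
  have P: "e \<in> P" "f \<in> P" using assms on_def by auto
  then consider "before e f" | "before f e" using before_total[OF P ne] by blast
  then show False
    using fin_le_pos assms unfolding on_def by cases fastforce+
qed

definition seg :: "real \<Rightarrow> 'e set" where "seg t = {e\<in>P. fin e \<le> t}"

lemma initial_seg: "initial (seg t)"
  unfolding initial_def seg_def
proof (intro conjI ballI allI impI)
  fix e f assume "e \<in> {e \<in> P. fin e \<le> t}" "before f e"
  then show "f \<in> {e \<in> P. fin e \<le> t}" using fin_le_pos[of f e] pos_fin[of e] before_P[of f e] by auto
qed auto

text \<open>The edges that end by t have total length at most t, the others at most W - t, and all
  together have length W, so both bounds are attained. The infinite sums are estimated through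
  finite sets of edges, which do have a first and a last edge.\<close>

lemma gap_length:
  assumes t: "0 \<le> t" "t \<le> W" and gap: "\<And>e. \<not> on e t"
  shows "len (seg t) = t"
proof -
  have sP: "seg t \<subseteq> P" unfolding seg_def by blast
  have 1: "len (seg t) \<le> t"
  proof (rule len_le[OF sP])
    fix F assume F: "finite F" "F \<subseteq> seg t"
    show "sum wt F \<le> t"
    proof (cases "F = {}")
      case False
      have FP: "F \<subseteq> P" using F(2) sP by blast
      obtain m where m: "m \<in> F" "\<forall>f\<in>F. f = m \<or> before f m" using before_max[OF F(1) FP False] by blast
      have mP: "m \<in> P" "fin m \<le> t" using m F unfolding seg_def by auto
      have "sum wt F \<le> fin m" unfolding fin_eq[OF mP(1)] len_finite[OF F(1), symmetric]
        by (rule len_mono) (use m mP before_sub in auto)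
      then show ?thesis using mP by simp
    qed (use t in simp)
  qed
  have 2: "len (P - seg t) \<le> W - t"
  proof (rule len_le)
    fix F assume F: "finite F" "F \<subseteq> P - seg t"
    show "sum wt F \<le> W - t"
    proof (cases "F = {}")
      case False
      have FP: "F \<subseteq> P" using F by blast
      obtain m where m: "m \<in> F" "\<forall>f\<in>F. f = m \<or> before m f" using before_min[OF F(1) FP False] by blast
      have mP: "m \<in> P" "t < fin m" using m F unfolding seg_def by auto
      have tm: "t \<le> pos m" using gap[of m] mP unfolding on_def by auto
      have "\<not> before f m" if f: "f \<in> F" for f
      proof (cases "f = m")
        case False
        then have "before m f" using m(2) f by auto
        then show ?thesis using before_total[OF mP(1) subsetD[OF FP f]] False by auto
      qed (simp add: before_irrefl)
      then have "F \<inter> {f. before f m} = {}" by blast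
      then have "len (F \<union> {f. before f m}) = sum wt F + pos m"
        unfolding pos_def len_finite[OF F(1), symmetric] using len_Un FP before_sub by blast
      moreover have "len (F \<union> {f. before f m}) \<le> W" unfolding W_def by (rule len_mono) (use FP before_sub in auto)
      ultimately show ?thesis using tm by simp
    qed (use t in simp)
  qed auto
  have "W = len (seg t) + len (P - seg t)"
    unfolding W_def using len_Un[of "seg t" "P - seg t"] sP by (simp add: Un_absorb1)
  then show ?thesis using 1 2 by simp
qed

definition inn :: "'e \<Rightarrow> real \<Rightarrow> ('v,'e) gpoint" where
  "inn e u = Inner e (if fst (inc e) \<in> K e then u else 1 - u)"

definition pth :: "real \<Rightarrow> ('v,'e) gpoint" where
  "pth t = (if \<exists>e. on e t then (let e = (SOME e. on e t) in inn e ((t - pos e) / wt e)) else pt (seg t))"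

lemma pth_on: assumes "on e t" shows "pth t = inn e ((t - pos e) / wt e)"
proof -
  have "(SOME e. on e t) = e" using assms on_unique by (metis someI)
  then show ?thesis unfolding pth_def Let_def using assms by auto
qed

lemma pth_gap: "(\<And>e. \<not> on e t) \<Longrightarrow> pth t = pt (seg t)"
  unfolding pth_def by simp

lemma on_range: assumes "on e t" shows "0 < (t - pos e) / wt e" "(t - pos e) / wt e < 1"
  using assms wt_pos[of e] unfolding on_def fin_def by (auto simp: field_simps)

lemma pth_gap_VE: "(\<And>e. \<not> on e t) \<Longrightarrow> pth t \<in> VE"
  using pth_gap pt(1)[OF initial_seg] by simp

lemma inn_inner_of: "0 < u \<Longrightarrow> u < 1 \<Longrightarrow> inn e u \<in> inner_of e"
  unfolding inn_def inner_of_def by auto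

lemma pth_in: "pth t \<in> VE \<union> (\<Union>e\<in>P. inner_of e)"
proof (cases "\<exists>e. on e t")
  case True
  then obtain e where e: "on e t" by blast
  then have "pth t \<in> inner_of e" using pth_on[OF e] inn_inner_of on_range[OF e] by simp
  then show ?thesis using e unfolding on_def by blast
qed (use pth_gap_VE in blast)

lemma inner_of_XX: "e \<in> E \<Longrightarrow> inner_of e \<subseteq> XX"
  unfolding inner_of_def XG_def inner_points_def by auto

lemma pth_GT: "pth t \<in> XX \<union> Ends"
  using pth_in[of t] inner_of_XX PE VE_sub by blast

lemma pth_0: "pth 0 = x"
proof -
  have "\<not> on e 0" for e using pos_nonneg[of e] unfolding on_def by auto
  moreover have "\<not> fin e \<le> 0" for e using pos_nonneg[of e] pos_fin[of e] by linarith
  then have "seg 0 = {}" unfolding seg_def by simp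
  ultimately show ?thesis using pth_gap[of 0] unfolding pt_def by simp
qed

lemma pth_W: "P \<noteq> {} \<Longrightarrow> pth W = y"
proof -
  assume "P \<noteq> {}"
  have "\<not> on e W" for e using fin_le_W[of e] unfolding on_def by auto
  moreover have "seg W = P" unfolding seg_def using fin_le_W by auto
  ultimately show ?thesis using pth_gap[of W] \<open>P \<noteq> {}\<close> unfolding pt_def by simp
qed

definition clamp01 :: "real \<Rightarrow> real" where "clamp01 u = max 0 (min 1 u)"

text \<open>Along the path the function of a finite cut becomes a finite sum of clamped linear
  ramps, one for each crossing edge. Its continuity is then immediate, however P is ordered.\<close>

lemma gval_pth:
  assumes B: "fincut B"
  shows "gval B (pth t) = px B + (\<Sum>e\<in>delta B \<inter> P. jump B e * clamp01 ((t - pos e) / wt e))"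
proof -
  let ?c = "\<lambda>e. clamp01 ((t - pos e) / wt e)"
  have c1: "?c e = 1" if "fin e \<le> t" for e
    using that wt_pos[of e] unfolding clamp01_def fin_def by (simp add: field_simps)
  have c0: "?c e = 0" if "t \<le> pos e" for e
    using that wt_pos[of e] unfolding clamp01_def by (simp add: divide_nonpos_pos)
  have finB: "finite (delta B \<inter> P)" using B unfolding fincut_def by blast
  show ?thesis
  proof (cases "\<exists>e. on e t")
    case False
    then have gap: "\<And>e. \<not> on e t" by blast
    have c0': "?c e = 0" if "e \<in> P" "e \<notin> seg t" for e
      using that gap[of e] c0[of e] unfolding seg_def on_def by auto
    have "(\<Sum>e\<in>delta B \<inter> P. jump B e * ?c e) = (\<Sum>e\<in>delta B \<inter> seg t. jump B e)"
    proof (rule sum.mono_neutral_cong_right[OF finB])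
      show "delta B \<inter> seg t \<subseteq> delta B \<inter> P" unfolding seg_def by blast
      show "\<forall>i\<in>delta B \<inter> P - delta B \<inter> seg t. jump B i * ?c i = 0" using c0' by auto
      show "\<And>e. e \<in> delta B \<inter> seg t \<Longrightarrow> jump B e * ?c e = jump B e" using c1 unfolding seg_def by auto
    qed
    then have "px B + (\<Sum>e\<in>delta B \<inter> P. jump B e * ?c e) = val B (seg t)" unfolding val_def by simp
    then show ?thesis using pth_gap[OF gap] pt[OF initial_seg] gval_VE B by simp
  next
    case True
    then obtain e where e: "on e t" by blast
    then have eP: "e \<in> P" and te: "pos e < t" "t < fin e" unfolding on_def by auto
    let ?u = "(t - pos e) / wt e"
    have ce: "?c e = ?u" using on_range[OF e] unfolding clamp01_def by simp
    have lt: "?c f = 1" if "before f e" for f using c1[of f] fin_le_pos[OF that] te by simp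
    have gt: "?c f = 0" if "before e f" for f using c0[of f] fin_le_pos[OF that] te by simp
    have fin2: "finite (delta B \<inter> {f. before f e})" using finB before_sub[of e] finite_subset
      by (metis Int_mono order_refl)
    have ne: "e \<notin> delta B \<inter> {f. before f e}" using before_irrefl by blast
    have "(\<Sum>f\<in>delta B \<inter> P. jump B f * ?c f) = (\<Sum>f\<in>insert e (delta B \<inter> {f. before f e}). jump B f * ?c f)"
    proof (rule sum.mono_neutral_cong)
      show "finite (insert e (delta B \<inter> {f. before f e}))" using fin2 by simp
      show "jump B i * ?c i = 0" if "i \<in> delta B \<inter> P - insert e (delta B \<inter> {f. before f e})" for i
        using that before_total[OF eP, of i] gt[of i] by auto
      show "jump B i * ?c i = 0" if "i \<in> insert e (delta B \<inter> {f. before f e}) - delta B \<inter> P" for i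
        using that jump_zero[OF eP, of B] before_sub eP by auto
    qed (use finB in auto)
    also have "\<dots> = jump B e * ?u + (\<Sum>f\<in>delta B \<inter> {f. before f e}. jump B f)"
      using sum.insert[OF fin2 ne, of "\<lambda>f. jump B f * ?c f"] ce lt by simp
    finally have "px B + (\<Sum>f\<in>delta B \<inter> P. jump B f * ?c f) = side B (src e) + jump B e * ?u"
      using val_before[OF B eP] unfolding val_def by simp
    then show ?thesis unfolding pth_on[OF e] inn_def jump_def src_def tgt_def by (auto simp: algebra_simps)
  qed
qed

lemma continuous_clamp01: "continuous_on S (\<lambda>t. clamp01 ((t - a) / b))" if "b > 0" for a b :: real
  unfolding clamp01_def using that by (intro continuous_intros) auto

lemma continuous_gval_pth:
  assumes "fincut B" shows "continuous_on S (\<lambda>t. gval B (pth t))"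
  unfolding gval_pth[OF assms] using wt_pos by (intro continuous_intros continuous_clamp01) auto

text \<open>The parameter on e continued linearly to all real t. Off the interval of e its values
  leave the open unit interval, so lying on a segment of e becomes a condition on a continuous
  function.\<close>

definition coord :: "'e \<Rightarrow> real \<Rightarrow> real" where
  "coord e t = (if fst (inc e) \<in> K e then (t - pos e) / wt e else 1 - (t - pos e) / wt e)"

lemma continuous_coord: "continuous_on S (coord e)"
proof -
  have "wt e \<noteq> 0" using wt_pos[of e] by simp
  then have "continuous_on S (\<lambda>t. (t - pos e) / wt e)" "continuous_on S (\<lambda>t. 1 - (t - pos e) / wt e)"
    by (intro continuous_intros; simp)+
  then show ?thesis unfolding coord_def by (cases "fst (inc e) \<in> K e") auto
qed

lemma pth_Inner_iff:
  assumes "I \<subseteq> {0<..<1}"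
  shows "pth t \<in> Inner e ` I \<longleftrightarrow> e \<in> P \<and> coord e t \<in> I"
proof
  assume a: "pth t \<in> Inner e ` I"
  have "\<exists>f. on f t"
  proof (rule ccontr)
    assume "\<nexists>f. on f t"
    then have "pth t \<in> VE" using pth_gap_VE by blast
    then show False using a unfolding VE_def Ends_def by auto
  qed
  then obtain f where f: "on f t" by blast
  then have "f = e" "coord e t \<in> I" using a unfolding pth_on[OF f] inn_def coord_def by auto
  then show "e \<in> P \<and> coord e t \<in> I" using f unfolding on_def by simp
next
  assume a: "e \<in> P \<and> coord e t \<in> I"
  then have "0 < coord e t" "coord e t < 1" using assms by auto
  then have "on e t" using a wt_pos[of e] unfolding coord_def on_def fin_def
    by (auto simp: field_simps split: if_splits)
  then show "pth t \<in> Inner e ` I" using a unfolding pth_on[OF \<open>on e t\<close>] inn_def coord_def by auto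
qed

lemma continuous_pth: "continuous_map (top_of_set {0..W}) GT pth"
proof (rule continuous_map_into_GT)
  show "pth \<in> topspace (top_of_set {0..W}) \<rightarrow> XX \<union> Ends" using pth_GT by blast
  show "continuous_map (top_of_set {0..W}) euclideanreal (\<lambda>t. gval A (pth t))" if "fincut A" for A
    using continuous_gval_pth[OF that] by simp
next
  fix e a b assume "e \<in> E" and ab: "(0::real) < a" "a < b" "b < 1"
  have "{a<..<b} \<subseteq> {0<..<1}" "{a..b} \<subseteq> {0<..<1}" using ab by auto
  then have iff: "pth t \<in> Inner e ` {a<..<b} \<longleftrightarrow> e \<in> P \<and> coord e t \<in> {a<..<b}"
    "pth t \<in> Inner e ` {a..b} \<longleftrightarrow> e \<in> P \<and> coord e t \<in> {a..b}" for t using pth_Inner_iff by blast+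
  have pre: "openin (top_of_set {0..W}) {t \<in> {0..W}. coord e t \<in> T}" if "open T" for T
  proof -
    have "{t \<in> {0..W}. coord e t \<in> T} = {0..W} \<inter> coord e -` T" by auto
    then show ?thesis using continuous_openin_preimage_gen[OF continuous_coord that, of "{0..W}" e] by simp
  qed
  show "openin (top_of_set {0..W}) {t \<in> topspace (top_of_set {0..W}). pth t \<in> Inner e ` {a<..<b}}"
    unfolding iff using pre[of "{a<..<b}"] by (cases "e \<in> P") auto
  show "openin (top_of_set {0..W}) {t \<in> topspace (top_of_set {0..W}). pth t \<notin> Inner e ` {a..b}}"
  proof (cases "e \<in> P")
    case True
    then show ?thesis unfolding iff using pre[of "- {a..b}"] by auto
  next
    case False
    then have "{t \<in> topspace (top_of_set {0..W}). pth t \<notin> Inner e ` {a..b}} = topspace (top_of_set {0..W})"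
      unfolding iff by auto
    then show ?thesis using openin_topspace by metis
  qed
qed

lemma pth_covers:
  assumes "e \<in> P" "0 < s" "s < 1" shows "\<exists>t\<in>{0..W}. on e t \<and> pth t = Inner e s"
proof -
  define u where "u = (if fst (inc e) \<in> K e then s else 1 - s)"
  define t where "t = pos e + u * wt e"
  have u: "0 < u" "u < 1" using assms unfolding u_def by auto
  have on: "on e t" unfolding on_def t_def fin_def using assms(1) u wt_pos[of e] by simp
  have "(t - pos e) / wt e = u" unfolding t_def using wt_pos[of e] by simp
  then have "pth t = Inner e s" unfolding pth_on[OF on] inn_def u_def by auto
  moreover have "t \<in> {0..W}" using on pos_nonneg[of e] fin_le_W[OF assms(1)] unfolding on_def by auto
  ultimately show ?thesis using on by blast
qed

text \<open>By \<open>gap_length\<close> the initial segments of two gaps differ in length, so some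
  edge e lies between them, and \<open>K e\<close> separates the points. Separation by a cut is more
  than being distinct; it is what makes the image Hausdorff.\<close>

lemma pth_distinct:
  assumes st: "s \<in> {0..W}" "t \<in> {0..W}" "s < t" and VE: "pth s \<in> VE" "pth t \<in> VE"
  shows "\<exists>B. fincut B \<and> pin B (pth s) \<noteq> pin B (pth t)"
proof -
  have "\<not> on e r" if "pth r \<in> VE" for e r
    using that unfolding VE_def Ends_def by (auto simp: pth_on inn_def)
  then have gap: "\<And>e. \<not> on e s" "\<And>e. \<not> on e t" using VE by auto
  have "len (seg s) < len (seg t)" using gap_length[of s] gap_length[of t] gap st by auto
  then have "\<not> seg t \<subseteq> seg s" using len_mono[of "seg t" "seg s"] unfolding seg_def by force
  then obtain e where e: "e \<in> seg t" "e \<notin> seg s" by blast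
  have eP: "e \<in> P" using e unfolding seg_def by simp
  have B: "fincut (K e)" by (rule K[OF eP])
  have only: "delta (K e) \<inter> seg s = {}" "delta (K e) \<inter> seg t = {e}"
    using K(4)[OF eP] e unfolding seg_def by auto
  have "val (K e) (seg s) = 0" unfolding val_def only px_def using K(2)[OF eP] by simp
  moreover have "val (K e) (seg t) = 1" unfolding val_def only px_def jump_def side_def using K(2)[OF eP] src_tgt[OF eP] by simp
  ultimately have "pin (K e) (pth s)" "\<not> pin (K e) (pth t)"
    using pt(2)[OF initial_seg B] gap pth_gap by (auto split: if_splits)
  then show ?thesis using B by blast
qed

lemma pth_inj_inner:
  assumes "pth s = pth t" "pth s \<notin> VE" shows "s = t"
proof -
  obtain e f where e: "on e s" and f: "on f t" using assms pth_gap_VE[of s] pth_gap_VE[of t] by metis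
  have "e = f" "(s - pos e) / wt e = (t - pos e) / wt e"
    using assms(1) unfolding pth_on[OF e] pth_on[OF f] inn_def by (auto split: if_splits)
  then show ?thesis using wt_pos[of e] by simp
qed

end

context conn_graph
begin

text \<open>For P = {} only the start x is prescribed, because x and y can be different points with
  no finite cut between them. Injectivity at vertices and ends takes the stronger form of separation
  by a finite cut.\<close>

definition arc_map :: "'e set \<Rightarrow> ('v,'e) gpoint \<Rightarrow> ('v,'e) gpoint \<Rightarrow> real \<Rightarrow> (real \<Rightarrow> ('v,'e) gpoint) \<Rightarrow> bool" where
  "arc_map P x y w g \<longleftrightarrow> 0 \<le> w \<and> (P = {} \<longrightarrow> w = 0) \<and> continuous_map (top_of_set {0..w}) GT g \<and>
     g 0 = x \<and> (P \<noteq> {} \<longrightarrow> g w = y) \<and> (\<forall>t. g t \<in> VE \<union> (\<Union>e\<in>P. inner_of e)) \<and>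
     (\<forall>e\<in>P. inner_of e \<subseteq> g ` {0..w}) \<and>
     (\<forall>s\<in>{0..w}. \<forall>t\<in>{0..w}. s < t \<longrightarrow> g s \<in> VE \<longrightarrow> g t \<in> VE \<longrightarrow> (\<exists>B. fincut B \<and> pin B (g s) \<noteq> pin B (g t))) \<and>
     (\<forall>s t. g s = g t \<longrightarrow> g s \<notin> VE \<longrightarrow> s = t)"

theorem link_arc_map:
  assumes "link P x y" shows "\<exists>w g. arc_map P x y w g"
proof -
  interpret link_path V E inc P x y by unfold_locales (rule assms)
  have "0 \<le> W" unfolding W_def by (rule len_nonneg)
  moreover have "inner_of e \<subseteq> pth ` {0..W}" if "e \<in> P" for e
    using pth_covers[OF that] unfolding inner_of_def by force
  ultimately have "arc_map P x y W pth"
    unfolding arc_map_def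
    by (intro conjI ballI allI impI continuous_pth pth_0 pth_W W_empty pth_in pth_distinct pth_inj_inner)
  then show ?thesis by blast
qed

end

section \<open>Circuits are circles\<close>

definition circ :: "real \<Rightarrow> complex" where "circ t = cis (2 * pi * t)"

lemma circ_sphere: "circ t \<in> sphere 0 1" unfolding circ_def by simp

lemma continuous_circ: "continuous_on S circ"
  unfolding circ_def by (intro continuous_intros)

lemma Arg2pi_circ: "0 \<le> t \<Longrightarrow> t < 1 \<Longrightarrow> Arg2pi (circ t) = 2 * pi * t"
proof -
  assume t: "0 \<le> t" "t < 1"
  have "of_real 1 * exp (\<i> * of_real (2 * pi * t)) = circ t"
    unfolding circ_def cis_conv_exp by simp
  then show ?thesis
    by (rule Arg2pi_unique) (use t in auto)
qed

lemma circ_Arg2pi: assumes "z \<in> sphere 0 1" shows "circ (Arg2pi z / (2 * pi)) = z"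
proof -
  have "z = of_real (norm z) * exp (\<i> * of_real (Arg2pi z))" by (rule Arg2pi_eq)
  moreover have "norm z = 1" using assms by simp
  ultimately have "z = cis (Arg2pi z)" unfolding cis_conv_exp by simp
  then show ?thesis unfolding circ_def by simp
qed

lemma circ_inj:
  assumes "0 \<le> s" "s < 1" "0 \<le> t" "t < 1" "circ s = circ t" shows "s = t"
proof -
  have "2 * pi * s = 2 * pi * t"
    using Arg2pi_circ[OF assms(1,2)] Arg2pi_circ[OF assms(3,4)] assms(5) by metis
  then show ?thesis by simp
qed

lemma circ_0_1: "circ 0 = circ 1"
  unfolding circ_def by simp

lemma circ_surj: assumes "z \<in> sphere 0 1" obtains t where "0 \<le> t" "t < 1" "circ t = z"
proof (rule that)
  show "0 \<le> Arg2pi z / (2 * pi)" using Arg2pi_ge_0[of z] by simp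
  show "Arg2pi z / (2 * pi) < 1" using Arg2pi_lt_2pi[of z] by (simp add: field_simps)
qed (rule circ_Arg2pi[OF assms])

lemma quotient_circ: "quotient_map (top_of_set {0..1}) (top_of_set (sphere 0 1)) circ"
proof (rule continuous_closed_imp_quotient_map)
  show c: "continuous_map (top_of_set {0..1}) (top_of_set (sphere 0 1)) circ"
    using continuous_circ circ_sphere by (simp add: continuous_map_in_subtopology image_subset_iff)
  show "closed_map (top_of_set {0..1}) (top_of_set (sphere 0 1)) circ"
  proof (rule continuous_imp_closed_map_gen[OF _ _ c])
    show "compact_space (top_of_set {0..1::real})" by (simp add: compact_space_subtopology)
    show "kc_space (top_of_set (sphere (0::complex) 1))"
      by (intro Hausdorff_imp_kc_space Hausdorff_space_subtopology) simp
  qed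
  show "circ ` topspace (top_of_set {0..1}) = topspace (top_of_set (sphere 0 1))"
  proof
    show "topspace (top_of_set (sphere 0 1)) \<subseteq> circ ` topspace (top_of_set {0..1})"
    proof
      fix z assume "z \<in> topspace (top_of_set (sphere (0::complex) 1))"
      then obtain t where "0 \<le> t" "t < 1" "circ t = z" using circ_surj[of z] by auto
      then show "z \<in> circ ` topspace (top_of_set {0..1})" by auto
    qed
    show "circ ` topspace (top_of_set {0..1}) \<subseteq> topspace (top_of_set (sphere 0 1))"
      using circ_sphere by (simp add: image_subset_iff)
  qed
qed

text \<open>The loop factors through the quotient map from the interval to the circle, giving a
  continuous bijection from a compact space onto a Hausdorff one. The Hausdorff property is asked of
  the image alone, as |G| may lack it.\<close>

lemma loop_homeomorphic_circle:
  fixes h :: "real \<Rightarrow> 'a"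
  assumes h: "continuous_map (top_of_set {0..1}) X h" and loop: "h 0 = h 1" and inj: "inj_on h {0..<1}"
    and haus: "Hausdorff_space (subtopology X (h ` {0..1}))"
  shows "subtopology X (h ` {0..1}) homeomorphic_space top_of_set (sphere (0::complex) 1)"
proof -
  let ?Y = "subtopology X (h ` {0..1})" and ?S = "top_of_set (sphere (0::complex) 1)"
  have norm: "\<exists>t'. 0 \<le> t' \<and> t' < 1 \<and> h t' = h t \<and> circ t' = circ t" if "t \<in> {0..1}" for t
  proof (cases "t = 1")
    case True
    then show ?thesis using loop circ_0_1 by (intro exI[of _ 0]) auto
  qed (use that in \<open>auto intro!: exI[of _ t]\<close>)
  have h': "continuous_map (top_of_set {0..1}) ?Y h"
    using h by (simp add: continuous_map_in_subtopology)
  have kernel: "h s = h t" if "s \<in> topspace (top_of_set {0..1})" "t \<in> topspace (top_of_set {0..1})" "circ s = circ t" for s t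
  proof -
    have st: "s \<in> {0..1}" "t \<in> {0..1}" using that by auto
    obtain s' where "0 \<le> s'" "s' < 1" "h s' = h s" "circ s' = circ s" using norm[OF st(1)] by auto
    moreover obtain t' where "0 \<le> t'" "t' < 1" "h t' = h t" "circ t' = circ t" using norm[OF st(2)] by auto
    ultimately show ?thesis using circ_inj[of s' t'] that(3) by simp
  qed
  obtain g where g: "continuous_map ?S ?Y g" "g ` topspace ?S = h ` topspace (top_of_set {0..1})"
    "\<And>t. t \<in> topspace (top_of_set {0..1}) \<Longrightarrow> g (circ t) = h t"
    using quotient_map_lift_exists[OF quotient_circ h'] kernel by blast
  have "inj_on g (topspace ?S)"
  proof (rule inj_onI)
    fix z z' assume z: "z \<in> topspace ?S" "z' \<in> topspace ?S" "g z = g z'"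
    obtain s where s: "0 \<le> s" "s < 1" "circ s = z" using circ_surj[of z] z by auto
    obtain t where t: "0 \<le> t" "t < 1" "circ t = z'" using circ_surj[of z'] z by auto
    have "h s = h t" using g(3)[of s] g(3)[of t] s t z(3) by simp
    then show "z = z'" using inj_onD[OF inj, of s t] s t by auto
  qed
  moreover have "g ` topspace ?S = topspace ?Y"
    using g(2) continuous_map_image_subset_topspace[OF h] by auto
  moreover have "closed_map ?S ?Y g"
    by (rule continuous_imp_closed_map_gen[OF _ Hausdorff_imp_kc_space[OF haus] g(1)]) (simp add: compact_space_subtopology)
  ultimately have "homeomorphic_map ?S ?Y g"
    using bijective_closed_imp_homeomorphic_map[OF g(1)] by blast
  then have "?S homeomorphic_space ?Y" by (rule homeomorphic_map_imp_homeomorphic_space)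
  then show ?thesis by (rule homeomorphic_space_sym[THEN iffD1])
qed

context conn_graph
begin

lemma VE_not_Inner: "p \<in> VE \<Longrightarrow> p \<notin> Inner e ` I"
  unfolding VE_def Ends_def by auto

text \<open>An inner point is separated from any other point by an open segment and the complement
  of a closed one. Two points of \<open>VE\<close> on different sides of a finite cut are separated
  by the level 1/2 of its function.\<close>

lemma Hausdorff_subspace:
  assumes X: "X \<subseteq> XX \<union> Ends"
    and sep: "\<And>p q. p \<in> X \<Longrightarrow> q \<in> X \<Longrightarrow> p \<in> VE \<Longrightarrow> q \<in> VE \<Longrightarrow> p \<noteq> q \<Longrightarrow> \<exists>B. fincut B \<and> pin B p \<noteq> pin B q"
  shows "Hausdorff_space (subtopology GT X)"
proof -
  have inner: "\<exists>U V. openin GT U \<and> openin GT V \<and> p \<in> U \<and> q \<in> V \<and> U \<inter> V = {}"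
    if p: "p = Inner e t" "e \<in> E" "0 < t" "t < 1" and q: "q \<in> XX \<union> Ends" "q \<noteq> p" for p q e t
  proof -
    have "\<exists>a b. 0 < a \<and> a < t \<and> t < b \<and> b < 1 \<and> q \<notin> Inner e ` {a..b}"
    proof (cases "\<exists>s. q = Inner e s")
      case False
      then show ?thesis using p(3,4) by (intro exI[of _ "t / 2"] exI[of _ "(t + 1) / 2"]) auto
    next
      case True
      then obtain s where s: "q = Inner e s" "s \<noteq> t" using q(2) p(1) by blast
      define r where "r = \<bar>s - t\<bar>"
      define u where "u = 1 - t"
      define d where "d = min (r / 2) (min (t / 2) (u / 2))"
      have r: "0 < r" using s(2) unfolding r_def by simp
      have u: "0 < u" using p(4) unfolding u_def by simp
      have "0 < d" using r u p(3) unfolding d_def by simp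
      moreover have "d \<le> r / 2" "d \<le> t / 2" "d \<le> u / 2" unfolding d_def by linarith+
      ultimately have "0 < d" "d < r" "d < t" "d < u" using r u p(3) by linarith+
      then have d: "0 < d" "d < r" "d < t" "d < 1 - t" unfolding u_def by auto
      have "s \<notin> {t - d..t + d}" using d(2) unfolding r_def by auto
      then show ?thesis using d s by (intro exI[of _ "t - d"] exI[of _ "t + d"]) auto
    qed
    then obtain a b where ab: "0 < a" "a < t" "t < b" "b < 1" "q \<notin> Inner e ` {a..b}" by blast
    have "openin GT (Inner e ` {a<..<b})" using GT_open_segment[OF p(2), of a b] ab by simp
    moreover have "openin GT (XX \<union> Ends - Inner e ` {a..b})" using GT_open_cosegment[OF p(2), of a b] ab by simp
    moreover have "Inner e ` {a<..<b} \<inter> (XX \<union> Ends - Inner e ` {a..b}) = {}" by auto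
    moreover have "p \<in> Inner e ` {a<..<b}" "q \<in> XX \<union> Ends - Inner e ` {a..b}" using p(1) ab q(1) by auto
    ultimately show ?thesis by blast
  qed
  have main: "\<exists>U V. openin GT U \<and> openin GT V \<and> p \<in> U \<and> q \<in> V \<and> U \<inter> V = {}" if pq: "p \<in> X" "q \<in> X" "p \<noteq> q" for p q
  proof -
    have p: "p \<in> XX \<union> Ends" and q: "q \<in> XX \<union> Ends" using pq X by auto
    show ?thesis
      using p
    proof (cases rule: GT_cases)
      case (2 e t)
      then show ?thesis using inner[OF 2 q] pq(3) by simp
    next
      case p: 1
      show ?thesis
        using q
      proof (cases rule: GT_cases)
        case (2 e t)
        then obtain U V where "openin GT U" "openin GT V" "q \<in> U" "p \<in> V" "U \<inter> V = {}"
          using inner[OF 2 \<open>p \<in> XX \<union> Ends\<close> pq(3)] by blast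
        then show ?thesis by (metis Int_commute)
      next
        case q: 1
        obtain B0 where B0: "fincut B0" "pin B0 p \<noteq> pin B0 q" using sep[OF pq(1,2) p q pq(3)] by blast
        define B where "B = (if pin B0 p then B0 else - B0)"
        have B: "fincut B" "pin B p" "\<not> pin B q"
          using B0 pin_compl[OF p B0(1)] pin_compl[OF q B0(1)] unfolding B_def by auto
        let ?U = "{p \<in> XX \<union> Ends. gval B p < 1/2}" and ?V = "{p \<in> XX \<union> Ends. gval B p > 1/2}"
        have "openin GT ?U" "openin GT ?V"
          using openin_gval_less[OF B(1), of "1/2"] openin_gval_greater[OF B(1), of "1/2"] by auto
        moreover have "p \<in> ?U" "q \<in> ?V" using gval_VE[OF p, of B] gval_VE[OF q, of B] B VE_sub p q by auto
        moreover have "?U \<inter> ?V = {}" by auto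
        ultimately show ?thesis by blast
      qed
    qed
  qed
  show ?thesis unfolding Hausdorff_space_def
  proof (intro allI impI)
    fix p q assume pq: "p \<in> topspace (subtopology GT X) \<and> q \<in> topspace (subtopology GT X) \<and> p \<noteq> q"
    then obtain U V where "openin GT U" "openin GT V" "p \<in> U" "q \<in> V" "U \<inter> V = {}" using main[of p q] by auto
    then show "\<exists>U V. openin (subtopology GT X) U \<and> openin (subtopology GT X) V \<and> p \<in> U \<and> q \<in> V \<and> disjnt U V"
      using pq by (intro exI[of _ "U \<inter> X"] exI[of _ "V \<inter> X"]) (auto simp: openin_subtopology_Int disjnt_def)
  qed
qed

text \<open>The edge e with its ends replaced by points that are topologically indistinguishable from them.\<close>

definition edge_arc :: "('v,'e) gpoint \<Rightarrow> ('v,'e) gpoint \<Rightarrow> 'e \<Rightarrow> real \<Rightarrow> ('v,'e) gpoint" where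
  "edge_arc p q e t = (if t \<le> 0 then p else if 1 \<le> t then q else Inner e t)"

lemma edge_arc_Inner_iff:
  assumes "p \<in> VE" "q \<in> VE" "I \<subseteq> {0<..<1}"
  shows "edge_arc p q e t \<in> Inner e' ` I \<longleftrightarrow> e' = e \<and> t \<in> I"
proof -
  consider "t \<le> 0" | "1 \<le> t" "\<not> t \<le> 0" | "\<not> t \<le> 0" "\<not> 1 \<le> t" by linarith
  then show ?thesis
  proof cases
    case 1
    then have "t \<notin> I" using assms(3) by auto
    then show ?thesis using 1 VE_not_Inner[OF assms(1)] unfolding edge_arc_def by simp
  next
    case 2
    then have "t \<notin> I" using assms(3) by auto
    then show ?thesis using 2 VE_not_Inner[OF assms(2)] unfolding edge_arc_def by simp
  next
    case 3
    then show ?thesis unfolding edge_arc_def by auto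
  qed
qed

lemma continuous_edge_arc:
  assumes e: "e \<in> E" and pq: "p \<in> VE" "q \<in> VE"
    and p: "\<And>A. fincut A \<Longrightarrow> pin A p \<longleftrightarrow> fst (inc e) \<in> A"
    and q: "\<And>A. fincut A \<Longrightarrow> pin A q \<longleftrightarrow> snd (inc e) \<in> A"
  shows "continuous_map (top_of_set {0..1}) GT (edge_arc p q e)"
proof (rule continuous_map_into_GT)
  show "edge_arc p q e \<in> topspace (top_of_set {0..1}) \<rightarrow> XX \<union> Ends"
  proof
    fix t :: real
    have "Inner e t \<in> XX" if "0 < t" "t < 1" using that e unfolding XG_def inner_points_def by auto
    moreover have "p \<in> XX \<union> Ends" "q \<in> XX \<union> Ends" using pq VE_sub by blast+
    ultimately show "edge_arc p q e t \<in> XX \<union> Ends" unfolding edge_arc_def by auto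
  qed
  fix A assume A: "fincut A"
  have "gval A (edge_arc p q e t) = (1 - t) * side A (fst (inc e)) + t * side A (snd (inc e))" if "t \<in> {0..1}" for t
    using that gval_VE[OF pq(1), of A] gval_VE[OF pq(2), of A] p[OF A] q[OF A]
    unfolding edge_arc_def by (auto simp: side_def)
  moreover have "continuous_on {0..1} (\<lambda>t. (1 - t) * side A (fst (inc e)) + t * side A (snd (inc e)))"
    by (intro continuous_intros)
  ultimately have "continuous_on {0..1} (\<lambda>t. gval A (edge_arc p q e t))"
    by (subst continuous_on_cong[OF refl]) auto
  then show "continuous_map (top_of_set {0..1}) euclideanreal (\<lambda>t. gval A (edge_arc p q e t))" by simp
next
  fix e' :: 'e and a b :: real assume "0 < a" "a < b" "b < 1"
  then have ab: "{a<..<b} \<subseteq> {0<..<1}" "{a..b} \<subseteq> {0<..<1}" by auto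
  note iff = edge_arc_Inner_iff[OF pq ab(1)] edge_arc_Inner_iff[OF pq ab(2)]
  have "openin (top_of_set {0..1}) ({0..1} \<inter> T)" if "open T" for T :: "real set"
    using that by (rule openin_open_Int)
  note this[of "if e' = e then {a<..<b} else {}"] this[of "if e' = e then - {a..b} else UNIV"]
  moreover have "{t \<in> topspace (top_of_set {0..1}). edge_arc p q e t \<in> Inner e' ` {a<..<b}} = {0..1} \<inter> (if e' = e then {a<..<b} else {})"
    "{t \<in> topspace (top_of_set {0..1}). edge_arc p q e t \<notin> Inner e' ` {a..b}} = {0..1} \<inter> (if e' = e then - {a..b} else UNIV)"
    unfolding iff by auto
  ultimately show "openin (top_of_set {0..1}) {t \<in> topspace (top_of_set {0..1}). edge_arc p q e t \<in> Inner e' ` {a<..<b}}"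
    "openin (top_of_set {0..1}) {t \<in> topspace (top_of_set {0..1}). edge_arc p q e t \<notin> Inner e' ` {a..b}}"
    by (auto split: if_splits)
qed

text \<open>A cut separating the ends of e0 contains e0 and therefore another edge of C; the cuts
  with trace {e0, e} on C show minimality. The direction from second to first end lets e0 itself
  lead back from the end of the link to its start.\<close>

lemma link_of_circuit:
  assumes C: "C \<in> circuits E fbs.coindep" and e0: "e0 \<in> C"
  shows "link (C - {e0}) (Vx (snd (inc e0))) (Vx (fst (inc e0)))"
proof -
  let ?x = "Vx (snd (inc e0))" and ?y = "Vx (fst (inc e0))"
  have C1: "C \<subseteq> E" and no1: "\<And>A e. fincut A \<Longrightarrow> delta A \<inter> C \<noteq> {e}"
    and two: "\<And>e f. e \<in> C \<Longrightarrow> f \<in> C \<Longrightarrow> e \<noteq> f \<Longrightarrow> \<exists>A. fincut A \<and> delta A \<inter> C = {e, f}"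
    using C unfolding cocircuit_iff by auto
  have e0E: "e0 \<in> E" using C1 e0 by blast
  have "delta A \<inter> (C - {e0}) \<noteq> {}" if A: "separates A ?x ?y" for A
  proof
    assume "delta A \<inter> (C - {e0}) = {}"
    moreover have "e0 \<in> delta A" using A in_delta[OF e0E] unfolding separates_def by auto
    ultimately have "delta A \<inter> C = {e0}" using e0 by auto
    then show False using no1 A unfolding separates_def by metis
  qed
  moreover have "\<exists>A. separates A ?x ?y \<and> delta A \<inter> (C - {e0}) = {e}" if e: "e \<in> C - {e0}" for e
  proof -
    obtain B where B: "fincut B" "delta B \<inter> C = {e0, e}" using two[OF e0, of e] e by auto
    define A where "A = (if snd (inc e0) \<in> B then B else - B)"
    have dA: "delta A = delta B" "fincut A" unfolding A_def using B by auto
    have "e0 \<in> delta B" using B(2) by auto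
    then have "separates A ?x ?y" unfolding separates_def using dA(2) in_delta[OF e0E, of B] unfolding A_def by auto
    moreover have "delta A \<inter> (C - {e0}) = (delta A \<inter> C) - {e0}" by blast
    then have "delta A \<inter> (C - {e0}) = {e}" unfolding dA B(2) using e by auto
    ultimately show ?thesis by blast
  qed
  ultimately show ?thesis unfolding link_def VE_def using C1 ends_in_V[OF e0E] by auto
qed

theorem circuit_is_circle:
  assumes C: "C \<in> circuits E fbs.coindep"
  shows "\<exists>X. is_circle V E inc X \<and> edge_set_of E X = C \<and> X \<subseteq> VE \<union> (\<Union>e\<in>C. inner_of e)"
proof -
  have C1: "C \<subseteq> E" "C \<noteq> {}" and no1: "\<And>A e. fincut A \<Longrightarrow> delta A \<inter> C \<noteq> {e}"
    using C unfolding cocircuit_iff by auto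
  obtain e0 where e0: "e0 \<in> C" using C1 by blast
  then have e0E: "e0 \<in> E" using C1 by blast
  define P where "P = C - {e0}"
  define x where "x = (Vx (snd (inc e0)) :: ('v,'e) gpoint)"
  define y where "y = (Vx (fst (inc e0)) :: ('v,'e) gpoint)"
  have link: "link P x y" using link_of_circuit[OF C e0] unfolding P_def x_def y_def .
  have xVE: "x \<in> VE" and yVE: "y \<in> VE" using link unfolding link_def by auto
  obtain w g where wg: "arc_map P x y w g" using link_arc_map[OF link] by blast
  have w: "0 \<le> w" and g: "continuous_map (top_of_set {0..w}) GT g" "g 0 = x"
    "P \<noteq> {} \<Longrightarrow> g w = y" "P = {} \<Longrightarrow> w = 0"
    using wg unfolding arc_map_def by simp_all
  have g_in: "g t \<in> VE \<union> (\<Union>e\<in>P. inner_of e)" and g_covers: "e \<in> P \<Longrightarrow> inner_of e \<subseteq> g ` {0..w}"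
    and g_inj: "g s = g t \<Longrightarrow> g s \<notin> VE \<Longrightarrow> s = t" for s t e
    using wg unfolding arc_map_def by meson+
  have g_sep: "\<exists>B. fincut B \<and> pin B (g s) \<noteq> pin B (g t)"
    if "s \<in> {0..w}" "t \<in> {0..w}" "s < t" "g s \<in> VE" "g t \<in> VE" for s t
    using wg that unfolding arc_map_def by simp
  have gw: "g w \<in> VE" "\<And>A. fincut A \<Longrightarrow> pin A (g w) \<longleftrightarrow> fst (inc e0) \<in> A"
  proof -
    show "g w \<in> VE" using g(2-4) xVE yVE by (cases "P = {}") auto
    fix A assume A: "fincut A"
    show "pin A (g w) \<longleftrightarrow> fst (inc e0) \<in> A"
    proof (cases "P = {}")
      case True
      \<comment> \<open>A circuit with a single edge, for example a loop: e0 lies in no finite cut,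
        so its ends are indistinguishable, and the path g has length 0.\<close>
      then have "C = {e0}" using e0 unfolding P_def by auto
      then have "e0 \<notin> delta A" using no1[OF A, of e0] by auto
      then have "fst (inc e0) \<in> A \<longleftrightarrow> snd (inc e0) \<in> A" using in_delta[OF e0E] by simp
      then show ?thesis using g(2) g(4)[OF True] unfolding x_def by simp
    next
      case False
      then show ?thesis using g(3) unfolding y_def by simp
    qed
  qed
  \<comment> \<open>Starting at \<open>g w\<close> instead of the first end of e0 makes the loop
    close up even when e0 is the whole circuit and has two different ends.\<close>
  let ?a = "edge_arc (g w) x e0"
  define h where "h t = (if t \<le> w then g t else ?a (t - w))" for t
  have cont_a: "continuous_map (top_of_set {0..1}) GT ?a"
    by (rule continuous_edge_arc[OF e0E gw(1) xVE gw(2)]) (simp_all add: x_def)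
  have h_cont: "continuous_map (top_of_set {0..w + 1}) GT h"
    unfolding h_def
  proof (rule continuous_map_cases_le[where p = "\<lambda>t. t" and q = "\<lambda>t. w"])
    have "{t \<in> topspace (top_of_set {0..w + 1}). t \<le> w} = {0..w}" using w by auto
    moreover have "{0..w + 1} \<inter> {0..w} = {0..w}" by auto
    ultimately show "continuous_map (subtopology (top_of_set {0..w + 1}) {t \<in> topspace (top_of_set {0..w + 1}). t \<le> w}) GT g"
      using g(1) by (simp add: subtopology_subtopology)
    have "{t \<in> topspace (top_of_set {0..w + 1}). w \<le> t} = {w..w + 1}" using w by auto
    moreover have "{0..w + 1} \<inter> {w..w + 1} = {w..w + 1}" using w by auto
    moreover have "continuous_map (top_of_set {w..w + 1}) (top_of_set {0..1}) (\<lambda>t. t - w)"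
      by (auto simp: continuous_map_in_subtopology intro!: continuous_intros)
    from continuous_map_compose[OF this cont_a]
    have "continuous_map (top_of_set {w..w + 1}) GT (\<lambda>t. ?a (t - w))" unfolding comp_def .
    ultimately show "continuous_map (subtopology (top_of_set {0..w + 1}) {t \<in> topspace (top_of_set {0..w + 1}). w \<le> t}) GT (\<lambda>t. ?a (t - w))"
      by (simp add: subtopology_subtopology)
  qed (auto simp: edge_arc_def)
  define k where "k t = h (t * (w + 1))" for t
  have "continuous_map (top_of_set {0..1}) (top_of_set {0..w + 1}) (\<lambda>t. t * (w + 1))"
    using w by (auto simp: continuous_map_in_subtopology mult_left_le_one_le intro!: continuous_intros)
  from continuous_map_compose[OF this h_cont]
  have k_cont: "continuous_map (top_of_set {0..1}) GT k" unfolding k_def comp_def .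
  have k_img: "k ` {0..1} = h ` {0..w + 1}"
  proof -
    have "(\<lambda>t. t * (w + 1)) ` {0..1} = {0..w + 1}"
    proof
      show "{0..w + 1} \<subseteq> (\<lambda>t. t * (w + 1)) ` {0..1}"
      proof
        fix s assume "s \<in> {0..w + 1}"
        then show "s \<in> (\<lambda>t. t * (w + 1)) ` {0..1}" using w by (intro image_eqI[of _ _ "s / (w + 1)"]) auto
      qed
      show "(\<lambda>t. t * (w + 1)) ` {0..1} \<subseteq> {0..w + 1}"
      proof
        fix s assume "s \<in> (\<lambda>t. t * (w + 1)) ` {0..1}"
        then obtain t where "s = t * (w + 1)" "t \<in> {0..1}" by (rule imageE)
        then show "s \<in> {0..w + 1}" using w mult_left_le_one_le[of "w + 1" t] by simp
      qed
    qed
    then show ?thesis unfolding k_def by (metis image_image)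
  qed
  have h_arc: "h t = Inner e0 (t - w)" if "w < t" "t < w + 1" for t using that unfolding h_def edge_arc_def by simp
  have h_g: "h t = g t" if "t \<le> w" for t using that unfolding h_def by simp
  have h_0: "h 0 = x" using w g(2) unfolding h_def by simp
  have h_end: "h (w + 1) = x" unfolding h_def edge_arc_def by simp
  have g_e0: "g t \<noteq> Inner e0 s" for s t
    using g_in[of t] VE_not_Inner[of "g t" e0 "{s}"] unfolding P_def inner_of_def by auto
  have cases_t: "t \<le> w \<or> (w < t \<and> t < w + 1)" if "t \<in> {0..<w + 1}" for t using that by auto
  have h_VE: "t \<le> w \<and> h t = g t" if "t \<in> {0..<w + 1}" "h t \<in> VE" for t
    using cases_t[OF that(1)] h_arc[of t] h_g that(2) VE_not_Inner[of "h t" e0 "{t - w}"] by auto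
  have h_sep: "\<exists>B. fincut B \<and> pin B (h s) \<noteq> pin B (h t)"
    if st: "s \<in> {0..<w + 1}" "t \<in> {0..<w + 1}" "s < t" "h s \<in> VE" "h t \<in> VE" for s t
    using g_sep[of s t] h_VE[OF st(1,4)] h_VE[OF st(2,5)] st by auto
  have h_inj: "inj_on h {0..<w + 1}"
  proof (rule linorder_inj_onI')
    fix s t assume st: "s \<in> {0..<w + 1}" "t \<in> {0..<w + 1}" "s < t"
    show "h s \<noteq> h t"
    proof
      assume eq: "h s = h t"
      show False
      proof (cases "h s \<in> VE")
        case True
        then show ?thesis using h_sep[OF st] eq by auto
      next
        case False
        from cases_t[OF st(1)] cases_t[OF st(2)] st(3) show ?thesis
        proof (elim disjE)
          assume "s \<le> w" "t \<le> w"
          then show ?thesis using g_inj[of s t] eq False h_g st(3) by auto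
        next
          assume "s \<le> w" "w < t \<and> t < w + 1"
          then show ?thesis using eq h_g[of s] h_arc[of t] g_e0 by auto
        next
          assume "w < s \<and> s < w + 1" "w < t \<and> t < w + 1"
          then show ?thesis using eq h_arc[of s] h_arc[of t] st(3) by auto
        next
          assume "w < s \<and> s < w + 1" "t \<le> w"
          then show ?thesis using st(3) by linarith
        qed
      qed
    qed
  qed
  have h_img: "h ` {0..w + 1} = h ` {0..<w + 1}"
  proof -
    have "{0..w + 1} = insert (w + 1) {0..<w + 1}" using w by auto
    moreover have "h (w + 1) \<in> h ` {0..<w + 1}" unfolding h_end h_0[symmetric] using w by auto
    ultimately show ?thesis by (simp add: insert_absorb)
  qed
  define X where "X = h ` {0..w + 1}"
  have X_sub: "X \<subseteq> VE \<union> (\<Union>e\<in>C. inner_of e)"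
  proof
    fix p assume "p \<in> X"
    then obtain t where t: "p = h t" "t \<in> {0..<w + 1}" unfolding X_def h_img by blast
    from cases_t[OF t(2)] show "p \<in> VE \<union> (\<Union>e\<in>C. inner_of e)"
    proof
      assume "t \<le> w"
      then show ?thesis using g_in[of t] h_g t(1) unfolding P_def by auto
    next
      assume "w < t \<and> t < w + 1"
      then have "p \<in> inner_of e0" using h_arc t(1) unfolding inner_of_def by auto
      then show ?thesis using e0 by blast
    qed
  qed
  have "(\<Union>e\<in>C. inner_of e) \<subseteq> XX" using C1 unfolding inner_of_def XG_def inner_points_def by auto
  then have X_GT: "X \<subseteq> XX \<union> Ends" using X_sub VE_sub by blast
  have "Hausdorff_space (subtopology GT X)"
  proof (rule Hausdorff_subspace[OF X_GT])
    fix p q assume pq: "p \<in> X" "q \<in> X" "p \<in> VE" "q \<in> VE" "p \<noteq> q"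
    then obtain s t where st: "p = h s" "s \<in> {0..<w + 1}" "q = h t" "t \<in> {0..<w + 1}" unfolding X_def h_img by blast
    then consider "s < t" | "t < s" using pq(5) by (metis linorder_neqE)
    then show "\<exists>B. fincut B \<and> pin B p \<noteq> pin B q"
      using h_sep[of s t] h_sep[of t s] st pq by cases auto
  qed
  moreover have "inj_on k {0..<1}"
  proof (rule inj_onI)
    fix s t :: real assume st: "s \<in> {0..<1}" "t \<in> {0..<1}" "k s = k t"
    have "r * (w + 1) < w + 1" if "r < 1" for r :: real
      using mult_strict_right_mono[OF that, of "w + 1"] w by simp
    then have "s * (w + 1) \<in> {0..<w + 1}" "t * (w + 1) \<in> {0..<w + 1}" using st w by auto
    then have "s * (w + 1) = t * (w + 1)" using inj_onD[OF h_inj] st(3) unfolding k_def by blast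
    then show "s = t" using w by simp
  qed
  moreover have "k 0 = k 1" unfolding k_def using h_0 h_end by simp
  ultimately have "subtopology GT X homeomorphic_space top_of_set (sphere (0::complex) 1)"
    using loop_homeomorphic_circle[OF k_cont] unfolding k_img X_def by blast
  then have "is_circle V E inc X" unfolding is_circle_def using X_GT by simp
  moreover have "edge_set_of E X = C"
  proof
    show "edge_set_of E X \<subseteq> C"
    proof
      fix e assume "e \<in> edge_set_of E X"
      then have "Inner e (1/2) \<in> X" unfolding edge_set_of_def inner_of_def by force
      then show "e \<in> C" using X_sub VE_not_Inner[of "Inner e (1/2)" e "{1/2}"] unfolding inner_of_def by auto
    qed
    show "C \<subseteq> edge_set_of E X"
    proof
      fix e assume e: "e \<in> C"
      have "inner_of e \<subseteq> X"
      proof (cases "e = e0")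
        case True
        show ?thesis
        proof
          fix p :: "('v,'e) gpoint" assume "p \<in> inner_of e"
          then obtain t where t: "p = Inner e0 t" "0 < t" "t < 1" unfolding inner_of_def True by auto
          then show "p \<in> X" unfolding X_def using h_arc[of "w + t"] w by (intro image_eqI[of _ _ "w + t"]) auto
        qed
      next
        case False
        then have "inner_of e \<subseteq> g ` {0..w}" using g_covers e unfolding P_def by auto
        also have "\<dots> = h ` {0..w}" using h_g by (intro image_cong) auto
        also have "\<dots> \<subseteq> X" unfolding X_def by auto
        finally show ?thesis .
      qed
      then show "e \<in> edge_set_of E X" using e C1 unfolding edge_set_of_def by blast
    qed
  qed
  ultimately show ?thesis using X_sub by blast
qed

end

section \<open>Circles are circuits\<close>

context conn_graph
begin

text \<open>The homeomorphism is rotated so that b has the parameters 0 and 1. Off b the inverse d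
  is continuous, since the angle \<open>Arg2pi\<close> is continuous away from the nonnegative
  reals.\<close>

lemma circle_param:
  assumes X: "is_circle V E inc X" and b: "b \<in> X"
  obtains c d where "continuous_map (top_of_set {0..1::real}) GT c" "c 0 = b" "c 1 = b" "c ` {0..1} = X"
    "continuous_map (subtopology GT (X - {b})) euclideanreal d"
    "\<And>t. 0 < t \<Longrightarrow> t < 1 \<Longrightarrow> c t \<noteq> b \<and> d (c t) = t"
    "\<And>p. p \<in> X \<Longrightarrow> p \<noteq> b \<Longrightarrow> 0 < d p \<and> d p < 1 \<and> c (d p) = p"
proof -
  let ?X = "subtopology GT X" and ?S = "top_of_set (sphere (0::complex) 1)"
  have XT: "X \<subseteq> topspace GT" and hom: "?X homeomorphic_space ?S" using X unfolding is_circle_def by auto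
  have tX: "topspace ?X = X" using XT by auto
  obtain f g where fg: "homeomorphic_maps ?X ?S f g" using hom unfolding homeomorphic_space_def by blast
  then have f: "continuous_map ?X ?S f" and g: "continuous_map ?S ?X g"
    and gf: "\<And>p. p \<in> X \<Longrightarrow> g (f p) = p" and fg': "\<And>z. z \<in> sphere 0 1 \<Longrightarrow> f (g z) = z"
    unfolding homeomorphic_maps_def tX by auto
  have fS: "f p \<in> sphere 0 1" if "p \<in> X" for p
    using continuous_map_image_subset_topspace[OF f] that unfolding tX by auto
  have gX: "g z \<in> X" if "z \<in> sphere 0 1" for z
    using continuous_map_image_subset_topspace[OF g] that unfolding tX by auto
  define B where "B = f b"
  have B: "norm B = 1" using fS[OF b] unfolding B_def by simp
  then have B0: "B \<noteq> 0" by auto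
  define c where "c t = g (B * circ t)" for t
  define d where "d p = Arg2pi (f p / B) / (2 * pi)" for p
  have nc: "norm (circ t) = 1" for t using circ_sphere[of t] by simp
  have BS: "B * circ t \<in> sphere 0 1" for t using B nc[of t] by (simp add: norm_mult)
  have c1: "continuous_map (top_of_set {0..1::real}) GT c"
  proof -
    have "continuous_map (top_of_set {0..1::real}) ?S (\<lambda>t. B * circ t)"
      using BS continuous_circ by (auto simp: continuous_map_in_subtopology intro!: continuous_intros)
    from continuous_map_compose[OF this g] show ?thesis
      unfolding c_def comp_def continuous_map_in_subtopology by simp
  qed
  have circ01: "circ 0 = 1" "circ 1 = 1" unfolding circ_def by auto
  have c0: "c 0 = b" "c 1 = b" unfolding c_def circ01 B_def using gf[OF b] by auto
  have quot: "f p / B \<in> sphere 0 1" if "p \<in> X" for p using fS[OF that] B by (simp add: norm_divide)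
  have d_range: "0 \<le> d p \<and> d p < 1" for p
    unfolding d_def using Arg2pi_ge_0[of "f p / B"] Arg2pi_lt_2pi[of "f p / B"] by (simp add: field_simps)
  have cd: "c (d p) = p" if "p \<in> X" for p
    unfolding c_def d_def circ_Arg2pi[OF quot[OF that]] using B0 gf[OF that] by simp
  have dc: "d (c t) = t" if "0 \<le> t" "t < 1" for t
  proof -
    have "f (c t) = B * circ t" unfolding c_def using fg'[OF BS] .
    then have "d (c t) = Arg2pi (circ t) / (2 * pi)" unfolding d_def using B0 by simp
    then show ?thesis unfolding Arg2pi_circ[OF that] by simp
  qed
  have im: "c ` {0..1} = X"
  proof
    show "c ` {0..1} \<subseteq> X" unfolding c_def using gX BS by (auto simp del: mem_sphere_0)
    show "X \<subseteq> c ` {0..1}"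
    proof
      fix p assume "p \<in> X"
      then have "p = c (d p)" "d p \<in> {0..1}" using cd d_range[of p] by auto
      then show "p \<in> c ` {0..1}" by blast
    qed
  qed
  have d0: "d p \<noteq> 0" if "p \<in> X" "p \<noteq> b" for p using cd[OF that(1)] c0(1) that(2) by metis
  have contd: "continuous_map (subtopology GT (X - {b})) euclideanreal d"
  proof -
    have "continuous_map (subtopology GT (X - {b})) ?S f"
      using continuous_map_from_subtopology[OF f, of "X - {b}"] by (simp add: subtopology_subtopology Int_absorb1 Diff_subset)
    then have "continuous_map (subtopology GT (X - {b})) euclidean f" by (simp add: continuous_map_in_subtopology)
    moreover have "continuous_map euclidean euclidean (\<lambda>z. z / B)"
      using B0 by (simp add: continuous_intros)
    ultimately have "continuous_map (subtopology GT (X - {b})) euclidean ((\<lambda>z. z / B) \<circ> f)"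
      by (rule continuous_map_compose)
    then have "continuous_map (subtopology GT (X - {b})) euclidean (\<lambda>p. f p / B)" unfolding comp_def .
    moreover have "(\<lambda>p. f p / B) ` topspace (subtopology GT (X - {b})) \<subseteq> - \<real>\<^sub>\<ge>\<^sub>0"
    proof
      fix z assume "z \<in> (\<lambda>p. f p / B) ` topspace (subtopology GT (X - {b}))"
      then obtain p where p: "z = f p / B" "p \<in> X" "p \<noteq> b" by auto
      show "z \<in> - \<real>\<^sub>\<ge>\<^sub>0"
      proof
        assume "z \<in> \<real>\<^sub>\<ge>\<^sub>0"
        then have "Arg2pi z = 0" unfolding Arg2pi_eq_0 by (auto elim: nonneg_Reals_cases)
        then show False using d0[OF p(2,3)] unfolding d_def p(1) by simp
      qed
    qed
    ultimately have "continuous_map (subtopology GT (X - {b})) (top_of_set (- \<real>\<^sub>\<ge>\<^sub>0)) (\<lambda>p. f p / B)"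
      by (simp add: continuous_map_in_subtopology image_subset_iff Pi_iff)
    moreover have "continuous_map (top_of_set (- \<real>\<^sub>\<ge>\<^sub>0)) euclideanreal (\<lambda>z. Arg2pi z / (2 * pi))"
    proof -
      have "continuous_on (- \<real>\<^sub>\<ge>\<^sub>0) Arg2pi"
        by (intro continuous_at_imp_continuous_on ballI continuous_at_Arg2pi) simp
      then have "continuous_on (- \<real>\<^sub>\<ge>\<^sub>0) (\<lambda>z. Arg2pi z / (2 * pi))" by (intro continuous_intros) auto
      then show ?thesis by simp
    qed
    ultimately have "continuous_map (subtopology GT (X - {b})) euclideanreal ((\<lambda>z. Arg2pi z / (2 * pi)) \<circ> (\<lambda>p. f p / B))"
      by (rule continuous_map_compose)
    then show ?thesis unfolding d_def comp_def .
  qed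
  have c_ne: "c t \<noteq> b" if "0 < t" "t < 1" for t
    using dc[of t] dc[of 0] c0(1) that by auto
  show ?thesis
  proof (rule that[OF c1 c0 im contd])
    show "\<And>t. 0 < t \<Longrightarrow> t < 1 \<Longrightarrow> c t \<noteq> b \<and> d (c t) = t" using c_ne dc by simp
    show "\<And>p. p \<in> X \<Longrightarrow> p \<noteq> b \<Longrightarrow> 0 < d p \<and> d p < 1 \<and> c (d p) = p"
      using d0 d_range cd by (metis less_eq_real_def)
  qed
qed

lemma circle_sub: "is_circle V E inc X \<Longrightarrow> X \<subseteq> XX \<union> Ends"
  unfolding is_circle_def by simp

lemma circle_Hausdorff: "is_circle V E inc X \<Longrightarrow> Hausdorff_space (subtopology GT X)"
  unfolding is_circle_def using homeomorphic_Hausdorff_space Hausdorff_space_subtopology Hausdorff_space_euclidean by metis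

lemma circle_nonempty: assumes "is_circle V E inc X" shows "X \<noteq> {}"
proof
  assume "X = {}"
  then have "topspace (subtopology GT X) = {}" by simp
  then have "topspace (top_of_set (sphere (0::complex) 1)) = {}"
    using assms homeomorphic_empty_space unfolding is_circle_def null_topspace_iff_trivial by metis
  moreover have "(1::complex) \<in> sphere 0 1" by simp
  ultimately show False by simp
qed

lemma circle_infinite:
  assumes "is_circle V E inc X" "finite F" shows "\<exists>p\<in>X. p \<notin> F"
proof -
  obtain b where b: "b \<in> X" using circle_nonempty[OF assms(1)] by blast
  obtain c d where cd: "c ` {0..1::real} = X" "\<And>t. 0 < t \<Longrightarrow> t < 1 \<Longrightarrow> c t \<noteq> b \<and> d (c t) = t"
    using circle_param[OF assms(1) b] by metis
  have inj: "inj_on c {0<..<1}" using cd(2) by (metis inj_onI greaterThanLessThan_iff)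
  have "infinite (c ` {0<..<1::real})" using finite_imageD[OF _ inj] infinite_Ioo[of "0::real" 1] by auto
  moreover have "c ` {0<..<1} \<subseteq> X" unfolding cd(1)[symmetric] by auto
  ultimately have "infinite X" using finite_subset by blast
  then show ?thesis using assms(2) by (meson finite_subset subsetI)
qed

lemma circle_connected:
  assumes "is_circle V E inc X" shows "connectedin GT X" "connectedin GT (X - {b})"
proof -
  have main: "connectedin GT X \<and> (b \<in> X \<longrightarrow> connectedin GT (X - {b}))" if b': "b' \<in> X" "b \<in> X \<longrightarrow> b = b'" for b b'
  proof -
    obtain c d where c: "continuous_map (top_of_set {0..1::real}) GT c" "c ` {0..1} = X" "c 0 = b'" "c 1 = b'"
      and d: "\<And>t. 0 < t \<Longrightarrow> t < 1 \<Longrightarrow> c t \<noteq> b' \<and> d (c t) = t"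
      using circle_param[OF assms b'(1)] by metis
    have im: "connectedin GT (c ` I)" if "connected I" "I \<subseteq> {0..1}" for I
      by (rule connectedin_continuous_map_image[OF c(1)]) (use that in \<open>simp add: connectedin_subtopology\<close>)
    have "c ` {0<..<1} = X - {b'}"
    proof
      show "c ` {0<..<1} \<subseteq> X - {b'}"
      proof
        fix p assume "p \<in> c ` {0<..<1}"
        then obtain t where "p = c t" "0 < t" "t < 1" by auto
        moreover have "c t \<in> X" unfolding c(2)[symmetric] using calculation by auto
        ultimately show "p \<in> X - {b'}" using d[of t] by auto
      qed
      show "X - {b'} \<subseteq> c ` {0<..<1}"
      proof
        fix p assume p: "p \<in> X - {b'}"
        then obtain t where t: "t \<in> {0..1}" "p = c t" using c(2) by blast
        then have "t \<noteq> 0" "t \<noteq> 1" using p c(3,4) by auto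
        then show "p \<in> c ` {0<..<1}" using t by auto
      qed
    qed
    moreover have "connectedin GT (c ` {0<..<1})" by (rule im) auto
    ultimately have minus: "connectedin GT (X - {b'})" by simp
    have "connectedin GT (c ` {0..1})" by (rule im) auto
    then have "connectedin GT X" unfolding c(2) .
    moreover have "connectedin GT (X - {b})" if "b \<in> X"
    proof -
      have "b = b'" using b'(2) that by blast
      then show ?thesis using minus by simp
    qed
    ultimately show ?thesis by blast
  qed
  obtain b0 where "b0 \<in> X" using circle_nonempty[OF assms] by blast
  then show conn: "connectedin GT X" using main[of b0 b0] by blast
  show "connectedin GT (X - {b})"
  proof (cases "b \<in> X")
    case False
    then show ?thesis using conn by simp
  qed (use main[of b b] in blast)
qed

section \<open>Circles consist of whole edges\<close>

definition ept :: "'e \<Rightarrow> bool \<Rightarrow> real \<Rightarrow> ('v,'e) gpoint" where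
  "ept e o1 t = Inner e (if o1 then t else 1 - t)"

text \<open>The end from which \<open>ept\<close> reads the edge. Letting \<open>o1\<close> choose
  it makes one argument cover both ends.\<close>

definition endv :: "'e \<Rightarrow> bool \<Rightarrow> 'v" where
  "endv e o1 = (if o1 then fst (inc e) else snd (inc e))"

lemma ept_inj: "ept e o1 s = ept e o1 t \<longleftrightarrow> s = t"
  unfolding ept_def by auto

lemma ept_image: "ept e o1 ` {a<..<b} = Inner e ` (if o1 then {a<..<b} else {1 - b<..<1 - a})"
  "ept e o1 ` {a..b} = Inner e ` (if o1 then {a..b} else {1 - b..1 - a})"
proof -
  have "t \<in> (\<lambda>t. 1 - t) ` I \<longleftrightarrow> 1 - t \<in> I" for t :: real and I
    by (metis (no_types, lifting) diff_diff_eq2 add_diff_cancel_left' image_iff)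
  then have "(\<lambda>t. 1 - t) ` {a<..<b} = {1 - b<..<1 - a}" "(\<lambda>t. 1 - t) ` {a..b} = {1 - b..1 - a}" by auto
  then show "ept e o1 ` {a<..<b} = Inner e ` (if o1 then {a<..<b} else {1 - b<..<1 - a})"
    "ept e o1 ` {a..b} = Inner e ` (if o1 then {a..b} else {1 - b..1 - a})"
    unfolding ept_def by (auto simp: image_image[symmetric] split: if_splits)
qed

lemma ept_open: "e \<in> E \<Longrightarrow> 0 \<le> a \<Longrightarrow> b \<le> 1 \<Longrightarrow> openin GT (ept e o1 ` {a<..<b})"
  unfolding ept_image using GT_open_segment[of e] by simp

lemma ept_coopen: "e \<in> E \<Longrightarrow> 0 < a \<Longrightarrow> a \<le> b \<Longrightarrow> b < 1 \<Longrightarrow> openin GT (XX \<union> Ends - ept e o1 ` {a..b})"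
  unfolding ept_image using GT_open_cosegment[of e] by simp

lemma ept_inner_of: "inner_of e = ept e o1 ` {0<..<1}"
  unfolding ept_image inner_of_eq by simp

lemma connectedin_segment:
  assumes e: "e \<in> E" and I: "connected I" "I \<subseteq> {0<..<1}" shows "connectedin GT (Inner e ` I)"
proof -
  let ?p = "Vx (fst (inc e)) :: ('v,'e) gpoint" and ?q = "Vx (snd (inc e)) :: ('v,'e) gpoint"
  have c: "continuous_map (top_of_set {0..1}) GT (edge_arc ?p ?q e)"
    by (rule continuous_edge_arc[OF e]) (use ends_in_V[OF e] in \<open>auto simp: VE_def\<close>)
  have "I \<subseteq> {0..1}" using I(2) by auto
  then have "connectedin GT (edge_arc ?p ?q e ` I)"
    by (intro connectedin_continuous_map_image[OF c]) (simp add: connectedin_subtopology I(1))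
  moreover have "edge_arc ?p ?q e ` I = Inner e ` I"
    using I(2) by (intro image_cong) (auto simp: edge_arc_def)
  ultimately show ?thesis by simp
qed

lemma connectedin_dichotomy:
  assumes "connectedin GT S" "openin GT U1" "openin GT U2" "S \<subseteq> U1 \<union> U2" "U1 \<inter> U2 \<inter> S = {}"
  shows "U1 \<inter> S = {} \<or> S \<subseteq> U1"
proof (rule ccontr)
  assume "\<not> ?thesis"
  then have "U1 \<inter> S \<noteq> {}" "U2 \<inter> S \<noteq> {}" using assms(4) by auto
  then have "\<exists>E1 E2. openin GT E1 \<and> openin GT E2 \<and> S \<subseteq> E1 \<union> E2 \<and> E1 \<inter> E2 \<inter> S = {} \<and> E1 \<inter> S \<noteq> {} \<and> E2 \<inter> S \<noteq> {}"
    using assms(2-5) by (intro exI[of _ U1] exI[of _ U2]) simp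
  then show False using assms(1) unfolding connectedin by simp
qed

lemma segment_dichotomy:
  assumes S: "connectedin GT S" and e: "e \<in> E" and ab: "0 < a" "a < b" "b < 1"
    and no: "ept e o1 a \<notin> S" "ept e o1 b \<notin> S"
  shows "ept e o1 ` {a<..<b} \<inter> S = {} \<or> S \<subseteq> ept e o1 ` {a<..<b}"
proof (rule connectedin_dichotomy[OF S])
  show "openin GT (ept e o1 ` {a<..<b})" using ept_open[OF e] ab by simp
  show "openin GT (XX \<union> Ends - ept e o1 ` {a..b})" using ept_coopen[OF e] ab by simp
  have "{a..b} = insert a (insert b {a<..<b})" using ab by auto
  then have "ept e o1 ` {a..b} = insert (ept e o1 a) (insert (ept e o1 b) (ept e o1 ` {a<..<b}))" by simp
  moreover have "S \<subseteq> XX \<union> Ends" using connectedin_subset_topspace[OF S] by simp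
  ultimately show "S \<subseteq> ept e o1 ` {a<..<b} \<union> (XX \<union> Ends - ept e o1 ` {a..b})" using no by auto
  show "ept e o1 ` {a<..<b} \<inter> (XX \<union> Ends - ept e o1 ` {a..b}) \<inter> S = {}" by auto
qed

text \<open>A circle stays connected without any one point. If s is missing and u < r2 beyond s
  belong to X, then dropping a point r1 between them would trap the rest of X between s and r1,
  against r2. So at most one point of X lies beyond s on the edge. But either all points after t are
  in X, or a missing r after t traps the infinite set X between s and r.\<close>

lemma circle_full_edge_aux:
  assumes X: "is_circle V E inc X" and e: "e \<in> E" and st: "0 < s" "s < t" "t < 1"
    and t: "ept e o1 t \<in> X" shows "ept e o1 s \<in> X"
proof (rule ccontr)
  assume s: "ept e o1 s \<notin> X"
  have confined: "\<exists>v. q = ept e o1 v \<and> s < v \<and> v < r"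
    if r: "r < 1" "s < u" "u < r" "ept e o1 u \<in> S" "q \<in> S" and S: "connectedin GT S" "S \<subseteq> X" "ept e o1 r \<notin> S" for r u q S
  proof -
    have "s < r" using r by simp
    have "ept e o1 s \<notin> S" using s S(2) by blast
    then have "ept e o1 ` {s<..<r} \<inter> S = {} \<or> S \<subseteq> ept e o1 ` {s<..<r}"
      by (rule segment_dichotomy[OF S(1) e st(1) \<open>s < r\<close> r(1) _ S(3)])
    moreover have "ept e o1 u \<in> ept e o1 ` {s<..<r} \<inter> S" using r by auto
    ultimately have "q \<in> ept e o1 ` {s<..<r}" using r(5) by blast
    then show ?thesis by auto
  qed
  have minus: "\<exists>v. q = ept e o1 v \<and> s < v \<and> v < r"
    if r: "r < 1" "s < u" "u < r" "ept e o1 u \<in> X" "q \<in> X" "q \<noteq> ept e o1 r" for r u q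
    by (rule confined[OF r(1-3) _ _ circle_connected(2)[OF X, of "ept e o1 r"]]) (use r ept_inj in auto)
  have two: False if r: "s < u" "u < r1" "r1 < r2" "r2 < 1" "ept e o1 u \<in> X" "ept e o1 r2 \<in> X" for u r1 r2
  proof -
    have "\<exists>v. ept e o1 r2 = ept e o1 v \<and> s < v \<and> v < r1"
      by (rule minus[of r1 u]) (use r ept_inj in auto)
    then show False using r ept_inj by auto
  qed
  show False
  proof (cases "\<exists>r. t < r \<and> r < 1 \<and> ept e o1 r \<notin> X")
    case False
    define r2 where "r2 = ((t + 1) / 2 + 1) / 2"
    have r2: "(t + 1) / 2 < r2" "r2 < 1" "t < (t + 1) / 2" using st(3) unfolding r2_def by (simp_all add: field_simps)
    then have "ept e o1 r2 \<in> X" using False by auto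
    then show False using two[of t "(t + 1) / 2" r2] r2 st t by auto
  next
    case True
    then obtain r where r: "t < r" "r < 1" "ept e o1 r \<notin> X" by blast
    have all: "\<exists>v. q = ept e o1 v \<and> s < v \<and> v < r" if "q \<in> X" for q
      by (rule confined[OF r(2) st(2) r(1) t that circle_connected(1)[OF X]]) (use r in auto)
    obtain p where p: "p \<in> X" "p \<notin> {ept e o1 t}" using circle_infinite[OF X, of "{ept e o1 t}"] by auto
    obtain q where q: "q \<in> X" "q \<notin> {ept e o1 t, p}" using circle_infinite[OF X, of "{ept e o1 t, p}"] by auto
    obtain a where a: "p = ept e o1 a" "s < a" "a < r" using all[OF p(1)] by blast
    obtain b where b: "q = ept e o1 b" "s < b" "b < r" using all[OF q(1)] by blast
    have ne: "a \<noteq> t" "b \<noteq> t" "a \<noteq> b" using p q a b by auto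
    have mid: False if "u < m" "m < v" "s < u" "v < r" "ept e o1 u \<in> X" "ept e o1 v \<in> X" for u m v
      using two[of u m v] that r by auto
    consider "a < b" "b < t" | "a < t" "t < b" | "b < a" "a < t" | "b < t" "t < a" | "t < a" "a < b" | "t < b" "b < a"
      using ne by linarith
    then show False
      using mid[of a b t] mid[of a t b] mid[of b a t] mid[of b t a] mid[of t a b] mid[of t b a] a b p q t st r by cases auto
  qed
qed

lemma circle_full_edge:
  assumes X: "is_circle V E inc X" and t: "Inner e t \<in> X" shows "e \<in> E \<and> inner_of e \<subseteq> X"
proof -
  have "Inner e t \<in> XX \<union> Ends" using circle_sub[OF X] t by blast
  then have e: "e \<in> E" "0 < t" "t < 1" unfolding XG_def inner_points_def Ends_def by auto
  have "Inner e s \<in> X" if s: "0 < s" "s < 1" for s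
  proof -
    consider "s = t" | "s < t" | "t < s" by linarith
    then show ?thesis
    proof cases
      case 2
      then show ?thesis using circle_full_edge_aux[OF X e(1), of s t True] s e t unfolding ept_def by simp
    next
      case 3
      then show ?thesis using circle_full_edge_aux[OF X e(1), of "1 - s" "1 - t" False] s e t unfolding ept_def by simp
    qed (use t in simp)
  qed
  then show ?thesis using e unfolding inner_of_def by auto
qed

lemma circle_points:
  assumes X: "is_circle V E inc X" and p: "p \<in> X"
  obtains "p \<in> VE" | e t where "p = Inner e t" "0 < t" "t < 1" "e \<in> edge_set_of E X"
proof -
  have "p \<in> XX \<union> Ends" using circle_sub[OF X] p by blast
  then show ?thesis
  proof (cases rule: GT_cases)
    case (2 e t)
    then have "e \<in> edge_set_of E X" using circle_full_edge[OF X, of e t] p unfolding edge_set_of_def by blast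
    then show ?thesis using that(2) 2 by blast
  qed (rule that(1))
qed

section \<open>Circles and finite cuts\<close>

lemma connected_one_side:
  assumes S: "connectedin GT S" and A: "fincut A" and c: "0 < c" "c < 1"
    and no: "\<And>p. p \<in> S \<Longrightarrow> gval A p \<noteq> c" and pq: "p \<in> S" "q \<in> S" "gval A p < c"
  shows "gval A q < c"
proof -
  let ?U = "{p \<in> XX \<union> Ends. gval A p < c}" and ?V = "{p \<in> XX \<union> Ends. gval A p > c}"
  have sub: "S \<subseteq> XX \<union> Ends" using connectedin_subset_topspace[OF S] by simp
  have "?U \<inter> S = {} \<or> S \<subseteq> ?U"
  proof (rule connectedin_dichotomy[OF S openin_gval_less[OF A c] openin_gval_greater[OF A c]])
    show "S \<subseteq> ?U \<union> ?V" using sub no by fastforce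
  qed auto
  moreover have "p \<in> ?U \<inter> S" using pq sub by blast
  ultimately show ?thesis using pq(2) by auto
qed

lemma gval_noncrossing:
  assumes "e \<in> E" "e \<notin> delta A" shows "gval A (Inner e t) = side A (fst (inc e))"
  using in_delta[OF assms(1), of A] assms(2) by (auto simp: side_def)

lemma gval_crossing:
  assumes "e \<in> E" "e \<in> delta A" shows "gval A (Inner e t) = (if fst (inc e) \<in> A then t else 1 - t)"
  using in_delta[OF assms(1), of A] assms(2) by (auto simp: side_def)

text \<open>Without the midpoint of e the circle is still connected. There the function of the cut
  never equals 1/2, since no other edge of the circle crosses, but it takes values on both sides of
  1/2 on the two halves of e.\<close>

lemma circle_crossing:
  assumes X: "is_circle V E inc X" and A: "fincut A" shows "delta A \<inter> edge_set_of E X \<noteq> {e}"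
proof
  let ?C = "edge_set_of E X"
  assume eq: "delta A \<inter> ?C = {e}"
  then have e: "e \<in> delta A" "e \<in> ?C" by auto
  then have eE: "e \<in> E" and eX: "inner_of e \<subseteq> X" unfolding edge_set_of_def by auto
  let ?b = "Inner e (1/2) :: ('v,'e) gpoint"
  have conn: "connectedin GT (X - {?b})" by (rule circle_connected(2)[OF X])
  have no: "gval A p \<noteq> 1/2" if "p \<in> X - {?b}" for p
  proof -
    have pX: "p \<in> X" using that by simp
    show ?thesis
    proof (cases rule: circle_points[OF X pX])
      case 1
      then show ?thesis using gval_VE[OF 1, of A] by (simp split: if_splits)
    next
      case (2 f t)
      show ?thesis
      proof (cases "f = e")
        case True
        then show ?thesis using gval_crossing[OF eE e(1), of t] that 2(1) by auto
      next
        case False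
        then have "f \<notin> delta A" using eq 2(4) by auto
        then show ?thesis using gval_noncrossing[of f A t] 2 unfolding edge_set_of_def by (simp add: side_def)
      qed
    qed
  qed
  have mem: "Inner e (1/4) \<in> X - {?b}" "Inner e (3/4) \<in> X - {?b}" using eX unfolding inner_of_def by force+
  show False
    using connected_one_side[OF conn A _ _ no mem] connected_one_side[OF conn A _ _ no mem(2,1)]
      gval_crossing[OF eE e(1), of "1/4"] gval_crossing[OF eE e(1), of "3/4"]
    by (auto split: if_splits)
qed

text \<open>Otherwise q would lie in every open set containing p, against the Hausdorff property of
  the circle.\<close>

lemma circle_points_separated:
  assumes X: "is_circle V E inc X" and pq: "p \<in> X" "q \<in> X" "p \<in> VE" "q \<in> VE" "p \<noteq> q"
  shows "\<exists>A. fincut A \<and> pin A p \<and> \<not> pin A q"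
proof (rule ccontr)
  assume no: "\<not> ?thesis"
  have "p \<in> topspace (subtopology GT X)" "q \<in> topspace (subtopology GT X)" using pq circle_sub[OF X] by auto
  then obtain U U' where U: "openin (subtopology GT X) U" "p \<in> U" "q \<in> U'" "disjnt U U'"
    using circle_Hausdorff[OF X] pq(5) unfolding Hausdorff_space_def by metis
  then obtain T where T: "openin GT T" "U = T \<inter> X" unfolding openin_subtopology by auto
  have "q \<in> T" by (rule nbhd_VE_indistinguishable[OF T(1) _ pq(3,4)]) (use no U T in auto)
  then show False using U T pq(2) by (auto simp: disjnt_def)
qed

text \<open>Without edges the circle would consist of vertices and ends only, and a cut separating
  two of them would disconnect it.\<close>

lemma circle_has_edge: assumes X: "is_circle V E inc X" shows "edge_set_of E X \<noteq> {}"
proof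
  assume empty: "edge_set_of E X = {}"
  have VE: "r \<in> VE" if "r \<in> X" for r using circle_points[OF X that] empty by auto
  obtain p where p: "p \<in> X" using circle_nonempty[OF X] by blast
  obtain q where q: "q \<in> X" "q \<noteq> p" using circle_infinite[OF X, of "{p}"] by auto
  obtain A where A: "fincut A" "pin A p" "\<not> pin A q"
    using circle_points_separated[OF X p q(1) VE[OF p] VE[OF q(1)]] q(2) by auto
  have no: "gval A r \<noteq> 1/2" if "r \<in> X" for r using gval_VE[OF VE[OF that], of A] by simp
  have "gval A q < 1/2"
    by (rule connected_one_side[OF circle_connected(1)[OF X] A(1) _ _ no p q(1)])
      (use gval_VE[OF VE[OF p], of A] A(2) in auto)
  then show False using gval_VE[OF VE[OF q(1)], of A] A(3) by simp
qed

lemma fincut_Union: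
  assumes "finite \<A>" "\<And>A. A \<in> \<A> \<Longrightarrow> fincut A"
  shows "fincut (\<Union>\<A>) \<and> (\<forall>p\<in>VE. pin (\<Union>\<A>) p \<longleftrightarrow> (\<exists>A\<in>\<A>. pin A p))"
  using assms
proof (induction \<A> rule: finite_induct)
  case empty
  then show ?case by (simp add: pin_empty)
next
  case (insert A \<A>)
  then have A: "fincut A" "fincut (\<Union>\<A>)" "\<forall>p\<in>VE. pin (\<Union>\<A>) p \<longleftrightarrow> (\<exists>A\<in>\<A>. pin A p)" by auto
  then show ?case using fincut_Un[OF A(1,2)] pin_Un[OF _ A(1,2)] by auto
qed

lemma VE_compact_cover:
  assumes P: "compactin GT P" "P \<subseteq> VE" and cover: "\<And>p. p \<in> P \<Longrightarrow> \<exists>A\<in>\<A>. fincut A \<and> pin A p"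
  obtains \<F> where "finite \<F>" "\<F> \<subseteq> \<A>" "\<And>A. A \<in> \<F> \<Longrightarrow> fincut A" "\<And>p. p \<in> P \<Longrightarrow> \<exists>A\<in>\<F>. pin A p"
proof -
  define U where "U A = {p \<in> XX \<union> Ends. gval A p < 1/2}" for A
  have pinU: "p \<in> U A \<longleftrightarrow> pin A p" if "p \<in> P" for p A
    using gval_VE[of p A] that P(2) VE_sub unfolding U_def by (auto split: if_splits)
  have "\<And>T. T \<in> U ` {A\<in>\<A>. fincut A} \<Longrightarrow> openin GT T" unfolding U_def using openin_gval_less[of _ "1/2"] by auto
  moreover have "P \<subseteq> \<Union>(U ` {A\<in>\<A>. fincut A})" using cover pinU by blast
  ultimately obtain \<G> where \<G>: "finite \<G>" "\<G> \<subseteq> U ` {A\<in>\<A>. fincut A}" "P \<subseteq> \<Union>\<G>"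
    using compactinD[OF P(1), of "U ` {A\<in>\<A>. fincut A}"] by metis
  from finite_subset_image[OF \<G>(1,2)]
  obtain \<F> where \<F>: "finite \<F>" "\<F> \<subseteq> {A\<in>\<A>. fincut A}" "\<G> = U ` \<F>" by metis
  show ?thesis
  proof (rule that[OF \<F>(1)])
    show "\<exists>A\<in>\<F>. pin A p" if "p \<in> P" for p using \<G>(3) that pinU[OF that] unfolding \<F>(3) by auto
  qed (use \<F>(2) in auto)
qed

text \<open>Within \<open>VE\<close> the condition \<open>pin A\<close> is cut out by the open set
  where \<open>gval A\<close> is below 1/2, and sides admit complements and finite unions. The usual
  double use of compactness, over P for a fixed q and then over Q, works in this algebra of
  sides.\<close>

lemma compact_separation:
  assumes P: "compactin GT P" "P \<subseteq> VE" and Q: "compactin GT Q" "Q \<subseteq> VE"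
    and sep: "\<And>p q. p \<in> P \<Longrightarrow> q \<in> Q \<Longrightarrow> \<exists>A. fincut A \<and> pin A p \<and> \<not> pin A q"
  shows "\<exists>B. fincut B \<and> (\<forall>p\<in>P. pin B p) \<and> (\<forall>q\<in>Q. \<not> pin B q)"
proof -
  have one: "\<exists>B. fincut B \<and> (\<forall>p\<in>P. pin B p) \<and> \<not> pin B q" if q: "q \<in> Q" for q
  proof -
    let ?\<A> = "{A. fincut A \<and> \<not> pin A q}"
    have cover: "\<exists>A\<in>?\<A>. fincut A \<and> pin A p" if "p \<in> P" for p using sep[OF that q] by auto
    obtain \<F> where \<F>: "finite \<F>" "\<F> \<subseteq> ?\<A>" "\<And>A. A \<in> \<F> \<Longrightarrow> fincut A" "\<And>p. p \<in> P \<Longrightarrow> \<exists>A\<in>\<F>. pin A p"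
      using VE_compact_cover[OF P cover] by metis
    have u: "fincut (\<Union>\<F>)" "\<forall>p\<in>VE. pin (\<Union>\<F>) p \<longleftrightarrow> (\<exists>A\<in>\<F>. pin A p)"
      using fincut_Union[OF \<F>(1,3)] by auto
    have "\<forall>p\<in>P. pin (\<Union>\<F>) p" using u(2) \<F>(4) P(2) by blast
    moreover have "\<not> pin (\<Union>\<F>) q" using u(2) \<F>(2) q Q(2) by blast
    ultimately show ?thesis using u(1) by blast
  qed
  define \<B> where "\<B> = {C. fincut C \<and> (\<forall>p\<in>P. \<not> pin C p)}"
  have cover: "\<exists>C\<in>\<B>. fincut C \<and> pin C q" if q: "q \<in> Q" for q
  proof -
    obtain B where B: "fincut B" "\<And>p. p \<in> P \<Longrightarrow> pin B p" "\<not> pin B q" using one[OF q] by blast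
    have "\<not> pin (- B) p" if "p \<in> P" for p using B(2)[OF that] pin_compl[OF _ B(1), of p] that P(2) by blast
    moreover have "pin (- B) q" using B(3) pin_compl[OF _ B(1), of q] q Q(2) by blast
    ultimately show ?thesis using B(1) unfolding \<B>_def by (intro bexI[of _ "- B"]) auto
  qed
  obtain \<F> where \<F>: "finite \<F>" "\<F> \<subseteq> \<B>" "\<And>A. A \<in> \<F> \<Longrightarrow> fincut A" "\<And>q. q \<in> Q \<Longrightarrow> \<exists>A\<in>\<F>. pin A q"
    using VE_compact_cover[OF Q cover] by metis
  have u: "fincut (\<Union>\<F>)" "\<forall>p\<in>VE. pin (\<Union>\<F>) p \<longleftrightarrow> (\<exists>A\<in>\<F>. pin A p)"
    using fincut_Union[OF \<F>(1,3)] by auto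
  have "\<not> pin (\<Union>\<F>) p" if p: "p \<in> P" for p
  proof
    assume "pin (\<Union>\<F>) p"
    then obtain C where "C \<in> \<F>" "pin C p" using u(2) p P(2) by blast
    then show False using \<F>(2) p unfolding \<B>_def by blast
  qed
  then have "pin (- \<Union>\<F>) p" if "p \<in> P" for p using pin_compl[OF _ u(1), of p] that P(2) by blast
  moreover have "\<not> pin (- \<Union>\<F>) q" if q: "q \<in> Q" for q
  proof -
    have "pin (\<Union>\<F>) q" using u(2) \<F>(4)[OF q] q Q(2) by blast
    then show ?thesis using pin_compl[OF _ u(1), of q] q Q(2) by blast
  qed
  ultimately show ?thesis using u(1) by (intro exI[of _ "- \<Union>\<F>"]) simp
qed

text \<open>If a compact set contains an initial piece of an edge, then it also contains, up to
  indistinguishability, the vertex from which that piece starts.\<close>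

lemma edge_limit:
  assumes Y: "compactin GT Y" and B: "fincut B" and pin: "\<And>p. p \<in> Y \<Longrightarrow> p \<in> VE \<Longrightarrow> pin B p"
    and e: "e \<in> E" and d: "0 < d" "d < 1" and sub: "ept e o1 ` {0<..<d} \<subseteq> Y"
  shows "endv e o1 \<in> B"
proof -
  define O1 where "O1 = {p \<in> XX \<union> Ends. gval B p < 1/2}"
  define T where "T r = ept e o1 ` {r<..<1}" for r
  \<comment> \<open>A finite subfamily contains finitely many sets \<open>T s\<close>, so points of
    the piece close enough to its starting vertex can be covered only by \<open>O1\<close>.\<close>
  define \<U> where "\<U> = insert O1 (inner_of ` (E - {e}) \<union> T ` {0<..<1})"
  have T_open: "openin GT (T r)" if "0 < r" for r unfolding T_def by (rule ept_open[OF e]) (use that in auto)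
  have "openin GT U" if "U \<in> \<U>" for U
    using that T_open openin_gval_less[OF B, of "1/2"] GT_open_inner_of unfolding \<U>_def O1_def by auto
  moreover have "Y \<subseteq> \<Union>\<U>"
  proof
    fix p assume p: "p \<in> Y"
    then have "p \<in> XX \<union> Ends" using compactin_subset_topspace[OF Y] by auto
    then show "p \<in> \<Union>\<U>"
    proof (cases rule: GT_cases)
      case 1
      then have "p \<in> O1" unfolding O1_def using gval_VE[OF 1, of B] pin[OF p 1] VE_sub by auto
      then show ?thesis unfolding \<U>_def by blast
    next
      case (2 f t)
      show ?thesis
      proof (cases "f = e")
        case False
        have "p \<in> inner_of f" using 2 unfolding inner_of_def by auto
        then show ?thesis unfolding \<U>_def using 2(2) False by blast
      next
        case True
        have "p \<in> inner_of e" using 2 True unfolding inner_of_def by auto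
        then obtain s where s: "p = ept e o1 s" "0 < s" "s < 1" unfolding ept_inner_of[of e o1] by auto
        then have "p \<in> T (s / 2)" unfolding T_def by auto
        moreover have "s / 2 \<in> {0<..<1}" using s by auto
        ultimately show ?thesis unfolding \<U>_def by blast
      qed
    qed
  qed
  ultimately obtain \<F> where \<F>: "finite \<F>" "\<F> \<subseteq> \<U>" "Y \<subseteq> \<Union>\<F>"
    using compactinD[OF Y, of \<U>] by metis
  have "finite (\<F> \<inter> T ` {0<..<1})" using \<F>(1) by blast
  then obtain R where R: "finite R" "R \<subseteq> {0<..<1}" "\<F> \<inter> T ` {0<..<1} = T ` R"
    using finite_subset_image[of "\<F> \<inter> T ` {0<..<1}" T "{0<..<1}"] by (metis inf_le2)
  have "\<exists>r>0. \<forall>s\<in>R \<union> {d, 1/2}. r < s" by (rule small_for_finite) (use R d in auto)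
  then obtain r where r: "0 < r" "\<forall>s\<in>R. r < s" "r < d" "r < 1/2" by auto
  let ?p = "ept e o1 r"
  have "?p \<in> Y" using sub r by auto
  then obtain U where U: "U \<in> \<F>" "?p \<in> U" using \<F>(3) by blast
  have "U = O1"
  proof (rule ccontr)
    assume "U \<noteq> O1"
    moreover have "U \<in> \<U>" using U(1) \<F>(2) by blast
    ultimately have "U \<in> inner_of ` (E - {e}) \<or> U \<in> T ` {0<..<1}" unfolding \<U>_def by simp
    then show False
    proof
      assume "U \<in> inner_of ` (E - {e})"
      then obtain f where "U = inner_of f" "f \<noteq> e" by auto
      then show False using U(2) unfolding ept_def inner_of_def by auto
    next
      assume "U \<in> T ` {0<..<1}"
      then have "U \<in> T ` R" using U(1) R(3) by auto
      then obtain s where "U = T s" "s \<in> R" by auto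
      then show False using U(2) r(2) ept_inj unfolding T_def by auto
    qed
  qed
  then have g: "gval B ?p < 1/2" using U(2) unfolding O1_def by simp
  show ?thesis
  proof (rule ccontr)
    assume no: "endv e o1 \<notin> B"
    define z where "z = side B (endv e (\<not> o1))"
    have "gval B ?p = (1 - r) + r * z"
      using no unfolding ept_def endv_def z_def by (auto simp: side_def)
    moreover have "0 \<le> r * z" using r(1) unfolding z_def side_def by simp
    ultimately show False using g r(4) by linarith
  qed
qed

text \<open>Deleting the midpoints of e and f leaves two arcs of the circle. The closures of these arcs contain
  disjoint compact sets of vertices and ends, and a finite cut separating the two sets meets the
  circle in e and f alone.\<close>

lemma circle_two_edge_cut:
  assumes X: "is_circle V E inc X" and e: "e \<in> edge_set_of E X" and f: "f \<in> edge_set_of E X" and ef: "e \<noteq> f"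
  shows "\<exists>B. fincut B \<and> delta B \<inter> edge_set_of E X = {e, f}"
proof -
  let ?C = "edge_set_of E X"
  define a where "a = (Inner e (1/2) :: ('v,'e) gpoint)"
  define b where "b = (Inner f (1/2) :: ('v,'e) gpoint)"
  have CE: "g \<in> E" "inner_of g \<subseteq> X" if "g \<in> ?C" for g using that unfolding edge_set_of_def by auto
  have aX: "a \<in> X" and bX: "b \<in> X" using CE(2)[OF e] CE(2)[OF f] unfolding a_def b_def inner_of_def by force+
  have ab: "a \<noteq> b" using ef unfolding a_def b_def by simp
  obtain c d where c: "continuous_map (top_of_set {0..1::real}) GT c" "c 0 = b" "c 1 = b" "c ` {0..1} = X"
    and d: "continuous_map (subtopology GT (X - {b})) euclideanreal d"
    and dc: "\<And>t. 0 < t \<Longrightarrow> t < 1 \<Longrightarrow> c t \<noteq> b \<and> d (c t) = t"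
    and cd: "\<And>p. p \<in> X \<Longrightarrow> p \<noteq> b \<Longrightarrow> 0 < d p \<and> d p < 1 \<and> c (d p) = p"
    using circle_param[OF X bX] by metis
  define m where "m = d a"
  have m: "0 < m" "m < 1" "c m = a" using cd[OF aX ab] unfolding m_def by auto
  define K where "K o1 = c ` (if o1 then {0..m} else {m..1})" for o1 :: bool
  define J where "J o1 = (if o1 then {0<..<m} else {m<..<1})" for o1 :: bool
  have K_compact: "compactin GT (K o1)" for o1
  proof -
    have "compactin (top_of_set {0..1}) (if o1 then {0..m} else {m..1})"
      using m by (auto simp: compactin_subtopology)
    then show ?thesis unfolding K_def by (rule image_compactin[OF _ c(1)])
  qed
  have K_sub: "K o1 \<subseteq> X" for o1 unfolding K_def c(4)[symmetric] using m by (intro image_mono) auto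
  have JK: "c t \<in> K o1" if "t \<in> J o1" for t o1 using that unfolding J_def K_def by (auto split: if_splits)
  have VE_ab: "p \<noteq> a" "p \<noteq> b" if "p \<in> VE" for p
    using VE_not_Inner[OF that, of e "{1/2}"] VE_not_Inner[OF that, of f "{1/2}"] unfolding a_def b_def by auto
  have K_VE: "d p \<in> J o1" if p: "p \<in> K o1" "p \<in> VE" for p o1
  proof -
    obtain t where t: "p = c t" "t \<in> (if o1 then {0..m} else {m..1})" using p(1) unfolding K_def by blast
    have "t \<noteq> 0" "t \<noteq> 1" "t \<noteq> m" using VE_ab[OF p(2)] t(1) c(2,3) m(3) by auto
    then have "0 < t" "t < 1" using t(2) m by (auto split: if_splits)
    then show ?thesis using dc[of t] t \<open>t \<noteq> 0\<close> \<open>t \<noteq> 1\<close> \<open>t \<noteq> m\<close> unfolding J_def by (auto split: if_splits)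
  qed
  have "closedin GT VE"
  proof -
    have "XX \<union> Ends - VE = (\<Union>g\<in>E. inner_of g)"
      unfolding VE_def XG_def inner_points_def inner_of_def Ends_def by auto
    then show ?thesis unfolding closedin_def using GT_open_inner_of VE_sub by auto
  qed
  then have comp: "compactin GT (K o1 \<inter> VE)" for o1
    using K_compact[of o1] by (simp add: compact_Int_closedin)
  have "\<exists>B. fincut B \<and> (\<forall>p\<in>K True \<inter> VE. pin B p) \<and> (\<forall>q\<in>K False \<inter> VE. \<not> pin B q)"
  proof (rule compact_separation[OF comp _ comp])
    fix p q assume p: "p \<in> K True \<inter> VE" and q: "q \<in> K False \<inter> VE"
    have "p \<noteq> q" using K_VE[of p True] K_VE[of q False] p q unfolding J_def by auto
    then show "\<exists>A. fincut A \<and> pin A p \<and> \<not> pin A q"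
      using circle_points_separated[OF X] p q K_sub by blast
  qed auto
  then obtain B where B: "fincut B" "\<And>p. p \<in> K True \<Longrightarrow> p \<in> VE \<Longrightarrow> pin B p" "\<And>q. q \<in> K False \<Longrightarrow> q \<in> VE \<Longrightarrow> \<not> pin B q"
    by blast
  \<comment> \<open>The arc that contains an initial piece of an edge decides the side of the vertex
    where that piece starts.\<close>
  have limit: "endv g o2 \<in> B \<longleftrightarrow> o1" if g: "g \<in> E" "0 < r" "r < 1" "ept g o2 ` {0<..<r} \<subseteq> K o1" for g o1 o2 r
  proof (cases o1)
    case True
    then show ?thesis using edge_limit[OF K_compact[of True] B(1) B(2) g(1-3), of o2] g(4) by simp
  next
    case False
    have "endv g o2 \<in> - B"
    proof (rule edge_limit[OF K_compact[of False] _ _ g(1-3)])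
      show "fincut (- B)" using B(1) by simp
      show "pin (- B) p" if "p \<in> K False" "p \<in> VE" for p using B(3)[OF that] pin_compl[OF that(2) B(1)] by simp
      show "ept g o2 ` {0<..<r} \<subseteq> K False" using g(4) False by simp
    qed
    then show ?thesis using False by simp
  qed
  \<comment> \<open>The image of S under d is an interval that misses m, hence lies on one side of
    m.\<close>
  have arc: "\<exists>o1. \<forall>p\<in>S. d p \<in> J o1 \<and> p \<in> K o1" if S: "connectedin GT S" "S \<subseteq> X" "a \<notin> S" "b \<notin> S" for S
  proof -
    have "connectedin (subtopology GT (X - {b})) S" using S by (auto simp: connectedin_subtopology)
    then have conn: "connected (d ` S)" using connectedin_continuous_map_image[OF d] by (simp add: connectedin_subtopology)
    have ne: "d p \<noteq> m" "0 < d p" "d p < 1" "c (d p) = p" if "p \<in> S" for p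
    proof -
      have "p \<in> X" "p \<noteq> b" "p \<noteq> a" using that S by auto
      then show "0 < d p" "d p < 1" "c (d p) = p" using cd by auto
      then show "d p \<noteq> m" using m(3) \<open>p \<noteq> a\<close> by auto
    qed
    have "m \<notin> d ` S" using ne(1) by blast
    then have "(\<forall>p\<in>S. d p < m) \<or> (\<forall>p\<in>S. m < d p)"
      using connectedD_interval[OF conn] ne(1) by (metis image_eqI less_eq_real_def linorder_neqE_linordered_idom)
    then obtain o1 where o1: "\<forall>p\<in>S. d p \<in> J o1"
    proof
      assume "\<forall>p\<in>S. d p < m"
      then show thesis using that[of True] ne unfolding J_def by auto
    next
      assume "\<forall>p\<in>S. m < d p"
      then show thesis using that[of False] ne unfolding J_def by auto
    qed
    have "p \<in> K o1" if "p \<in> S" for p using JK[of "d p" o1] o1 that ne(4)[OF that] by auto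
    then show ?thesis using o1 by blast
  qed
  have other: "g \<notin> delta B" if g: "g \<in> ?C" "g \<noteq> e" "g \<noteq> f" for g
  proof -
    have gE: "g \<in> E" using CE(1)[OF g(1)] .
    have "connectedin GT (inner_of g)" unfolding inner_of_eq by (rule connectedin_segment[OF gE]) auto
    moreover have "a \<notin> inner_of g" "b \<notin> inner_of g" using g unfolding a_def b_def inner_of_def by auto
    ultimately obtain o1 where o1: "\<forall>p\<in>inner_of g. d p \<in> J o1 \<and> p \<in> K o1" using arc CE(2)[OF g(1)] by blast
    have sub: "ept g o2 ` {0<..<1/2} \<subseteq> K o1" for o2
    proof -
      have "ept g o2 ` {0<..<1/2} \<subseteq> inner_of g" unfolding ept_inner_of[of g o2] by auto
      then show ?thesis using o1 by blast
    qed
    have "endv g o2 \<in> B \<longleftrightarrow> o1" for o2 by (rule limit[OF gE _ _ sub]) auto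
    then have "endv g True \<in> B \<longleftrightarrow> endv g False \<in> B" by simp
    then show ?thesis using in_delta[OF gE] unfolding endv_def by simp
  qed
  \<comment> \<open>Each half of g stays in one arc, while by \<open>near\<close> the edge g runs
    into both. So the halves lie in different arcs and the ends of g on different sides of
    B.\<close>
  have crossing: "g \<in> delta B" if g: "g \<in> ?C" "Inner g (1/2) = a \<or> Inner g (1/2) = b"
      and near: "\<And>o1. \<exists>t\<in>J o1. c t \<in> inner_of g" for g
  proof -
    have gE: "g \<in> E" using CE(1)[OF g(1)] .
    have half: "\<exists>o1. \<forall>p\<in>ept g o2 ` {0<..<1/2}. d p \<in> J o1 \<and> p \<in> K o1" for o2
    proof (rule arc)
      show "connectedin GT (ept g o2 ` {0<..<1/2})"
        unfolding ept_image by (rule connectedin_segment[OF gE]) auto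
      have "ept g o2 ` {0<..<1/2} \<subseteq> inner_of g" unfolding ept_inner_of[of g o2] by auto
      then show "ept g o2 ` {0<..<1/2} \<subseteq> X" using CE(2)[OF g(1)] by blast
      show "a \<notin> ept g o2 ` {0<..<1/2}" "b \<notin> ept g o2 ` {0<..<1/2}"
        unfolding a_def b_def ept_def by (auto split: if_splits)
    qed
    obtain u where u: "\<And>o2. \<forall>p\<in>ept g o2 ` {0<..<1/2}. d p \<in> J (u o2) \<and> p \<in> K (u o2)" using half by metis
    have "u True \<noteq> u False"
    proof
      assume eq: "u True = u False"
      obtain t where t: "t \<in> J (\<not> u True)" "c t \<in> inner_of g" using near by blast
      have t01: "0 < t" "t < 1" "t \<noteq> m" using t(1) m unfolding J_def by (auto split: if_splits)
      have ct: "c t \<noteq> b" "d (c t) = t" using dc[OF t01(1,2)] by auto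
      have "c t \<noteq> a" using ct(2) t01(3) unfolding m_def by auto
      obtain s where s: "c t = Inner g s" "0 < s" "s < 1" using t(2) unfolding inner_of_def by auto
      then have "s \<noteq> 1/2" using g(2) ct(1) \<open>c t \<noteq> a\<close> by auto
      then have "c t \<in> ept g True ` {0<..<1/2} \<or> c t \<in> ept g False ` {0<..<1/2}"
        unfolding ept_image using s by (cases "s < 1/2") auto
      then have "d (c t) \<in> J (u True)" using u[of True] u[of False] eq by auto
      then show False using t(1) ct(2) unfolding J_def by (auto split: if_splits)
    qed
    moreover have "endv g o2 \<in> B \<longleftrightarrow> u o2" for o2
      by (rule limit[OF gE, of "1/2"]) (use u in auto)
    ultimately have "(endv g True \<in> B) \<noteq> (endv g False \<in> B)" by simp
    then show ?thesis using in_delta[OF gE] unfolding endv_def by simp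
  qed
  have near: "\<exists>r>0. \<forall>t\<in>{0..1}. \<bar>t - s\<bar> < r \<longrightarrow> c t \<in> inner_of g" if "g \<in> ?C" "s \<in> {0..1}" "c s \<in> inner_of g" for g s
  proof -
    have "openin (top_of_set {0..1}) {t \<in> topspace (top_of_set {0..1}). c t \<in> inner_of g}"
      by (rule openin_continuous_map_preimage[OF c(1) GT_open_inner_of[OF CE(1)[OF that(1)]]])
    moreover have "s \<in> {t \<in> topspace (top_of_set {0..1}). c t \<in> inner_of g}" using that by simp
    ultimately obtain r where r: "r > 0" "ball s r \<inter> {0..1} \<subseteq> {t \<in> topspace (top_of_set {0..1}). c t \<in> inner_of g}"
      unfolding openin_contains_ball by blast
    have "c t \<in> inner_of g" if "t \<in> {0..1}" "\<bar>t - s\<bar> < r" for t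
    proof -
      have "t \<in> ball s r" unfolding mem_ball dist_real_def using that(2) by linarith
      then show ?thesis using r(2) that(1) by blast
    qed
    then show ?thesis using r(1) by blast
  qed
  have "e \<in> delta B"
  proof (rule crossing[OF e])
    have "0 < (1/2::real)" "(1/2::real) < 1" by simp_all
    then have "c m \<in> inner_of e" unfolding m(3) a_def inner_of_def by blast
    then obtain r where r: "r > 0" "\<forall>t\<in>{0..1}. \<bar>t - m\<bar> < r \<longrightarrow> c t \<in> inner_of e" using near[OF e, of m] m by auto
    fix o1
    define v where "v = 1 - m"
    define h where "h = min (r / 2) (min (m / 2) (v / 2))"
    have "0 < v" using m unfolding v_def by simp
    then have "0 < h" "h < r" "h < m" "h < v" using r(1) m(1) unfolding h_def by (auto simp: min_less_iff_disj)
    then have h: "0 < h" "h < r" "h < m" "m + h < 1" unfolding v_def by auto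
    show "\<exists>t\<in>J o1. c t \<in> inner_of e"
      by (rule bexI[of _ "if o1 then m - h else m + h"]) (use r(2) h in \<open>auto simp: J_def\<close>)
  qed (simp add: a_def)
  moreover have "f \<in> delta B"
  proof (rule crossing[OF f])
    have "0 < (1/2::real)" "(1/2::real) < 1" by simp_all
    \<comment> \<open>The point b has the two parameters 0 and 1, each bounding one of the arcs, so
      both ends of the parameter interval have to be examined.\<close>
    then have fb: "c 0 \<in> inner_of f" "c 1 \<in> inner_of f" unfolding c(2,3) b_def inner_of_def by blast+
    obtain r0 where r0: "r0 > 0" "\<forall>t\<in>{0..1}. \<bar>t - 0\<bar> < r0 \<longrightarrow> c t \<in> inner_of f" using near[OF f, of 0] fb by auto
    obtain r1 where r1: "r1 > 0" "\<forall>t\<in>{0..1}. \<bar>t - 1\<bar> < r1 \<longrightarrow> c t \<in> inner_of f" using near[OF f, of 1] fb by auto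
    fix o1
    define v where "v = 1 - m"
    define h where "h = min (min (r0 / 2) (r1 / 2)) (min (m / 2) (v / 2))"
    have "0 < v" using m unfolding v_def by simp
    then have "0 < h" "h < r0" "h < r1" "h < m" "h < v"
      using r0(1) r1(1) m(1) unfolding h_def by (auto simp: min_less_iff_disj)
    then have h: "0 < h" "h < r0" "h < r1" "h < m" "m + h < 1" unfolding v_def by auto
    show "\<exists>t\<in>J o1. c t \<in> inner_of f"
      by (rule bexI[of _ "if o1 then h else 1 - h"]) (use r0(2) r1(2) h m in \<open>auto simp: J_def\<close>)
  qed (simp add: b_def)
  ultimately have "delta B \<inter> ?C = {e, f}" using other e f by auto
  then show ?thesis using B(1) by blast
qed

theorem circle_is_circuit:
  assumes X: "is_circle V E inc X" shows "edge_set_of E X \<in> circuits E fbs.coindep"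
  unfolding cocircuit_iff
proof (intro conjI ballI allI impI)
  show "edge_set_of E X \<subseteq> E" unfolding edge_set_of_def by blast
qed (rule circle_has_edge[OF X], erule circle_crossing[OF X], rule circle_two_edge_cut[OF X])

end

section \<open>Topological spanning trees\<close>

context conn_graph
begin

text \<open>The interior of an edge is open, so taking the closure adds no inner point of an edge
  outside E'.\<close>

lemma edge_set_standard:
  assumes E': "E' \<subseteq> E"
  shows "edge_set_of E (GT closure_of (Vx ` V' \<union> \<Union>(inner_of ` E'))) = E'"
    and "Inner e t \<in> GT closure_of (Vx ` V' \<union> \<Union>(inner_of ` E')) \<Longrightarrow> e \<in> E \<Longrightarrow> 0 < t \<Longrightarrow> t < 1 \<Longrightarrow> e \<in> E'"
proof -
  let ?B = "Vx ` V' \<union> \<Union>(inner_of ` E') :: ('v,'e) gpoint set"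
  have *: "e \<in> E'" if e: "e \<in> E" "0 < t" "t < 1" "Inner e t \<in> GT closure_of ?B" for e t
  proof -
    have "Inner e t \<in> (inner_of e :: ('v,'e) gpoint set)" using e unfolding inner_of_eq by auto
    moreover have "\<forall>T. Inner e t \<in> T \<and> openin GT T \<longrightarrow> (\<exists>y\<in>?B. y \<in> T)"
      using e(4) unfolding in_closure_of by meson
    ultimately have "\<exists>y\<in>?B. y \<in> (inner_of e :: ('v,'e) gpoint set)" using GT_open_inner_of[OF e(1)] by blast
    then show "e \<in> E'" unfolding inner_of_eq by auto
  qed
  show "Inner e t \<in> GT closure_of ?B \<Longrightarrow> e \<in> E \<Longrightarrow> 0 < t \<Longrightarrow> t < 1 \<Longrightarrow> e \<in> E'" using * by blast
  show "edge_set_of E (GT closure_of ?B) = E'"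
  proof
    show "edge_set_of E (GT closure_of ?B) \<subseteq> E'"
    proof
      fix e assume e: "e \<in> edge_set_of E (GT closure_of ?B)"
      have "Inner e (1/2) \<in> (inner_of e :: ('v,'e) gpoint set)" unfolding inner_of_eq by auto
      then have "Inner e (1/2) \<in> GT closure_of ?B" using e unfolding edge_set_of_def by auto
      then show "e \<in> E'" using e by (intro *[of e "1/2"]) (auto simp: edge_set_of_def)
    qed
    show "E' \<subseteq> edge_set_of E (GT closure_of ?B)"
    proof
      fix e assume e: "e \<in> E'"
      have "inner_of e \<subseteq> GT closure_of (inner_of e)"
        using openin_subset[OF GT_open_inner_of] e E' by (intro closure_of_subset) auto
      also have "\<dots> \<subseteq> GT closure_of ?B" using e by (intro closure_of_mono) auto
      finally show "e \<in> edge_set_of E (GT closure_of ?B)" using e E' unfolding edge_set_of_def by auto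
    qed
  qed
qed

text \<open>Every neighbourhood of an end contains vertices, so a closed set containing V contains
  all ends as well, and only the choice of the edges remains free.\<close>

lemma standard_spanning:
  assumes S: "standard_subspace V E inc S" and V: "Vx ` V \<subseteq> S"
  shows "S = VE \<union> (\<Union>e\<in>edge_set_of E S. inner_of e)"
proof -
  obtain V' E' where E': "E' \<subseteq> E" and S_eq: "S = GT closure_of (Vx ` V' \<union> \<Union>(inner_of ` E'))"
    using S unfolding standard_subspace_def by metis
  note std = edge_set_standard[OF E', where V' = V', folded S_eq]
  have clS: "closedin GT S" unfolding S_eq by (rule closedin_closure_of)
  have "p \<in> S" if p: "p \<in> VE" for p
  proof (rule ccontr)
    assume "p \<notin> S"
    then have "openin GT (topspace GT - S)" "p \<in> topspace GT - S" using subsetD[OF VE_sub p] clS by (blast intro: openin_diff openin_topspace, auto)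
    from nbhd_VE[OF this p] obtain A F r where Ar: "0 < r" "pin A p"
      and U: "\<forall>q\<in>XX \<union> Ends. gval A q < r \<longrightarrow> (\<forall>e\<in>F. q \<notin> Inner e ` {r..1 - r}) \<longrightarrow> q \<in> topspace GT - S"
      by metis
    have nb: "Vx v \<in> topspace GT - S" if "v \<in> V" "v \<in> A" for v
    proof -
      have "Vx v \<in> XX" "gval A (Vx v) < r" "\<forall>e\<in>F. Vx v \<notin> Inner e ` {r..1 - r}"
        using that Ar(1) by (auto simp: XG_def side_def)
      then show ?thesis using U by (meson UnI1)
    qed
    show False using p
    proof (cases rule: VE_cases)
      case (1 v) then show False using \<open>p \<notin> S\<close> V by auto
    next
      case (2 \<omega> R)
      then obtain R' where R': "R' \<in> \<omega>" "tail_in A R'" using Ar by auto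
      then obtain k where "fst R' k \<in> A" unfolding tail_in_def by blast
      moreover have "fst R' k \<in> V" using end_ray_ray[OF 2(2) R'(1)] unfolding is_ray_def by auto
      ultimately show False using nb V by blast
    qed
  qed
  moreover have "S \<subseteq> VE \<union> (\<Union>e\<in>E'. inner_of e)"
  proof
    fix q assume q: "q \<in> S"
    then have "q \<in> XX \<union> Ends" using closedin_subset[OF clS] by auto
    then show "q \<in> VE \<union> (\<Union>e\<in>E'. inner_of e)"
    proof (cases rule: GT_cases)
      case (2 e t)
      then have "e \<in> E'" using q std(2) by metis
      then show ?thesis using 2 unfolding inner_of_def by auto
    qed simp
  qed
  moreover have "(\<Union>e\<in>E'. inner_of e) \<subseteq> S" using std(1) unfolding edge_set_of_def by blast
  ultimately show ?thesis unfolding std(1) by blast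
qed

text \<open>If no edge of T were in the cut, its function would avoid 1/2 on the connected set T,
  yet take the values 0 and 1 at vertices.\<close>

lemma tree_meets_cuts:
  assumes T: "top_spanning_tree V E inc T" and A: "fincut A" "delta A \<noteq> {}"
  shows "delta A \<inter> edge_set_of E T \<noteq> {}"
proof
  assume none: "delta A \<inter> edge_set_of E T = {}"
  have conn: "connectedin GT T" and VT: "Vx ` V \<subseteq> T"
    using T path_connectedin_imp_connectedin unfolding top_spanning_tree_def by blast+
  have T_eq: "T = VE \<union> (\<Union>e\<in>edge_set_of E T. inner_of e)"
    using T standard_spanning unfolding top_spanning_tree_def by blast
  have no: "gval A p \<noteq> 1/2" if p: "p \<in> T" for p
  proof -
    have "p \<in> VE \<union> (\<Union>e\<in>edge_set_of E T. inner_of e)" using p T_eq by (rule subst[rotated])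
    then have p': "p \<in> VE \<or> (\<exists>e\<in>edge_set_of E T. p \<in> inner_of e)" by blast
    consider "p \<in> VE" | e t where "e \<in> E" "e \<notin> delta A" "p = Inner e t"
    proof -
      from p' consider "p \<in> VE" | e where "e \<in> edge_set_of E T" "p \<in> inner_of e" by blast
      then show ?thesis
      proof cases
        case 2
        then have "e \<in> E" "e \<notin> delta A" using none unfolding edge_set_of_def by auto
        then show ?thesis using 2(2) that(2) unfolding inner_of_def by auto
      qed (rule that(1))
    qed
    then show ?thesis
    proof cases
      case 1 then show ?thesis by (simp add: gval_VE)
    next
      case 2 then show ?thesis using gval_noncrossing[OF 2(1,2), of t] by (simp add: side_def)
    qed
  qed
  obtain e where e: "e \<in> delta A" using A(2) by auto
  then have e: "e \<in> E" "e \<in> delta A" unfolding cutset_def by auto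
  define u where "u = (if fst (inc e) \<in> A then fst (inc e) else snd (inc e))"
  define w where "w = (if fst (inc e) \<in> A then snd (inc e) else fst (inc e))"
  have uw: "u \<in> V" "w \<in> V" "u \<in> A" "w \<notin> A"
    using in_delta[OF e(1), of A] e ends_in_V[OF e(1)] unfolding u_def w_def by auto
  have "gval A (Vx w) < 1/2"
    by (rule connected_one_side[OF conn A(1) _ _ no, of "Vx u"]) (use uw VT in \<open>auto simp: side_def\<close>)
  then show False using uw(4) by (simp add: side_def)
qed

text \<open>The edge set meets every nonempty finite cut, so its complement is independent in the
  finite-bond matroid and extends to a base B. Thus E - B is a base of the dual inside the edge set.
  The edge set is itself independent in the dual, because a circuit in it would give a circle in T,
  so the two coincide.\<close>

lemma tree_is_base:
  assumes T: "top_spanning_tree V E inc T" shows "edge_set_of E T \<in> bases fbs.coindep"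
proof -
  let ?E' = "edge_set_of E T"
  have sub: "?E' \<subseteq> E" unfolding edge_set_of_def by blast
  have T_eq: "T = VE \<union> (\<Union>e\<in>?E'. inner_of e)"
    using T standard_spanning unfolding top_spanning_tree_def by blast
  have "D = {}" if D: "D \<in> fincuts" "D \<subseteq> E - ?E'" for D
  proof -
    obtain A where A: "D = delta A" "fincut A" using D(1) unfolding fincuts_def by auto
    have "D \<inter> ?E' = {}" using D(2) by blast
    then show ?thesis using tree_meets_cuts[OF T A(2)] A(1) by metis
  qed
  then have "E - ?E' \<in> fbs.indep" unfolding fbs.indep_def by simp
  then obtain B where B0: "maximal_in {J'\<in>fbs.indep. E - ?E' \<subseteq> J' \<and> J' \<subseteq> E} B"
    using fbs.indep_extend[of "E - ?E'" E] by blast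
  have B: "maximal_in fbs.indep B" "E - ?E' \<subseteq> B"
  proof -
    from maximal_in_mem[OF B0] have B1: "B \<in> fbs.indep" "E - ?E' \<subseteq> B" by auto
    have "J = B" if J: "J \<in> fbs.indep" "B \<subseteq> J" for J
    proof (rule maximal_in_eq[OF B0 _ J(2)])
      have "J \<subseteq> E" using J(1) unfolding fbs.indep_def by auto
      then show "J \<in> {J'\<in>fbs.indep. E - ?E' \<subseteq> J' \<and> J' \<subseteq> E}"
        using J order_trans[OF B1(2) J(2)] by simp
    qed
    then show "maximal_in fbs.indep B" "E - ?E' \<subseteq> B" unfolding maximal_in_def using B1 by auto
  qed
  have co: "?E' \<in> fbs.coindep"
  proof (rule ccontr)
    assume "?E' \<notin> fbs.coindep"
    then obtain C where C: "C \<in> circuits E fbs.coindep" "C \<subseteq> ?E'"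
      using fbs.codependent_contains_cocircuit[OF sub] by metis
    obtain X where "is_circle V E inc X" "X \<subseteq> VE \<union> (\<Union>e\<in>C. inner_of e)"
      using circuit_is_circle[OF C(1)] by blast
    moreover from this(2) have "X \<subseteq> T" using C(2) T_eq by blast
    ultimately show False using T unfolding top_spanning_tree_def by blast
  qed
  have max: "maximal_in fbs.coindep (E - B)" using B(1) fbs.cobase_iff by blast
  have "E - B \<subseteq> ?E'" using B(2) by blast
  then have "?E' = E - B" using maximal_in_eq[OF max co] by blast
  then show ?thesis using max unfolding bases_def by simp
qed

lemma path_component_ofI:
  assumes g: "continuous_map (top_of_set {0..w}) GT g" and w: "(0::real) \<le> w"
    and S: "\<And>t. t \<in> {0..w} \<Longrightarrow> g t \<in> S"
  shows "path_component_of (subtopology GT S) (g 0) (g w)"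
proof -
  have "continuous_map (top_of_set {0..1}) (top_of_set {0..w}) (\<lambda>t. t * w)"
    using w by (auto intro!: continuous_intros simp: mult_left_le_one_le)
  from continuous_map_compose[OF this g]
  have "continuous_map (top_of_set {0..1}) GT (\<lambda>t. g (t * w))" by (simp add: o_def)
  moreover have "g (t * w) \<in> S" if "t \<in> {0..1}" for t
    using that w by (intro S) (auto simp: mult_left_le_one_le)
  ultimately have "pathin (subtopology GT S) (\<lambda>t. g (t * w))"
    unfolding pathin_def by (auto simp: continuous_map_in_subtopology)
  then show ?thesis unfolding path_component_of_def by (intro exI[of _ "\<lambda>t. g (t * w)"]) simp
qed

text \<open>Jumping from p to q right after time 0 is continuous, because no open set tells the two
  points apart.\<close>

lemma indistinguishable_path_component:
  assumes p: "p \<in> VE" "q \<in> VE" and S: "p \<in> S" "q \<in> S"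
    and eq: "\<And>A. fincut A \<Longrightarrow> pin A p \<longleftrightarrow> pin A q"
  shows "path_component_of (subtopology GT S) p q"
proof -
  let ?g = "\<lambda>t::real. if t = 0 then p else q"
  have "continuous_map (top_of_set {0..1}) GT ?g"
  proof (rule continuous_map_into_GT)
    show "?g \<in> topspace (top_of_set {0..1}) \<rightarrow> XX \<union> Ends" using subsetD[OF VE_sub p(1)] subsetD[OF VE_sub p(2)] by auto
    fix A assume "fincut A"
    then have "gval A (?g t) = gval A p" for t using eq p by (simp add: gval_VE)
    then show "continuous_map (top_of_set {0..1}) euclideanreal (\<lambda>t. gval A (?g t))" by simp
  next
    fix e :: 'e and a b :: real assume "0 < a" "a < b" "b < 1"
    have "?g t \<notin> Inner e ` I" for t I using VE_not_Inner p by auto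
    then have *: "{t \<in> topspace (top_of_set {0..1}). ?g t \<in> Inner e ` {a<..<b}} = {}"
      "{t \<in> topspace (top_of_set {0..1}). ?g t \<notin> Inner e ` {a..b}} = topspace (top_of_set {0..1})" by auto
    show "openin (top_of_set {0..1}) {t \<in> topspace (top_of_set {0..1}). ?g t \<in> Inner e ` {a<..<b}}"
      unfolding *(1) by (rule openin_empty)
    show "openin (top_of_set {0..1}) {t \<in> topspace (top_of_set {0..1}). ?g t \<notin> Inner e ` {a..b}}"
      unfolding *(2) by (rule openin_topspace)
  qed
  from path_component_ofI[OF this, of S] S show ?thesis by simp
qed

text \<open>Meeting every separating cut survives intersections of chains since the cuts are finite,
  so Y0 has a minimal subset with this property. Removing e from it exposes a cut that meets it in e
  alone.\<close>

lemma link_exists: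
  assumes Y0: "Y0 \<subseteq> E" and meets: "\<And>A. fincut A \<Longrightarrow> delta A \<noteq> {} \<Longrightarrow> delta A \<inter> Y0 \<noteq> {}"
    and xy: "x \<in> VE" "y \<in> VE"
  shows "\<exists>M\<subseteq>Y0. link M x y"
proof -
  define P where "P Y \<longleftrightarrow> (\<forall>A. separates A x y \<longrightarrow> delta A \<inter> Y \<noteq> {})" for Y
  \<comment> \<open>A side with empty cut contains all vertices or none, hence also all ends or
    none, and separates nothing.\<close>
  have "delta A \<noteq> {}" if A: "separates A x y" for A
  proof
    assume e: "delta A = {}"
    have "V \<subseteq> A \<or> V \<inter> A = {}" using delta_nonempty e by blast
    then show False
    proof
      assume "V \<subseteq> A"
      then have t: "tail_in A R" if "ray R" for R using that unfolding tail_in_def is_ray_def by auto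
      have "pin A y" by (cases rule: VE_cases[OF xy(2)]) (use \<open>V \<subseteq> A\<close> t in auto)
      then show False using A unfolding separates_def by simp
    next
      assume "V \<inter> A = {}"
      then have t: "\<not> tail_in A R" if "ray R" for R using that unfolding tail_in_def is_ray_def by blast
      have "\<not> pin A x" by (cases rule: VE_cases[OF xy(1)]) (use \<open>V \<inter> A = {}\<close> t end_ray_ray in auto)
      then show False using A unfolding separates_def by simp
    qed
  qed
  then have P0: "P Y0" using meets unfolding P_def separates_def by simp
  have "\<exists>M. P M \<and> M \<subseteq> Y0 \<and> (\<forall>Y. P Y \<longrightarrow> Y \<subseteq> M \<longrightarrow> Y = M)"
  proof (rule Zorn_minimal_of_finite_tests[of P, OF P0])
    fix \<C> :: "'e set set"
    assume ne: "\<C> \<noteq> {}" and mem: "\<And>Y. Y \<in> \<C> \<Longrightarrow> P Y \<and> Y \<subseteq> Y0"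
      and ch: "\<And>Y Z. Y \<in> \<C> \<Longrightarrow> Z \<in> \<C> \<Longrightarrow> Y \<subseteq> Z \<or> Z \<subseteq> Y"
    show "P (\<Inter>\<C>)" unfolding P_def
    proof (intro allI impI)
      fix A assume A: "separates A x y"
      then have "finite (delta A)" unfolding separates_def fincut_def by simp
      from chain_Inter_finite_test[OF this ne ch]
      obtain Y where "Y \<in> \<C>" "delta A \<inter> Y = delta A \<inter> \<Inter>\<C>" by metis
      then show "delta A \<inter> \<Inter>\<C> \<noteq> {}" using mem A unfolding P_def by metis
    qed
  qed
  then obtain M where M: "P M" "M \<subseteq> Y0" and min: "\<And>Y. P Y \<Longrightarrow> Y \<subseteq> M \<Longrightarrow> Y = M" by metis
  have "\<exists>A. separates A x y \<and> delta A \<inter> M = {e}" if e: "e \<in> M" for e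
  proof -
    have "\<not> P (M - {e})" using min[of "M - {e}"] e by blast
    then obtain A where A: "separates A x y" "delta A \<inter> (M - {e}) = {}" unfolding P_def by blast
    then have "delta A \<inter> M \<noteq> {}" using M(1) unfolding P_def by blast
    then have "delta A \<inter> M = {e}" using A(2) by auto
    then show ?thesis using A(1) by blast
  qed
  then have "link M x y" unfolding link_def using M Y0 xy unfolding P_def by auto
  then show ?thesis using M(2) by blast
qed

text \<open>An empty link means that no finite cut separates x from y; then the jump between
  indistinguishable points is the path.\<close>

lemma link_path_component:
  assumes L: "link M x y" and S: "VE \<union> (\<Union>e\<in>M. inner_of e) \<subseteq> S"
  shows "path_component_of (subtopology GT S) x y"
proof (cases "M = {}")
  case True
  have xy: "x \<in> VE" "y \<in> VE" using L unfolding link_def by auto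
  have ns: "\<not> separates A x y" for A using L unfolding link_def True by auto
  have "pin A x \<longleftrightarrow> pin A y" if A: "fincut A" for A
    using ns[of A] ns[of "- A"] A xy unfolding separates_def by (auto simp: pin_compl)
  then show ?thesis using xy S by (intro indistinguishable_path_component) auto
next
  case False
  obtain w g where g: "arc_map M x y w g" using link_arc_map[OF L] by blast
  have "path_component_of (subtopology GT S) (g 0) (g w)"
  proof (rule path_component_ofI)
    have "\<forall>t. g t \<in> VE \<union> (\<Union>e\<in>M. inner_of e)" using g unfolding arc_map_def by blast
    then show "g t \<in> S" for t using S by blast
  qed (use g in \<open>auto simp: arc_map_def\<close>)
  then show ?thesis using g False unfolding arc_map_def by simp
qed

lemma inner_path_component:
  assumes e: "e \<in> E" and S: "VE \<union> inner_of e \<subseteq> S" and t: "0 < t" "t < 1"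
  shows "path_component_of (subtopology GT S) (Vx (fst (inc e))) (Inner e t)"
proof -
  let ?u = "Vx (fst (inc e)) :: ('v,'e) gpoint" and ?w = "Vx (snd (inc e)) :: ('v,'e) gpoint"
  have uw: "?u \<in> VE" "?w \<in> VE" using ends_in_V[OF e] unfolding VE_def by auto
  have "continuous_map (top_of_set {0..1}) GT (edge_arc ?u ?w e)"
    by (rule continuous_edge_arc[OF e uw]) auto
  then have "continuous_map (top_of_set {0..t}) GT (edge_arc ?u ?w e)"
    by (rule continuous_map_from_subtopology_mono) (use t in auto)
  moreover have "edge_arc ?u ?w e s \<in> S" for s
    using S uw unfolding edge_arc_def inner_of_eq by auto
  ultimately have "path_component_of (subtopology GT S) (edge_arc ?u ?w e 0) (edge_arc ?u ?w e t)"
    using t by (intro path_component_ofI) auto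
  then show ?thesis using t unfolding edge_arc_def by simp
qed

text \<open>Links inside the base join the points of \<open>VE\<close>, and an inner point is joined
  to an end of its edge. A circle in T would have its edge set, which is a circuit, inside the
  base.\<close>

lemma base_is_tree:
  assumes B: "B \<in> bases fbs.coindep"
  shows "\<exists>T. top_spanning_tree V E inc T \<and> edge_set_of E T = B"
proof -
  obtain B' where B': "maximal_in fbs.indep B'" "B = E - B'"
    using B fbs.cobase_iff unfolding bases_def by auto
  have BE: "B \<subseteq> E" and Bco: "B \<in> fbs.coindep" using B' B unfolding bases_def maximal_in_def by auto
  have meets: "delta A \<inter> B \<noteq> {}" if A: "fincut A" "delta A \<noteq> {}" for A
  proof
    assume "delta A \<inter> B = {}"
    then have "delta A \<subseteq> B'" unfolding B'(2) cutset_def by blast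
    moreover have "B' \<in> fbs.indep" using B'(1) by (rule maximal_in_mem)
    moreover have "delta A \<in> fincuts" using A(1) unfolding fincuts_def by auto
    ultimately show False using A(2) unfolding fbs.indep_def by blast
  qed
  define T where "T = GT closure_of (Vx ` V \<union> \<Union>(inner_of ` B))"
  have std: "standard_subspace V E inc T" unfolding standard_subspace_def
  proof (intro exI conjI)
    show "\<forall>e\<in>B. ends_of inc e \<subseteq> V" using BE ends_in_V unfolding ends_of_def by auto
  qed (use BE T_def in auto)
  have ET: "edge_set_of E T = B" unfolding T_def by (rule edge_set_standard(1)[OF BE])
  have "Vx ` V \<subseteq> GT closure_of (Vx ` V)" by (rule closure_of_subset) (auto simp: XG_def)
  also have "\<dots> \<subseteq> T" unfolding T_def by (rule closure_of_mono) auto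
  finally have VT: "Vx ` V \<subseteq> T" .
  have T_eq: "T = VE \<union> (\<Union>e\<in>B. inner_of e)" using standard_spanning[OF std VT] unfolding ET .
  have sub: "T \<subseteq> topspace GT" unfolding T_def by (rule closure_of_subset_topspace)
  have "X \<subseteq> T \<Longrightarrow> \<not> is_circle V E inc X" for X
  proof
    assume X: "X \<subseteq> T" "is_circle V E inc X"
    have "edge_set_of E X \<subseteq> B" using X(1) unfolding ET[symmetric] edge_set_of_def by blast
    then have "edge_set_of E X \<in> fbs.coindep" using Bco by (rule fbs.coindep_sub[rotated])
    then show False using circle_is_circuit[OF X(2)] unfolding circuits_def by blast
  qed
  moreover have "path_connectedin GT T"
  proof -
    let ?c = "path_component_of (subtopology GT T)"
    have VE_c: "?c x y" if xy: "x \<in> VE" "y \<in> VE" for x y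
    proof -
      obtain M where "M \<subseteq> B" "link M x y" using link_exists[OF BE meets xy] by auto
      then show ?thesis using T_eq by (intro link_path_component[of M]) auto
    qed
    have to_VE: "\<exists>v\<in>VE. ?c v p" if p: "p \<in> T" for p
    proof -
      consider "p \<in> VE" | e t where "e \<in> B" "0 < t" "t < 1" "p = Inner e t"
        using p T_eq unfolding inner_of_eq by auto
      then show ?thesis
      proof cases
        case 1 then show ?thesis using VE_c by blast
      next
        case 2
        have "?c (Vx (fst (inc e))) p" unfolding 2(4)
          by (rule inner_path_component) (use 2 BE T_eq in auto)
        moreover have "Vx (fst (inc e)) \<in> VE" using ends_in_V 2(1) BE unfolding VE_def by auto
        ultimately show ?thesis by blast
      qed
    qed
    have "?c p q" if pq: "p \<in> T" "q \<in> T" for p q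
    proof -
      obtain u w where "u \<in> VE" "w \<in> VE" "?c u p" "?c w q" using to_VE pq by blast
      then show ?thesis using VE_c path_component_of_sym path_component_of_trans by metis
    qed
    then show ?thesis using sub unfolding path_connectedin_def path_connected_space_iff_path_component by auto
  qed
  ultimately have "top_spanning_tree V E inc T" unfolding top_spanning_tree_def using std VT by blast
  then show ?thesis using ET by blast
qed

lemma circuits_coindep: "circuits E fbs.coindep = {edge_set_of E X | X. is_circle V E inc X}"
  using circuit_is_circle circle_is_circuit by blast

lemma bases_coindep_trees: "bases fbs.coindep = {edge_set_of E T | T. top_spanning_tree V E inc T}"
  using base_is_tree tree_is_base by blast

end

theorem theorem3p2:
  fixes V :: "'v set" and E :: "'e set" and inc :: "'e \<Rightarrow> 'v \<times> 'v"
  assumes "graph V E inc" and "connected_graph V E inc"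
  shows "\<exists>\<I>. matroid E \<I> \<and>
      circuits E \<I> = {edge_set_of E X | X. is_circle V E inc X} \<and>
      bases \<I> = {edge_set_of E T | T. top_spanning_tree V E inc T} \<and>
      (\<exists>\<J>. matroid E \<J> \<and> circuits E \<J> = {D. finite D \<and> bond V E inc D} \<and>
            bases \<I> = {E - B | B. B \<in> bases \<J>})"
proof -
  interpret conn_graph V E inc by unfold_locales (rule assms)+
  show ?thesis
  proof (intro exI conjI)
    show "matroid E fbs.coindep" by (rule fbs.matroid_coindep)
    show "circuits E fbs.coindep = {edge_set_of E X | X. is_circle V E inc X}" by (rule circuits_coindep)
    show "bases fbs.coindep = {edge_set_of E T | T. top_spanning_tree V E inc T}" by (rule bases_coindep_trees)
    show "matroid E fbs.indep" by (rule fbs.matroid_indep)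
    show "circuits E fbs.indep = {D. finite D \<and> bond V E inc D}" by (rule circuits_indep)
    show "bases fbs.coindep = {E - B | B. B \<in> bases fbs.indep}" by (rule fbs.bases_coindep)
  qed
qed

end
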